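(* Let $n\ge 1$, let $(k_1,\dots,k_n)$ be a weak composition of $n$, and let $1\le r\le n$. Let $[z_b:z_c:z_1:z_2:\cdots:z_{r-1}]$ be the projective coordinates of the $\mathbb{P}^r$ factor in $\mathbb{P}^1\times\cdots\times\mathbb{P}^n$. Then for every boundary point in $\mathrm{Tour}(k_1,\dots,k_n)$, the $\mathbb{P}^r$ component of its image under $\Phi_n$ lies on all of the $k_r$ hyperplanes $$z_b=0,\quad z_c=0,\quad z_1=0,\quad\ldots,\quad z_{k_r-2}=0,$$ where if $k_r=1$ the collection consists only of the hyperplane $z_b=0$, if $k_r=2$ it consists only of $z_b=0$ and $z_c=0$, and if $k_r=0$ it is empty.
   Context: **Weak compositions.** A weak composition $(k_1,\dots,k_n)$ of $n$ here means a sequence of $n$ nonnegative integers with sum $n$. **The iterated Kapranov embedding.** Let $X=\{a,b,c,1,\dots,n\}$ and let $\overline{M}_{0,X}\cong\overline{M}_{0,n+3}$ be the Deligne–Mumford moduli space of stable genus $0$ curves with $n+3$ marked points labeled by $X$; let $M_{0,X}$ be its interior (smooth curves). The Kapranov morphism $|\psi_n|:\overline{M}_{0,X}\to\mathbb{P}^n$ is the map given by the complete linear system of the line bundle $\mathbb{L}_n$ whose fiber at a curve $C$ is the cotangent space of $C$ at the marked point $n$. Using projective coordinates $[z_b:z_c:z_1:\cdots:z_{n-1}]$ on $\mathbb{P}^n$, it is the unique morphism that on the interior sends $C\cong\mathbb{P}^1$ with marked points $p_a,p_b,p_c,p_1,\dots,p_n$, in coordinates with $p_a=0$, $p_n=\infty$,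 to $[p_b:p_c:p_1:\cdots:p_{n-1}]$. Let $\pi_i$ be the map forgetting the $i$-th marked point (and stabilizing). Then $\Phi_n:\overline{M}_{0,X}\hookrightarrow\mathbb{P}^1\times\mathbb{P}^2\times\cdots\times\mathbb{P}^n$ is the closed embedding whose $r$-th factor is $|\psi_r|\circ\pi_{r+1}\circ\cdots\circ\pi_n$, where $|\psi_r|:\overline{M}_{0,\{a,b,c,1,\dots,r\}}\to\mathbb{P}^r$ is the analogous map in coordinates $[z_b:z_c:z_1:\cdots:z_{r-1}]$. **Trees and boundary points.** Order the labels by $a<b<c<1<2<\cdots<n$. A trivalent tree is a finite tree in which every vertex has degree $1$ or $3$ and at least one vertex has degree $3$. It is leaf-labeled by $X$ if its leaves are in bijection with $X$; such trees are considered up to label-preserving isomorphism. A leaf edge is an edge incident to a leaf. The dual tree of a stable curve has an unlabeled vertex for each irreducible component, a vertex labeled $i$ for each $i\in X$ joined to the component containing the marked point $i$, and an edge joining two components meeting at a node. A trivalent tree leaf-labeled by $X$ is identified with the unique point of $\overline{M}_{0,X}$ (a boundary point) having that dual tree. **Lazy tournament** of a leaf-labeled trivalent tree $T$: a labeling of the edges of $T$ computed as follows. Label each leaf edge by the label of its leaf. Then repeat the following round until all edges are labeled. (1) Among all pairs of labeled edges $(i,j)$ (written by their labels, with $i<j$) that share a vertex whose third edge $E$ is unlabeled, choose the pair with the largest value of $i$; $i$ and $j$ face off (compete) in this round. (2) The larger label $j$ wins the round and the smaller label $i$ loses it. (3) If $E$ is adjacent to a labeled edge with label $u\ne j$ and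 $u>i$, label $E$ by $i$ ($i$ advances); this is the laziness rule. Otherwise label $E$ by $j$ ($j$ advances). **Tour.** $\mathrm{Tour}(k_1,\dots,k_n)$ is the set of trivalent trees with leaves labeled by $X$ (viewed as boundary points) in which the leaf edges $a$ and $b$ share a vertex, and each label $i\in\{1,\dots,n\}$ wins exactly $k_i$ rounds of the lazy tournament. *)

theory Defs
  imports "HOL-Analysis.Analysis"
begin

section \<open>Labels\<close>

text \<open>
  The labels \<open>a, b, c, 1, \<dots>, n\<close> are encoded as the integers \<open>-2, -1, 0, 1, \<dots>, n\<close>, so that the
  order \<open>a < b < c < 1 < \<dots> < n\<close> is the order of the integers.
\<close>

type_synonym label = int

abbreviation label_a :: label where "label_a \<equiv> -2"
abbreviation label_b :: label where "label_b \<equiv> -1"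
abbreviation label_c :: label where "label_c \<equiv> 0"

definition labels :: "nat \<Rightarrow> label set" where
  "labels n = {label_a, label_b, label_c} \<union> {1..int n}"


section \<open>Trees\<close>

text \<open>Edges are two-element sets of vertices.\<close>

definition reach :: "'v set set \<Rightarrow> 'v \<Rightarrow> 'v \<Rightarrow> bool" where
  "reach E u v \<longleftrightarrow> (u, v) \<in> {(x, y). {x, y} \<in> E}\<^sup>*"

definition is_cycle :: "'v set set \<Rightarrow> 'v list \<Rightarrow> bool" where
  "is_cycle E p \<longleftrightarrow> 3 \<le> length p \<and> distinct p \<and>
     (\<forall>i<length p. {p ! i, p ! (Suc i mod length p)} \<in> E)"

definition is_tree :: "'v set \<Rightarrow> 'v set set \<Rightarrow> bool" where
  "is_tree V E \<longleftrightarrow> finite V \<and> V \<noteq> {} \<and> (\<forall>e\<in>E. \<exists>u\<in>V. \<exists>v\<in>V. u \<noteq> v \<and> e = {u, v}) \<and>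
     (\<forall>u\<in>V. \<forall>v\<in>V. reach E u v) \<and> (\<nexists>p. is_cycle E p)"

record 'v ltree =
  verts :: "'v set"
  edges :: "'v set set"
  leaf  :: "label \<Rightarrow> 'v"

definition edges_at :: "'v ltree \<Rightarrow> 'v \<Rightarrow> 'v set set" where
  "edges_at T v = {e \<in> edges T. v \<in> e}"

definition trivalent :: "'v ltree \<Rightarrow> bool" where
  "trivalent T \<longleftrightarrow> is_tree (verts T) (edges T) \<and>
     (\<forall>v\<in>verts T. card (edges_at T v) \<in> {1, 3}) \<and> (\<exists>v\<in>verts T. card (edges_at T v) = 3)"

definition leaf_labeled :: "label set \<Rightarrow> 'v ltree \<Rightarrow> bool" where
  "leaf_labeled X T \<longleftrightarrow> bij_betw (leaf T) X {v \<in> verts T. card (edges_at T v) = 1}"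

definition ltree_iso :: "label set \<Rightarrow> 'v ltree \<Rightarrow> 'w ltree \<Rightarrow> bool" where
  "ltree_iso X T T' \<longleftrightarrow> (\<exists>h. bij_betw h (verts T) (verts T') \<and> edges T' = (\<lambda>e. h ` e) ` edges T \<and>
     (\<forall>x\<in>X. h (leaf T x) = leaf T' x))"


section \<open>Lazy tournament\<close>

type_synonym 'v labeling = "'v set \<Rightarrow> label option"

definition initial_labeling :: "label set \<Rightarrow> 'v ltree \<Rightarrow> 'v labeling" where
  "initial_labeling X T = (\<lambda>e. if e \<in> edges T \<and> (\<exists>x\<in>X. leaf T x \<in> e)
     then Some (THE x. x \<in> X \<and> leaf T x \<in> e) else None)"

definition can_face_off ::
    "'v ltree \<Rightarrow> 'v labeling \<Rightarrow> label \<Rightarrow> label \<Rightarrow> 'v set \<Rightarrow> bool" where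
  "can_face_off T L i j g \<longleftrightarrow> i < j \<and> (\<exists>v\<in>verts T. \<exists>e f. edges_at T v = {e, f, g} \<and>
     e \<noteq> f \<and> e \<noteq> g \<and> f \<noteq> g \<and> L e = Some i \<and> L f = Some j \<and> L g = None)"

text \<open>
  One round, in which \<open>i < j\<close> compete, so that \<open>j\<close> wins; one of them advances to the edge \<open>g\<close>.
\<close>

definition lazy_round ::
    "'v ltree \<Rightarrow> 'v labeling \<Rightarrow> label \<Rightarrow> label \<Rightarrow> 'v labeling \<Rightarrow> bool" where
  "lazy_round T L i j L' \<longleftrightarrow> (\<exists>g. can_face_off T L i j g \<and>
     (\<forall>i' j' g'. can_face_off T L i' j' g' \<longrightarrow> i' \<le> i) \<and>
     L' = L(g \<mapsto> (if \<exists>h\<in>edges T. \<exists>u. h \<noteq> g \<and> h \<inter> g \<noteq> {} \<and> L h = Some u \<and> u \<noteq> j \<and> u > i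
                  then i else j)))"

text \<open>\<open>tournament X T L ws\<close>: some rounds lead to the labeling \<open>L\<close>; \<open>ws\<close> lists their winners.\<close>

inductive tournament :: "label set \<Rightarrow> 'v ltree \<Rightarrow> 'v labeling \<Rightarrow> label list \<Rightarrow> bool"
  for X :: "label set" and T :: "'v ltree" where
  start: "tournament X T (initial_labeling X T) []"
| round: "tournament X T L ws \<Longrightarrow> lazy_round T L i j L' \<Longrightarrow> tournament X T L' (j # ws)"

definition tour :: "nat \<Rightarrow> (nat \<Rightarrow> nat) \<Rightarrow> 'v ltree set" where
  "tour n k = {T. trivalent T \<and> leaf_labeled (labels n) T \<and>
     (\<exists>v\<in>verts T. {leaf T label_a, v} \<in> edges T \<and> {leaf T label_b, v} \<in> edges T) \<and>
     (\<exists>L ws. tournament (labels n) T L ws \<and> (\<forall>e\<in>edges T. L e \<noteq> None) \<and>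
        (\<forall>i\<in>{1..n}. count_list ws (int i) = k i))}"


section \<open>Complex projective spaces\<close>

text \<open>
  Coordinates are indexed by a finite set \<open>I\<close> of integers; a vector vanishes outside \<open>I\<close>.  A point is
  the set of all its homogeneous coordinate vectors, and the topology is the quotient topology.
\<close>

type_synonym vec = "int \<Rightarrow> complex"
type_synonym point = "vec set"

definition vecs :: "int set \<Rightarrow> vec set" where
  "vecs I = {v. (\<forall>i. i \<notin> I \<longrightarrow> v i = 0) \<and> (\<exists>i. v i \<noteq> 0)}"

definition proj_pt :: "vec \<Rightarrow> point" where
  "proj_pt v = {(\<lambda>i. t * v i) |t. t \<noteq> 0}"

definition proj_space :: "int set \<Rightarrow> point set" where
  "proj_space I = proj_pt ` vecs I"

definition proj_topology :: "int set \<Rightarrow> point topology" where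
  "proj_topology I = topology (\<lambda>U. U \<subseteq> proj_space I \<and>
     openin (top_of_set (vecs I)) {v \<in> vecs I. proj_pt v \<in> U})"

abbreviation P1 :: "point set" where "P1 \<equiv> proj_space {0, 1}"

definition vec2 :: "complex \<Rightarrow> complex \<Rightarrow> vec" where
  "vec2 s t = (\<lambda>i. if i = 0 then s else if i = 1 then t else 0)"

definition affine_pt :: "complex \<Rightarrow> point" where
  "affine_pt z = proj_pt (vec2 z 1)"

definition infinity_pt :: point where
  "infinity_pt = proj_pt (vec2 1 0)"

definition moebius :: "(point \<Rightarrow> point) set" where
  "moebius = {(\<lambda>p. (\<lambda>v. vec2 (\<alpha> * v 0 + \<beta> * v 1) (\<gamma> * v 0 + \<delta> * v 1)) ` p)
     |\<alpha> \<beta> \<gamma> \<delta>. \<alpha> * \<delta> - \<beta> * \<gamma> \<noteq> 0}"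

text \<open>
  The homogeneous form of \<open>(p - s)(q - t) / ((p - t)(q - s))\<close>, valid also at infinity and whenever no
  three of the four points coincide.
\<close>

definition cross_ratio :: "point \<Rightarrow> point \<Rightarrow> point \<Rightarrow> point \<Rightarrow> point" where
  "cross_ratio p q s t = (let D = (\<lambda>x y. let v = (SOME v. v \<in> x); w = (SOME w. w \<in> y)
       in v 0 * w 1 - v 1 * w 0)
     in proj_pt (vec2 (D p s * D q t) (D p t * D q s)))"


section \<open>Stable curves of genus 0\<close>

text \<open>
  A connected nodal curve of arithmetic genus 0 is a tree of projective lines.  The components are
  indexed by natural numbers, and \<open>nodes\<close> is the set of pairs \<open>{v, w}\<close> of components that meet, namely
  at the point \<open>node_pt v w\<close> of \<open>v\<close>, which is identified with the point \<open>node_pt w v\<close> of \<open>w\<close>.  The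
  label \<open>x\<close> marks the point \<open>mark_pt x\<close> of the component \<open>mark_comp x\<close>.
\<close>

record curve =
  comps :: "nat set"
  nodes :: "nat set set"
  node_pt :: "nat \<Rightarrow> nat \<Rightarrow> point"
  mark_comp :: "label \<Rightarrow> nat"
  mark_pt :: "label \<Rightarrow> point"

definition nodes_on :: "curve \<Rightarrow> nat \<Rightarrow> nat set" where
  "nodes_on C v = {w. {v, w} \<in> nodes C}"

definition marks_on :: "label set \<Rightarrow> curve \<Rightarrow> nat \<Rightarrow> label set" where
  "marks_on X C v = {x \<in> X. mark_comp C x = v}"

definition n_special :: "label set \<Rightarrow> curve \<Rightarrow> nat \<Rightarrow> nat" where
  "n_special X C v = card (nodes_on C v) + card (marks_on X C v)"

definition stable_curve :: "label set \<Rightarrow> curve \<Rightarrow> bool" where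
  "stable_curve X C \<longleftrightarrow> is_tree (comps C) (nodes C) \<and> (\<forall>x\<in>X. mark_comp C x \<in> comps C) \<and>
     (\<forall>v\<in>comps C.
        node_pt C v ` nodes_on C v \<subseteq> P1 \<and> mark_pt C ` marks_on X C v \<subseteq> P1 \<and>
        inj_on (node_pt C v) (nodes_on C v) \<and> inj_on (mark_pt C) (marks_on X C v) \<and>
        node_pt C v ` nodes_on C v \<inter> mark_pt C ` marks_on X C v = {} \<and>
        3 \<le> n_special X C v)"

definition curve_iso :: "label set \<Rightarrow> (curve \<times> curve) set" where
  "curve_iso X = {(C, D). stable_curve X C \<and> stable_curve X D \<and>
     (\<exists>h \<phi>. bij_betw h (comps C) (comps D) \<and> nodes D = (\<lambda>e. h ` e) ` nodes C \<and>
        (\<forall>v\<in>comps C. \<phi> v \<in> moebius \<and>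
           (\<forall>w\<in>nodes_on C v. node_pt D (h v) (h w) = \<phi> v (node_pt C v w))) \<and>
        (\<forall>x\<in>X. mark_comp D x = h (mark_comp C x) \<and>
           mark_pt D x = \<phi> (mark_comp C x) (mark_pt C x)))}"

definition dual_tree :: "label set \<Rightarrow> curve \<Rightarrow> (nat + label) ltree" where
  "dual_tree X C = \<lparr>verts = Inl ` comps C \<union> Inr ` X,
     edges = {{Inl v, Inl w} |v w. {v, w} \<in> nodes C} \<union> {{Inr x, Inl (mark_comp C x)} |x. x \<in> X},
     leaf = Inr\<rparr>"


section \<open>The moduli space\<close>

definition moduli :: "label set \<Rightarrow> curve set set" where
  "moduli X = {C. stable_curve X C} // curve_iso X"

text \<open>
  \<open>proj_to C v x\<close> is the point of \<open>v\<close> to which the marked point \<open>x\<close> is contracted when all other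
  components are contracted: the marked point itself or the node of \<open>v\<close> through which it is reached.
\<close>

definition proj_to :: "curve \<Rightarrow> nat \<Rightarrow> label \<Rightarrow> point" where
  "proj_to C v x = (if mark_comp C x = v then mark_pt C x else
     node_pt C v (THE w. w \<in> nodes_on C v \<and> reach {e \<in> nodes C. v \<notin> e} w (mark_comp C x)))"

text \<open>
  The cross-ratio of four marked points of a stable curve is taken on a component on which they have
  at least three different images.  There may be two such components, namely if the curve separates
  the four points into two pairs, but then both give the same one of the values 0, 1, infinity.
\<close>

definition curve_cross_ratio :: "curve \<Rightarrow> label \<times> label \<times> label \<times> label \<Rightarrow> point" where
  "curve_cross_ratio C = (\<lambda>(x, y, s, t).
     let v = (SOME v. v \<in> comps C \<and> 3 \<le> card (proj_to C v ` {x, y, s, t}))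
     in cross_ratio (proj_to C v x) (proj_to C v y) (proj_to C v s) (proj_to C v t))"

definition quadruples :: "label set \<Rightarrow> (label \<times> label \<times> label \<times> label) set" where
  "quadruples X = {(x, y, s, t). {x, y, s, t} \<subseteq> X \<and> distinct [x, y, s, t]}"

text \<open>
  The (analytic) topology of the moduli space is the one induced by the family of all cross-ratios
  of four marked points, which embeds the moduli space as a closed subset of a product of projective
  lines (McDuff and Salamon, J-holomorphic curves and symplectic topology, Appendix D).
  The choice of a representative of the isomorphism class does not matter, here and in \<open>forget\<close>.
\<close>

definition moduli_topology :: "label set \<Rightarrow> curve set topology" where
  "moduli_topology X = pullback_topology (moduli X)
     (\<lambda>P. \<lambda>q\<in>quadruples X. curve_cross_ratio (SOME C. C \<in> P) q)
     (product_topology (\<lambda>_. proj_topology {0, 1}) (quadruples X))"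

text \<open>
  The point of the moduli space that is identified with a trivalent tree \<open>T\<close> is the one with
  \<open>has_dual_tree X P T\<close>.
\<close>

definition has_dual_tree :: "label set \<Rightarrow> curve set \<Rightarrow> 'v ltree \<Rightarrow> bool" where
  "has_dual_tree X P T \<longleftrightarrow> P \<in> moduli X \<and> (\<exists>C\<in>P. ltree_iso X (dual_tree X C) T)"


section \<open>Forgetting a marked point\<close>

text \<open>
  The component \<open>v\<close> of the marked point \<open>i\<close> becomes unstable if it has exactly three special points.
  It is then contracted: if the two others are nodes, these two nodes become one; if they are a node
  and a marked point \<open>x\<close>, then \<open>x\<close> moves to the point of the neighbouring component at the node.
  (They are two marked points only if there are just three labels.)
\<close>

definition forget_curve :: "label set \<Rightarrow> label \<Rightarrow> curve \<Rightarrow> curve" where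
  "forget_curve X i C = (let v = mark_comp C i; w = (SOME w. w \<in> nodes_on C v) in
     if 3 < n_special X C v then C
     else \<lparr>comps = comps C - {v},
       nodes = {e \<in> nodes C. v \<notin> e} \<union> {{u, u'} |u u'. u \<noteq> u' \<and> u \<in> nodes_on C v \<and> u' \<in> nodes_on C v},
       node_pt = (\<lambda>u u'. if {u, u'} \<in> nodes C then node_pt C u u' else node_pt C u v),
       mark_comp = (\<lambda>x. if mark_comp C x = v then w else mark_comp C x),
       mark_pt = (\<lambda>x. if mark_comp C x = v then node_pt C w v else mark_pt C x)\<rparr>)"

definition forget :: "nat \<Rightarrow> curve set \<Rightarrow> curve set" where
  "forget m P = curve_iso (labels (m - 1)) `` {forget_curve (labels m) (int m) (SOME C. C \<in> P)}"


section \<open>The iterated Kapranov embedding\<close>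

text \<open>The labels \<open>b, c, 1, \<dots>, r - 1\<close>, which index the coordinates of the \<open>r\<close>-th factor.\<close>

definition coords :: "nat \<Rightarrow> int set" where
  "coords r = {label_b, label_c} \<union> {1..int r - 1}"

text \<open>
  The Kapranov morphism is determined as a continuous map by its values on the interior, which is
  dense: on a projective line with coordinates such that the marked point \<open>a\<close> is \<open>0\<close> and the
  marked point \<open>r\<close> is infinity, these are given by the coordinates of the remaining marked points.
\<close>

definition kapranov_morphism :: "nat \<Rightarrow> (curve set \<Rightarrow> point) \<Rightarrow> bool" where
  "kapranov_morphism r \<psi> \<longleftrightarrow>
     continuous_map (moduli_topology (labels r)) (proj_topology (coords r)) \<psi> \<and>
     (\<forall>P\<in>moduli (labels r). \<forall>C\<in>P. \<forall>p :: label \<Rightarrow> complex.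
        card (comps C) = 1 \<and> mark_pt C (int r) = infinity_pt \<and>
        (\<forall>x\<in>labels r - {int r}. mark_pt C x = affine_pt (p x)) \<and> p label_a = 0 \<longrightarrow>
        \<psi> P = proj_pt (\<lambda>j. if j \<in> coords r then p j else 0))"

text \<open>
  The \<open>r\<close>-th component of \<open>Phi n \<psi>\<close> is \<open>\<psi> r \<circ> forget (r + 1) \<circ> \<dots> \<circ> forget n\<close>.
\<close>

definition Phi :: "nat \<Rightarrow> (nat \<Rightarrow> curve set \<Rightarrow> point) \<Rightarrow> curve set \<Rightarrow> nat \<Rightarrow> point" where
  "Phi n \<psi> P = (\<lambda>r\<in>{1..n}. \<psi> r (foldr forget [Suc r..<Suc n] P))"

definition coord_hyperplane :: "nat \<Rightarrow> int \<Rightarrow> point set" where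
  "coord_hyperplane r j = {proj_pt v |v. v \<in> vecs (coords r) \<and> j \<in> coords r \<and> v j = 0}"

end

theory Submission
  imports Defs "HOL-Library.Transitive_Closure_Table"
begin

text \<open>
  Two facts meet in the theorem, one on the geometry of the Kapranov morphism and one on tournaments; both are about the
  branches at a vertex, the classes of labels that are seen from it in the same direction.

  Geometry: let \<open>Q\<close> be a boundary point with labels \<open>a, b, c, 1, \<dots>, r\<close> and let \<open>v\<close> be the component of \<open>r\<close>.  If \<open>j\<close> and \<open>a\<close> are
  in the same branch at \<open>v\<close>, then \<open>z\<^sub>j\<close> vanishes at the image of \<open>Q\<close> (\<open>kapranov_hyperplane\<close>).  Since the morphism is only
  known on smooth curves, \<open>Q\<close> is written as a limit of smooth curves.  With the mark \<open>r\<close> at infinity, the labels beyond a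
  vertex become a cluster whose diameter is a power of \<open>\<epsilon>\<close>, with the larger exponent the deeper the vertex lies, so that a
  four-point condition on the exponents (\<open>four_points\<close>) gives the limits of all cross-ratios; these are the ones of \<open>Q\<close>, and
  they determine the topology of the moduli space (\<open>smoothing_limit\<close>).  In the limit the difference of \<open>j\<close> and \<open>a\<close> is
  infinitely small compared with that of \<open>l\<close> and \<open>a\<close>, for any \<open>l\<close> in the third branch at \<open>v\<close>.

  Tournaments: laziness keeps the losers from increasing in the course of a tournament (\<open>losers_decrease\<close>).  The rounds run from
  the leaves towards the vertex of \<open>a\<close> and \<open>b\<close>, and the labels beaten by \<open>r\<close> come from disjoint parts of the tree.  Let \<open>t\<close> be
  a vertex of the tree that separates \<open>r\<close> and \<open>s\<close> from \<open>a\<close>, such that the branch of \<open>r\<close> at \<open>t\<close> contains no label smaller than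
  \<open>r\<close>.  Then \<open>r\<close> wins only at \<open>t\<close> or above it, and not before \<open>s\<close> takes part in a round, whose loser is at most \<open>s\<close>.  Hence
  \<open>r\<close> beats different labels among \<open>0, \<dots>, s\<close>, and wins at most \<open>s + 1\<close> times (\<open>wins_le\<close>).

  To combine them, note that forgetting a marked point does not change the branches at the components that remain
  (\<open>F_proj_to_eq\<close>).  So the component of \<open>r\<close> after forgetting \<open>r + 1, \<dots>, n\<close> comes from a vertex \<open>t\<close> of the tree, at which no
  smaller label is in the branch of \<open>r\<close>.  If \<open>j\<close> and \<open>a\<close> were in different branches there, \<open>r\<close> would win at most \<open>j + 1\<close> times,
  but \<open>j \<le> k r - 2\<close>.
\<close>

section \<open>Trees and their branches\<close>

lemma reach_refl [simp]: "reach E x x"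
  by (simp add: reach_def)

lemma reach_edge: "{x, y} \<in> E \<Longrightarrow> reach E x y"
  by (auto simp: reach_def)

lemma reach_trans: "reach E x y \<Longrightarrow> reach E y z \<Longrightarrow> reach E x z"
  unfolding reach_def by (rule rtrancl_trans)

lemma reach_sym: "reach E x y \<Longrightarrow> reach E y x"
  unfolding reach_def
  by (rule symD[OF sym_rtrancl]) (auto simp: sym_def insert_commute)

lemma reach_induct [consumes 1, case_names refl step]:
  assumes "reach E x y" "P x" "\<And>y z. reach E x y \<Longrightarrow> {y, z} \<in> E \<Longrightarrow> P y \<Longrightarrow> P z"
  shows "P y"
  using assms(1) unfolding reach_def
  by (induction rule: rtrancl_induct) (use assms(2,3) in \<open>auto simp: reach_def\<close>)

lemma reach_map:
  assumes "reach E x y" and "\<And>x y. {x, y} \<in> E \<Longrightarrow> reach F (f x) (f y)"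
  shows "reach F (f x) (f y)"
  using assms(1) by (induction rule: reach_induct) (auto intro: reach_trans assms(2))

lemma reach_mono: "reach E x y \<Longrightarrow> E \<subseteq> F \<Longrightarrow> reach F x y"
  by (rule reach_map[where f = "\<lambda>x. x"]) (auto intro: reach_edge)

text \<open>
  The branches at \<open>v\<close> are the components of the graph without \<open>v\<close>; \<open>v\<close> is a class of its own.
\<close>
definition linked :: "'v set set \<Rightarrow> 'v \<Rightarrow> 'v \<Rightarrow> 'v \<Rightarrow> bool" where
  "linked E v x y \<longleftrightarrow> reach {e \<in> E. v \<notin> e} x y"

lemma linked_refl [simp]: "linked E v x x"
  by (simp add: linked_def)

lemma linked_edge: "{x, y} \<in> E \<Longrightarrow> v \<noteq> x \<Longrightarrow> v \<noteq> y \<Longrightarrow> linked E v x y"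
  unfolding linked_def by (rule reach_edge) auto

lemma linked_trans: "linked E v x y \<Longrightarrow> linked E v y z \<Longrightarrow> linked E v x z"
  unfolding linked_def by (rule reach_trans)

lemma linked_sym: "linked E v x y \<Longrightarrow> linked E v y x"
  unfolding linked_def by (rule reach_sym)

lemma linked_imp_reach: "linked E v x y \<Longrightarrow> reach E x y"
  unfolding linked_def by (rule reach_mono) auto

lemma linked_induct [consumes 1, case_names refl step]:
  assumes "linked E v x y" "P x"
    and "\<And>y z. linked E v x y \<Longrightarrow> {y, z} \<in> E \<Longrightarrow> y \<noteq> v \<Longrightarrow> z \<noteq> v \<Longrightarrow> P y \<Longrightarrow> P z"
  shows "P y"
  using assms(1) unfolding linked_def
  by (induction rule: reach_induct) (use assms(2,3) in \<open>auto simp: linked_def\<close>)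

lemma linked_map:
  assumes "linked E v x y"
    and "\<And>x y. {x, y} \<in> E \<Longrightarrow> x \<noteq> v \<Longrightarrow> y \<noteq> v \<Longrightarrow> linked F w (f x) (f y)"
  shows "linked F w (f x) (f y)"
  using assms(1) by (induction rule: linked_induct) (auto intro: linked_trans assms(2))

lemma linked_self: "linked E v v y \<longleftrightarrow> y = v"
proof
  assume "linked E v v y"
  then show "y = v"
    by (induction rule: linked_induct) auto
qed auto

text \<open>
  Follow a walk from \<open>v\<close> to \<open>u\<close> after its last visit to \<open>v\<close>: if it avoids \<open>w\<close>, it links \<open>u\<close> and \<open>v\<close> there; otherwise it links
  \<open>w\<close> and \<open>u\<close> without meeting \<open>v\<close> again.  So two vertices see each other in opposite directions.
\<close>
lemma linked_or_linked:
  assumes "reach E v u" "v \<noteq> w"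
  shows "linked E v u w \<or> linked E w u v"
  using assms(1)
proof (induction rule: reach_induct)
  case (step y z)
  have "linked E v z y" if "v \<noteq> y" "v \<noteq> z"
    using step(2) that by (intro linked_edge) (auto simp: insert_commute)
  moreover have "linked E w z y" if "w \<noteq> y" "w \<noteq> z"
    using step(2) that by (intro linked_edge) (auto simp: insert_commute)
  moreover have "linked E v y w \<Longrightarrow> y \<noteq> v" "linked E w y v \<Longrightarrow> y \<noteq> w"
    using assms(2) by (auto simp: linked_self)
  ultimately show ?case
    using step.IH by (cases "z = v"; cases "z = w") (auto intro: linked_trans)
qed (use assms in auto)

locale tree =
  fixes V :: "'v set" and E :: "'v set set"
  assumes is_tree: "is_tree V E"
begin

lemma finite_V: "finite V"
  and connected: "x \<in> V \<Longrightarrow> y \<in> V \<Longrightarrow> reach E x y"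
  using is_tree by (auto simp: is_tree_def)

lemma edgeE:
  assumes "e \<in> E"
  obtains x y where "e = {x, y}" "x \<in> V" "y \<in> V" "x \<noteq> y"
  using is_tree assms unfolding is_tree_def by metis

lemma edgeD: "{x, y} \<in> E \<Longrightarrow> x \<noteq> y \<and> x \<in> V \<and> y \<in> V"
  by (erule edgeE) (auto simp: doubleton_eq_iff)

lemma linked_neq: "linked E v x y \<Longrightarrow> x \<noteq> v \<Longrightarrow> y \<noteq> v"
  using linked_self linked_sym by metis

text \<open>A walk that joins two neighbours of \<open>v\<close> and avoids \<open>v\<close> would close up to a cycle through \<open>v\<close>.\<close>
lemma linked_neighbours:
  assumes "{v, w} \<in> E" "{v, w'} \<in> E" "linked E v w w'"
  shows "w = w'"
proof (rule ccontr)
  assume "w \<noteq> w'"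
  define R where "R x y \<longleftrightarrow> {x, y} \<in> E \<and> v \<notin> {x, y}" for x y
  have "R\<^sup>*\<^sup>* w w'"
    using assms(3)
    by (induction rule: linked_induct) (auto simp: R_def intro: rtranclp.rtrancl_into_rtrancl)
  then obtain xs0 where "rtrancl_path R w xs0 w'"
    by (auto simp: rtranclp_eq_rtrancl_path)
  then obtain xs where xs: "rtrancl_path R w xs w'" "distinct (w # xs)"
    by (rule rtrancl_path_distinct)
  have ne: "xs \<noteq> []"
    using xs(1) \<open>w \<noteq> w'\<close> by (auto elim: rtrancl_path.cases)
  have step: "R ((w # xs) ! i) (xs ! i)" if "i < length xs" for i
    using rtrancl_path_nth[OF xs(1) that] .
  have last: "xs ! (length xs - 1) = w'"
    using rtrancl_path_last[OF xs(1) ne] ne by (simp add: last_conv_nth)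
  have v: "v \<notin> set (w # xs)"
  proof -
    have "xs ! i \<noteq> v" if "i < length xs" for i
      using step[OF that] by (auto simp: R_def)
    then show ?thesis
      using edgeD[OF assms(1)] by (auto simp: in_set_conv_nth)
  qed
  let ?p = "v # w # xs"
  have "is_cycle E ?p"
    unfolding is_cycle_def
  proof (intro conjI allI impI)
    show "3 \<le> length ?p"
      using ne by (cases xs) auto
    show "distinct ?p"
      using v xs(2) by auto
    fix i assume "i < length ?p"
    then consider "i = 0" | k where "i = Suc k" "k < length xs" | "i = Suc (length xs)"
      by (cases i) (auto simp: less_Suc_eq)
    then show "{?p ! i, ?p ! (Suc i mod length ?p)} \<in> E"
    proof cases
      case 3
      then have "?p ! i = w'"
        using last ne by (auto simp: nth_Cons split: nat.splits)
      then show ?thesis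
        using 3 assms(2) by (simp add: insert_commute)
    qed (use assms(1) step in \<open>auto simp: R_def\<close>)
  qed
  then show False
    using is_tree by (auto simp: is_tree_def)
qed

lemma linked_neighbourE:
  assumes "v \<in> V" "u \<in> V" "u \<noteq> v"
  obtains w where "{v, w} \<in> E" "linked E v w u"
proof -
  have "u = v \<or> (\<exists>w. {v, w} \<in> E \<and> linked E v w u)"
    using connected[OF assms(1,2)]
  proof (induction rule: reach_induct)
    case (step y z)
    show ?case
    proof (cases "z = v \<or> y = v")
      case True
      then show ?thesis
        using step(2) by auto
    next
      case False
      then have "linked E v y z"
        using step(2) by (intro linked_edge) auto
      then show ?thesis
        using step.IH False linked_trans by metis
    qed
  qed auto
  then show thesis
    using that assms(3) by auto
qed

text \<open>
  By \<open>linked_or_linked\<close> every vertex is on one of the two sides of an edge; a vertex on both sides would link \<open>w\<close> to another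
  neighbour of \<open>v\<close>.
\<close>
lemma edge_separates:
  assumes "{v, w} \<in> E" "u \<in> V"
  shows "linked E v w u \<longleftrightarrow> \<not> linked E w v u"
proof
  assume l: "linked E v w u"
  show "\<not> linked E w v u"
  proof
    assume l': "linked E w v u"
    have vw: "v \<noteq> w" "v \<in> V" "w \<in> V"
      using edgeD[OF assms(1)] by auto
    have "u = v \<or> (\<exists>x. {v, x} \<in> E \<and> x \<noteq> w \<and> linked E v x u)"
      using l'
    proof (induction rule: linked_induct)
      case (step y z)
      show ?case
      proof (cases "z = v \<or> y = v")
        case True
        then show ?thesis
          using step(2,4) by auto
      next
        case False
        then have "linked E v y z"
          using step(2) by (intro linked_edge) auto
        then show ?thesis
          using step.IH False linked_trans by metis
      qed
    qed auto
    moreover have "u \<noteq> v"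
      using l vw linked_neq by metis
    ultimately obtain x where "{v, x} \<in> E" "x \<noteq> w" "linked E v x u"
      by auto
    then show False
      using linked_neighbours[OF assms(1), of x] l linked_trans linked_sym by metis
  qed
next
  assume "\<not> linked E w v u"
  then show "linked E v w u"
    using linked_or_linked[OF connected[of v u], of w] edgeD[OF assms(1)] assms(2) linked_sym by metis
qed

end

text \<open>
  The converse of \<open>linked_neighbours\<close>: it turns the cycles, which are lists, into a local condition that is easily
  transferred to another graph.
\<close>
lemma acyclicI:
  assumes "\<And>v w w'. {v, w} \<in> E \<Longrightarrow> {v, w'} \<in> E \<Longrightarrow> linked E v w w' \<Longrightarrow> w = w'"
  shows "\<nexists>p. is_cycle E p"
proof
  assume "\<exists>p. is_cycle E p"
  then obtain p where p: "3 \<le> length p" "distinct p"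
    "\<And>i. i < length p \<Longrightarrow> {p ! i, p ! (Suc i mod length p)} \<in> E"
    by (auto simp: is_cycle_def)
  have "linked E (p ! 0) (p ! 1) (p ! Suc i)" if "Suc i < length p" for i
    using that
  proof (induction i)
    case (Suc i)
    have "{p ! Suc i, p ! Suc (Suc i)} \<in> E"
      using p(3)[of "Suc i"] Suc.prems by simp
    moreover have "p ! 0 \<noteq> p ! Suc i" "p ! 0 \<noteq> p ! Suc (Suc i)"
      using Suc.prems nth_eq_iff_index_eq[OF p(2), of 0 "Suc i"]
        nth_eq_iff_index_eq[OF p(2), of 0 "Suc (Suc i)"] by linarith+
    ultimately have "linked E (p ! 0) (p ! Suc i) (p ! Suc (Suc i))"
      by (intro linked_edge)
    moreover have "linked E (p ! 0) (p ! 1) (p ! Suc i)"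
      using Suc by simp
    ultimately show ?case
      by (rule linked_trans[rotated])
  qed auto
  from this[of "length p - 2"] have "linked E (p ! 0) (p ! 1) (p ! (length p - 1))"
    using p(1) by (simp add: numeral_2_eq_2 Suc_diff_Suc)
  moreover have "{p ! 0, p ! 1} \<in> E"
  proof -
    have "0 < length p" "Suc 0 mod length p = 1"
      using p(1) by auto
    then show ?thesis
      using p(3)[of 0] by metis
  qed
  moreover have "{p ! 0, p ! (length p - 1)} \<in> E"
    using p(3)[of "length p - 1"] p(1) by (cases "length p") (simp_all add: insert_commute)
  ultimately have "p ! 1 = p ! (length p - 1)"
    using assms by blast
  then show False
    using p(1) nth_eq_iff_index_eq[OF p(2), of 1 "length p - 1"] by linarith
qed

section \<open>Rooted trees\<close>

text \<open>
  The tree is rooted at \<open>A\<close>.  Every edge is the parent edge of exactly one of its two ends, so statements about edges can be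
  phrased as statements about vertices.
\<close>
locale rooted_tree = tree V E
  for V :: "'v set" and E +
  fixes A :: 'v
  assumes A: "A \<in> V"
begin

definition below where "below u = {w \<in> V. \<not> linked E u w A}"

definition parent_edge where "parent_edge u = {u, THE p. {u, p} \<in> E \<and> linked E u p A}"

lemma belowI: "u \<in> V \<Longrightarrow> u \<noteq> A \<Longrightarrow> u \<in> below u"
  by (auto simp: below_def linked_self)

lemma root_notin_below: "A \<notin> below u"
  by (auto simp: below_def)

lemma below_V: "w \<in> below u \<Longrightarrow> w \<in> V"
  by (auto simp: below_def)

lemma parent_edgeI:
  assumes "{u, p} \<in> E" "linked E u p A"
  shows "parent_edge u = {u, p}"
proof -
  have "(THE p. {u, p} \<in> E \<and> linked E u p A) = p"
  proof (rule the_equality)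
    fix q assume q: "{u, q} \<in> E \<and> linked E u q A"
    then have "linked E u p q"
      using assms(2) linked_trans linked_sym by metis
    then show "q = p"
      using linked_neighbours[OF assms(1), of q] q by simp
  qed (use assms in simp)
  then show ?thesis
    by (simp add: parent_edge_def)
qed

lemma parentE:
  assumes "u \<in> V" "u \<noteq> A"
  obtains p where "{u, p} \<in> E" "linked E u p A" "parent_edge u = {u, p}"
  using linked_neighbourE[OF assms(1) A] assms(2) parent_edgeI by metis

lemma edge_cases:
  assumes "{v, w} \<in> E"
  obtains "parent_edge v = {v, w}" "v \<noteq> A" "w \<notin> below v" "linked E v w A"
  | "parent_edge w = {v, w}" "w \<noteq> A" "w \<in> below v" "\<not> linked E v w A" "linked E w v A"
proof (cases "linked E v w A")
  case True
  then have "v \<noteq> A"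
    using edgeD[OF assms] linked_neq by metis
  then show thesis
    using True that(1) parent_edgeI assms by (auto simp: below_def)
next
  case False
  then have "linked E w v A"
    using edge_separates[OF assms A] by simp
  moreover have "w \<noteq> A"
    using False by auto
  ultimately show thesis
    using False that(2) parent_edgeI[of w v] assms edgeD[OF assms]
    by (auto simp: below_def insert_commute)
qed

lemma parent_edge_inj:
  assumes "u \<in> V" "u \<noteq> A" "w \<in> V" "w \<noteq> A" "parent_edge u = parent_edge w"
  shows "u = w"
proof (rule ccontr)
  assume "u \<noteq> w"
  moreover obtain p where p: "{u, p} \<in> E" "linked E u p A" "parent_edge u = {u, p}"
    using parentE assms by metis
  moreover obtain q where q: "{w, q} \<in> E" "linked E w q A" "parent_edge w = {w, q}"
    using parentE assms by metis
  ultimately have "p = w" "q = u"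
    using assms(5) by (auto simp: doubleton_eq_iff)
  then show False
    using p q edge_separates[OF p(1) A] by simp
qed

text \<open>
  Since \<open>A\<close> and \<open>u\<close> are in the same branch at \<open>w\<close>, a vertex \<open>x\<close> below \<open>w\<close> is not linked to \<open>u\<close> there, and \<open>linked_or_linked\<close>
  applies.
\<close>
lemma linked_below:
  assumes "u \<in> V" "w \<in> below u" "w \<noteq> u" "x \<in> below w"
  shows "linked E u x w"
proof -
  have w: "\<not> linked E u w A" and x: "\<not> linked E w x A" and V: "x \<in> V"
    using assms by (auto simp: below_def)
  have "linked E w A u"
    using linked_or_linked[OF connected[OF assms(1) A], of w] assms(3) w linked_sym by metis
  then have "\<not> linked E w x u"
    using x linked_trans linked_sym by metis
  then show ?thesis
    using linked_or_linked[OF connected[OF assms(1) V], of w] assms(3) by auto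
qed

lemma below_mono:
  assumes "u \<in> V" "w \<in> below u"
  shows "below w \<subseteq> below u"
proof
  fix x assume "x \<in> below w"
  then show "x \<in> below u"
    using linked_below[OF assms, of x] assms(2) linked_trans[OF linked_sym, of E u x w A]
    by (cases "w = u") (auto simp: below_def)
qed

lemma below_antisym:
  assumes "u \<in> V" "w \<in> below u" "u \<in> below w"
  shows "u = w"
  using linked_below[OF assms(1,2) _ assms(3)] linked_self by metis

lemma below_nested:
  assumes "u \<in> V" "u \<noteq> A" "w \<in> V" "x \<in> below u" "x \<in> below w"
  shows "w \<in> below u \<or> u \<in> below w"
proof (rule ccontr)
  assume "\<not> ?thesis"
  then have *: "linked E u w A" "linked E w u A"
    using assms by (auto simp: below_def)
  have "u \<noteq> w"
    using * assms(2) linked_self by metis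
  then have "linked E u x w \<or> linked E w x u"
    using linked_or_linked[OF connected[of u x], of w] assms below_V by auto
  then show False
    using * assms(4,5) linked_trans[of E u x w A] linked_trans[of E w x u A]
    by (auto simp: below_def)
qed

lemma below_neighbour:
  assumes "u \<in> V" "u \<noteq> A" "x \<in> below u" "{x, y} \<in> E" "x \<noteq> u"
  shows "y \<in> below u"
proof (cases "y = u")
  case True
  then show ?thesis
    using assms belowI by simp
next
  case False
  then have "linked E u y x"
    using linked_edge[OF assms(4), of u] assms(5) linked_sym by metis
  then show ?thesis
    using assms(3) edgeD[OF assms(4)] linked_trans[OF linked_sym, of E u y x A] by (auto simp: below_def)
qed

lemma below_child:
  assumes "v \<in> V" "v \<noteq> A" "x \<in> below v" "x \<noteq> v"
  obtains w where "{v, w} \<in> E" "parent_edge w = {v, w}" "w \<noteq> A" "w \<in> below v" "x \<in> below w"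
proof -
  obtain w where w: "{v, w} \<in> E" "linked E v w x"
    using linked_neighbourE[of v x] assms below_V by metis
  then have "\<not> linked E v w A"
    using assms(3) linked_trans[OF linked_sym, of E v w x A] by (auto simp: below_def)
  then have *: "parent_edge w = {v, w}" "w \<noteq> A" "w \<in> below v" "linked E w v A"
    using edge_cases[OF w(1)] by metis+
  moreover have "\<not> linked E w v x"
    using edge_separates[OF w(1)] w(2) below_V[OF assms(3)] by simp
  then have "x \<in> below w"
    using *(4) below_V[OF assms(3)] linked_trans[OF _ linked_sym, of E w v A x]
    by (auto simp: below_def)
  ultimately show thesis
    using that w(1) by blast
qed

lemma children_disjoint:
  assumes "{v, w} \<in> E" "w \<in> below v" "{v, w'} \<in> E" "w' \<in> below v" "w \<noteq> w'"
  shows "below w \<inter> below w' = {}"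
proof (rule ccontr)
  assume "below w \<inter> below w' \<noteq> {}"
  then obtain x where x: "x \<in> below w" "x \<in> below w'"
    by auto
  have "v \<in> V" "v \<noteq> w" "v \<noteq> w'"
    using edgeD assms by auto
  then have "linked E v x w" "linked E v x w'"
    using linked_below[of v w x] linked_below[of v w' x] assms x by auto
  then show False
    using linked_neighbours[OF assms(1,3)] assms(5) linked_sym linked_trans by metis
qed

end

section \<open>The lazy tournament\<close>

lemma can_face_offI:
  assumes "i < j" "v \<in> verts T" "edges_at T v = {e, f, g}" "distinct [e, f, g]"
    and "L e = Some i" "L f = Some j" "L g = None"
  shows "can_face_off T L i j g"
  unfolding can_face_off_def
  by (rule conjI, fact, rule bexI[of _ v], rule exI[of _ e], rule exI[of _ f]) (use assms in auto)

lemma lazy_roundE: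
  assumes "lazy_round T L i j L'"
  obtains g x where "can_face_off T L i j g" "\<And>i' j' g'. can_face_off T L i' j' g' \<Longrightarrow> i' \<le> i"
    "L' = L(g \<mapsto> x)" "x = i \<or> x = j"
    "\<And>h u. x = j \<Longrightarrow> h \<in> edges T \<Longrightarrow> h \<noteq> g \<Longrightarrow> h \<inter> g \<noteq> {} \<Longrightarrow> L h = Some u \<Longrightarrow> u \<le> i \<or> u = j"
proof -
  obtain g where g: "can_face_off T L i j g \<and> (\<forall>i' j' g'. can_face_off T L i' j' g' \<longrightarrow> i' \<le> i) \<and>
    L' = L(g \<mapsto> (if \<exists>h\<in>edges T. \<exists>u. h \<noteq> g \<and> h \<inter> g \<noteq> {} \<and> L h = Some u \<and> u \<noteq> j \<and> u > i then i else j))"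
    using assms unfolding lazy_round_def by (elim exE)
  then have max: "i' \<le> i" if "can_face_off T L i' j' g'" for i' j' g'
    using that by blast
  have "i < j"
    using g by (simp add: can_face_off_def)
  show thesis
  proof (cases "\<exists>h\<in>edges T. \<exists>u. h \<noteq> g \<and> h \<inter> g \<noteq> {} \<and> L h = Some u \<and> u \<noteq> j \<and> u > i")
    case True
    then have "L' = L(g \<mapsto> i)"
      using g by (simp only: if_True)
    then show thesis
      using conjunct1[OF g] max \<open>i < j\<close> by (intro that[of g i]) simp_all
  next
    case False
    then have "L' = L(g \<mapsto> j)"
      using g by (simp only: if_False)
    then show thesis
      using conjunct1[OF g] max False by (intro that[of g j]) (simp_all, force)
  qed
qed

text \<open>
  This is where laziness enters.  A new face-off involves the newly labeled edge.  If the loser \<open>i\<close> has advanced to it, then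
  \<open>i\<close> bounds the next loser there.  The winner \<open>j\<close> advances only if all other labels that it meets are at most \<open>i\<close>.
\<close>
lemma losers_decrease:
  assumes "lazy_round T L i j L'" "can_face_off T L' i' j' g'"
  shows "i' \<le> i"
proof -
  from assms(1) obtain g x where g: "can_face_off T L i j g"
    and max: "\<And>i' j' g'. can_face_off T L i' j' g' \<Longrightarrow> i' \<le> i"
    and L': "L' = L(g \<mapsto> x)" and x: "x = i \<or> x = j"
    and lazy: "\<And>h u. x = j \<Longrightarrow> h \<in> edges T \<Longrightarrow> h \<noteq> g \<Longrightarrow> h \<inter> g \<noteq> {} \<Longrightarrow> L h = Some u \<Longrightarrow> u \<le> i \<or> u = j"
    by (rule lazy_roundE) blast
  have ij: "i < j"
    using g by (simp add: can_face_off_def)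
  from assms(2) obtain v e f where v: "i' < j'" "edges_at T v = {e, f, g'}" "e \<noteq> f" "e \<noteq> g'" "f \<noteq> g'"
    "L' e = Some i'" "L' f = Some j'" "L' g' = None" "v \<in> verts T"
    unfolding can_face_off_def by blast
  have "e \<in> edges_at T v" "f \<in> edges_at T v"
    using v(2) by auto
  then have inc: "e \<in> edges T" "f \<in> edges T" "e \<inter> f \<noteq> {}"
    by (auto simp: edges_at_def)
  have "L g' = None"
    using v(8) L' by (auto split: if_splits)
  consider "e \<noteq> g" "f \<noteq> g" | "e = g" | "f = g"
    by auto
  then show ?thesis
  proof cases
    case 1
    then have "can_face_off T L i' j' g'"
      using v L' \<open>L g' = None\<close> by (intro can_face_offI[of i' j' v T e f]) auto
    then show ?thesis
      by (rule max)
  next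
    case 2
    then have "L f = Some j'" "f \<noteq> g" "f \<inter> g \<noteq> {}" "x = i'"
      using v inc L' by auto
    then show ?thesis
      using lazy[of f j'] inc(2) v(1) x by auto
  next
    case 3
    then have "L e = Some i'" "e \<noteq> g" "e \<inter> g \<noteq> {}" "x = j'"
      using v inc L' by auto
    then show ?thesis
      using lazy[of e i'] inc(1) v(1) x ij by auto
  qed
qed

text \<open>
  The tree is rooted at the leaf \<open>a\<close>; its leaves \<open>a\<close> and \<open>b\<close> hang at \<open>R\<close>, the last vertex that other labels can reach.
\<close>
locale tournament_tree =
  fixes n :: nat and T :: "'v ltree" and R :: 'v
  assumes trivalent: "trivalent T" and leaf_labeled: "leaf_labeled (labels n) T"
    and R: "{leaf T label_a, R} \<in> edges T" "{leaf T label_b, R} \<in> edges T"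
begin

abbreviation "A \<equiv> leaf T label_a"
abbreviation "X \<equiv> labels n"

lemma labels_abc: "label_a \<in> X" "label_b \<in> X" "label_c \<in> X" and label_ge: "x \<in> X \<Longrightarrow> label_a \<le> x"
  by (auto simp: labels_def)

lemma leaves: "leaf T ` X = {v \<in> verts T. card (edges_at T v) = 1}"
  using leaf_labeled by (simp add: leaf_labeled_def bij_betw_def)

lemma leaf_V: "x \<in> X \<Longrightarrow> leaf T x \<in> verts T"
  and card_leaf: "x \<in> X \<Longrightarrow> card (edges_at T (leaf T x)) = 1"
  using imageI[of x X "leaf T"] by (simp_all add: leaves)

lemma leaf_eq: "x \<in> X \<Longrightarrow> y \<in> X \<Longrightarrow> leaf T x = leaf T y \<longleftrightarrow> x = y"
  using leaf_labeled unfolding leaf_labeled_def bij_betw_def by (metis inj_on_eq_iff)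

lemma leafE:
  assumes "v \<in> verts T" "card (edges_at T v) \<noteq> 3"
  obtains x where "x \<in> X" "v = leaf T x"
proof -
  have "v \<in> leaf T ` X"
    unfolding leaves using trivalent assms by (auto simp: trivalent_def)
  then show thesis
    using that by blast
qed

sublocale rooted_tree "verts T" "edges T" A
proof unfold_locales
  show "is_tree (verts T) (edges T)"
    using trivalent by (simp add: trivalent_def)
  show "A \<in> verts T"
    by (rule leaf_V, rule labels_abc)
qed

lemma leaf_neighbour:
  assumes "x \<in> X" "{leaf T x, p} \<in> edges T" "{leaf T x, q} \<in> edges T"
  shows "p = q"
proof -
  obtain e where "edges_at T (leaf T x) = {e}"
    using card_leaf[OF assms(1)] by (rule card_1_singletonE)
  moreover have "{leaf T x, p} \<in> edges_at T (leaf T x)" "{leaf T x, q} \<in> edges_at T (leaf T x)"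
    using assms by (auto simp: edges_at_def)
  ultimately have "{leaf T x, p} = {leaf T x, q}"
    by simp
  then show ?thesis
    by (auto simp: doubleton_eq_iff)
qed

lemma leaf_linked:
  assumes "x \<in> X" "{leaf T x, p} \<in> edges T" "linked (edges T) p (leaf T x) y"
  shows "y = leaf T x"
  using assms(3) by (induction rule: linked_induct) (use leaf_neighbour[OF assms(1,2)] in auto)

text \<open>
  Two leaves on one edge would be the whole tree, and there would be no vertex of degree 3.
\<close>
lemma leaf_unique:
  assumes "x \<in> X" "y \<in> X" "e \<in> edges T" "leaf T x \<in> e" "leaf T y \<in> e"
  shows "x = y"
proof (rule ccontr)
  assume "x \<noteq> y"
  then have "leaf T x \<noteq> leaf T y"
    using leaf_eq assms by auto
  moreover obtain p q where "e = {p, q}"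
    using edgeE[OF assms(3)] .
  ultimately have "e = {leaf T y, leaf T x}"
    using assms(4,5) by auto
  then have e: "{leaf T y, leaf T x} \<in> edges T"
    using assms(3) by simp
  obtain t where t: "t \<in> verts T" "card (edges_at T t) = 3"
    using trivalent by (auto simp: trivalent_def)
  then have "t \<noteq> leaf T x" "t \<noteq> leaf T y"
    using card_leaf assms(1,2) by auto
  then obtain w where "{leaf T x, w} \<in> edges T" "linked (edges T) (leaf T x) w t"
    using linked_neighbourE[of "leaf T x" t] t(1) leaf_V[OF assms(1)] by metis
  then have "w = leaf T y" "linked (edges T) (leaf T x) w t"
    using leaf_neighbour[OF assms(1), of w "leaf T y"] e by (auto simp: insert_commute)
  then show False
    using leaf_linked[OF assms(2) e] \<open>t \<noteq> leaf T y\<close> by metis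
qed

abbreviation "init \<equiv> initial_labeling X T"

lemma initial_leaf: "x \<in> X \<Longrightarrow> e \<in> edges T \<Longrightarrow> leaf T x \<in> e \<Longrightarrow> init e = Some x"
  unfolding initial_labeling_def using leaf_unique by (auto intro!: the_equality)

lemma initial_SomeD: "init e = Some x \<Longrightarrow> e \<in> edges T \<and> x \<in> X \<and> leaf T x \<in> e"
proof -
  assume *: "init e = Some x"
  then have "e \<in> edges T \<and> (\<exists>y\<in>X. leaf T y \<in> e)"
    by (simp add: initial_labeling_def split: if_splits)
  then obtain y where "e \<in> edges T" "y \<in> X" "leaf T y \<in> e"
    by blast
  then show ?thesis
    using initial_leaf[of y e] * by simp
qed

lemma R_neq_A: "R \<noteq> A"
  using edgeD[OF R(1)] by auto

lemma parent_edge_R: "parent_edge R = {R, A}"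
  using R by (intro parent_edgeI) (auto simp: insert_commute)

text \<open>
  The edge of \<open>a\<close> is the parent edge of \<open>R\<close>, but its label does not come from below \<open>R\<close>; hence \<open>R\<close> is exempt from what
  holds of the other vertices.
\<close>
definition N where "N = verts T - {A, R}"

lemma N_V: "u \<in> N \<Longrightarrow> u \<in> verts T" "u \<in> N \<Longrightarrow> u \<noteq> A" "u \<in> N \<Longrightarrow> u \<noteq> R"
  by (auto simp: N_def)

lemma below_N:
  assumes "u \<in> N" "w \<in> below u"
  shows "w \<in> N"
proof -
  have "linked (edges T) u R A"
    using R(1) N_V[OF assms(1)] by (intro linked_edge) (auto simp: insert_commute)
  then show ?thesis
    using assms(2) by (auto simp: N_def below_def)
qed

lemma child_R: "{R, w} \<in> edges T \<Longrightarrow> w \<noteq> A \<Longrightarrow> w \<in> N \<and> parent_edge w = {R, w}"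
  using edge_cases[of R w] linked_neighbours[of R w A] parent_edge_R edgeD[of R w] R_neq_A
  by (auto simp: N_def doubleton_eq_iff)

text \<open>
  What remains true in a tournament: labels come from below, an edge is labeled only after all edges below it, and leaf
  edges keep their labels.
\<close>
definition sound where
  "sound L \<longleftrightarrow> (\<forall>u\<in>N. \<forall>x. L (parent_edge u) = Some x \<longrightarrow> x \<in> X \<and> leaf T x \<in> below u) \<and>
     (\<forall>u\<in>N. L (parent_edge u) \<noteq> None \<longrightarrow> (\<forall>w\<in>below u. L (parent_edge w) \<noteq> None)) \<and>
     (\<forall>x\<in>X. \<forall>e\<in>edges T. leaf T x \<in> e \<longrightarrow> L e = Some x)"

lemma soundI:
  assumes "\<And>u x. u \<in> N \<Longrightarrow> L (parent_edge u) = Some x \<Longrightarrow> x \<in> X \<and> leaf T x \<in> below u"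
    and "\<And>u w. u \<in> N \<Longrightarrow> L (parent_edge u) \<noteq> None \<Longrightarrow> w \<in> below u \<Longrightarrow> L (parent_edge w) \<noteq> None"
    and "\<And>x e. x \<in> X \<Longrightarrow> e \<in> edges T \<Longrightarrow> leaf T x \<in> e \<Longrightarrow> L e = Some x"
  shows "sound L"
  unfolding sound_def
  by (intro conjI ballI allI impI, erule (1) assms(1)[THEN conjunct1], erule (1) assms(1)[THEN conjunct2],
      erule (2) assms(2), erule (2) assms(3))

lemma soundD:
  assumes "sound L"
  shows "u \<in> N \<Longrightarrow> L (parent_edge u) = Some x \<Longrightarrow> x \<in> X \<and> leaf T x \<in> below u"
    and "u \<in> N \<Longrightarrow> w \<in> below u \<Longrightarrow> L (parent_edge w) = None \<Longrightarrow> L (parent_edge u) = None"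
    and "x \<in> X \<Longrightarrow> e \<in> edges T \<Longrightarrow> leaf T x \<in> e \<Longrightarrow> L e = Some x"
proof -
  note s = assms[unfolded sound_def]
  show "u \<in> N \<Longrightarrow> L (parent_edge u) = Some x \<Longrightarrow> x \<in> X \<and> leaf T x \<in> below u"
    using conjunct1[OF s] by simp
  show "u \<in> N \<Longrightarrow> w \<in> below u \<Longrightarrow> L (parent_edge w) = None \<Longrightarrow> L (parent_edge u) = None"
    using conjunct1[OF conjunct2[OF s]] by blast
  show "x \<in> X \<Longrightarrow> e \<in> edges T \<Longrightarrow> leaf T x \<in> e \<Longrightarrow> L e = Some x"
    using conjunct2[OF conjunct2[OF s]] by simp
qed

lemma parent_edge_E: "u \<in> verts T \<Longrightarrow> u \<noteq> A \<Longrightarrow> parent_edge u \<in> edges T"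
  by (metis parentE)

lemma below_leaf:
  assumes "x \<in> X" "x \<noteq> label_a"
  shows "below (leaf T x) = {leaf T x}"
proof -
  have x: "leaf T x \<noteq> A" "leaf T x \<in> verts T"
    using assms leaf_eq leaf_V labels_abc by auto
  have False if w: "w \<in> below (leaf T x)" "w \<noteq> leaf T x" for w
  proof -
    obtain u where u: "{leaf T x, u} \<in> edges T" "u \<in> below (leaf T x)"
      by (rule below_child[OF x(2,1) w])
    obtain p where p: "{leaf T x, p} \<in> edges T" "linked (edges T) (leaf T x) p A"
      by (rule parentE[OF x(2,1)])
    then show False
      using leaf_neighbour[OF assms(1) u(1) p(1)] u(2) by (simp add: below_def)
  qed
  then show ?thesis
    using belowI[OF x(2,1)] by blast
qed

lemma initial_parent:
  assumes u: "u \<in> N" "init (parent_edge u) = Some x"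
  shows "u = leaf T x \<and> x \<in> X"
proof -
  obtain p where p: "{u, p} \<in> edges T" "linked (edges T) u p A" "parent_edge u = {u, p}"
    by (rule parentE[OF N_V(1)[OF u(1)] N_V(2)[OF u(1)]])
  then have x: "x \<in> X" "leaf T x = u \<or> leaf T x = p"
    using initial_SomeD[OF u(2)] by auto
  moreover have "leaf T x \<noteq> p"
  proof
    assume "leaf T x = p"
    then have "A = p"
      using leaf_linked[of x u A] p x by (auto simp: insert_commute)
    then have "u = R"
      using leaf_neighbour[of label_a u R] p(1) R(1) labels_abc by (auto simp: insert_commute)
    then show False
      using u N_V by auto
  qed
  ultimately show ?thesis by auto
qed

lemma sound_initial: "sound init"
proof -
  note * = initial_parent
  show ?thesis
  proof (rule soundI)
    fix u x assume u: "u \<in> N" "init (parent_edge u) = Some x"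
    show "x \<in> X \<and> leaf T x \<in> below u"
      using *[OF u] belowI[OF N_V(1,2)[OF u(1)]] by simp
  next
    fix u w assume u: "u \<in> N" "init (parent_edge u) \<noteq> None" "w \<in> below u"
    then obtain x where x: "init (parent_edge u) = Some x"
      by auto
    then have "u = leaf T x" "x \<in> X"
      using *[OF u(1) x] by auto
    moreover have "x \<noteq> label_a"
      using calculation N_V(2)[OF u(1)] by auto
    ultimately have "w = u"
      using below_leaf[of x] u(3) by auto
    then show "init (parent_edge w) \<noteq> None"
      using u(2) by simp
  qed (rule initial_leaf)
qed

lemma inner_vertexE:
  assumes "v \<in> verts T" "v \<noteq> A" "card (edges_at T v) = 3"
  obtains w w' where "edges_at T v = {parent_edge w, parent_edge w', parent_edge v}" "w \<noteq> w'"
    "parent_edge w = {v, w}" "parent_edge w' = {v, w'}" "{v, w} \<in> edges T" "{v, w'} \<in> edges T"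
    "w \<in> below v" "w' \<in> below v" "w \<noteq> A" "w' \<noteq> A"
    "distinct [parent_edge w, parent_edge w', parent_edge v]"
proof -
  have pv: "parent_edge v \<in> edges_at T v"
    using parent_edge_E[OF assms(1,2)] by (auto simp: edges_at_def parent_edge_def)
  then have "card (edges_at T v - {parent_edge v}) = 2"
    using assms(3) by (simp add: card_Diff_singleton)
  then obtain e f where ef: "edges_at T v - {parent_edge v} = {e, f}" "e \<noteq> f"
    by (auto simp: card_2_iff)
  have *: "\<exists>w. e = {v, w} \<and> parent_edge w = {v, w} \<and> {v, w} \<in> edges T \<and> w \<in> below v \<and> w \<noteq> A"
    if "e \<in> edges_at T v" "e \<noteq> parent_edge v" for e
  proof -
    have "e \<in> edges T" "v \<in> e"
      using that(1) by (auto simp: edges_at_def)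
    then obtain w where w: "e = {v, w}" "{v, w} \<in> edges T"
      by (metis edgeE insert_commute insertE singletonD)
    then show ?thesis
      using that(2) edge_cases[of v w] by metis
  qed
  have "e \<in> edges_at T v" "e \<noteq> parent_edge v" "f \<in> edges_at T v" "f \<noteq> parent_edge v"
    using ef by auto
  then obtain w w' where w: "e = {v, w}" "parent_edge w = {v, w}" "{v, w} \<in> edges T" "w \<in> below v" "w \<noteq> A"
    "f = {v, w'}" "parent_edge w' = {v, w'}" "{v, w'} \<in> edges T" "w' \<in> below v" "w' \<noteq> A"
    using *[of e] *[of f] by metis
  have "edges_at T v = {e, f, parent_edge v}"
    using ef(1) pv by blast
  moreover have "w \<noteq> w'" "e \<noteq> parent_edge v" "f \<noteq> parent_edge v"
    using ef w(1,6) by auto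
  ultimately show thesis
    using ef(2) w(1,6) by (intro that[of w w'] w(2-5,7-10)) (simp_all add: w(2,7))
qed

lemma card_below_less:
  assumes "u \<in> verts T" "u \<noteq> A" "w \<in> below u" "w \<noteq> u"
  shows "card (below w) < card (below u)"
proof (rule psubset_card_mono)
  show "finite (below u)"
    using finite_V by (simp add: below_def)
  show "below w \<subset> below u"
  proof
    show "below w \<subseteq> below u"
      using below_mono[OF assms(1,3)] .
    have "u \<notin> below w"
      using below_antisym[OF assms(1,3)] assms(4) by blast
    moreover have "u \<in> below u"
      using belowI[OF assms(1,2)] .
    ultimately show "below w \<noteq> below u" by auto
  qed
qed

text \<open>
  The children of a lowest vertex with unlabeled parent edge have labels that come from disjoint parts of the tree, and can
  face off.  So \<open>a\<close> is never the largest possible loser as long as an edge is unlabeled.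
\<close>
lemma other_face_off:
  assumes "sound L" "u \<in> N" "L (parent_edge u) = None"
  shows "\<exists>i j g. can_face_off T L i j g \<and> label_a < i"
  using assms(2,3)
proof (induction "card (below u)" arbitrary: u rule: less_induct)
  case less
  note u = N_V[OF less.prems(1)]
  show ?case
  proof (cases "\<exists>w\<in>below u. w \<noteq> u \<and> L (parent_edge w) = None")
    case True
    then show ?thesis
      using less.hyps card_below_less[OF u(1,2)] below_N[OF less.prems(1)] by metis
  next
    case False
    have "card (edges_at T u) = 3"
    proof (rule ccontr)
      assume "card (edges_at T u) \<noteq> 3"
      then obtain x where "x \<in> X" "u = leaf T x"
        using leafE u by metis
      then show False
        using soundD(3)[OF assms(1), of x "parent_edge u"] less.prems(2) u parent_edge_E[of u]
        by (auto simp: parent_edge_def)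
    qed
    then obtain w w' where w: "edges_at T u = {parent_edge w, parent_edge w', parent_edge u}" "w \<noteq> w'"
      "parent_edge w = {u, w}" "parent_edge w' = {u, w'}" "{u, w} \<in> edges T" "{u, w'} \<in> edges T"
      "w \<in> below u" "w' \<in> below u" "w \<noteq> A" "w' \<noteq> A"
      "distinct [parent_edge w, parent_edge w', parent_edge u]"
      using inner_vertexE u by metis
    have "w \<noteq> u" "w' \<noteq> u"
      using w edgeD by metis+
    then obtain x x' where x: "L (parent_edge w) = Some x" "L (parent_edge w') = Some x'"
      using False w(7,8) by fastforce
    have "w \<in> N" "w' \<in> N"
      using w below_N less.prems by auto
    then have below: "x \<in> X" "leaf T x \<in> below w" "x' \<in> X" "leaf T x' \<in> below w'"
      using soundD(1)[OF assms(1)] x by auto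
    then have "x \<noteq> x'"
      using children_disjoint[OF w(5,7,6,8,2)] by auto
    have "x \<noteq> label_a" "x' \<noteq> label_a"
      using below root_notin_below by auto
    then have "label_a < x" "label_a < x'"
      using below label_ge order_less_le by auto
    have "can_face_off T L x x' (parent_edge u)" if "x < x'"
      by (rule can_face_offI[OF that u(1) w(1,11) x less.prems(2)])
    moreover have "can_face_off T L x' x (parent_edge u)" if "x' < x"
      using w(11) by (intro can_face_offI[OF that u(1) _ _ x(2,1) less.prems(2)]) (auto simp: w(1))
    ultimately show ?thesis
      using \<open>x \<noteq> x'\<close> \<open>label_a < x\<close> \<open>label_a < x'\<close> by (meson linorder_neq_iff)
  qed
qed

text \<open>
  All rounds go upwards: at \<open>R\<close> the loser would be \<open>a\<close>, which \<open>other_face_off\<close> excludes, and at another vertex a labeled parent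
  edge would imply that both children are labeled.
\<close>
lemma roundE:
  assumes "sound L" "lazy_round T L i j L'"
  obtains v w w' x where "v \<in> N" "edges_at T v = {parent_edge w, parent_edge w', parent_edge v}"
    "{v, w} \<in> edges T" "{v, w'} \<in> edges T" "w \<in> below v" "w' \<in> below v" "w \<in> N" "w' \<in> N" "w \<noteq> w'"
    "L (parent_edge w) = Some i" "L (parent_edge w') = Some j" "L (parent_edge v) = None"
    "L' = L(parent_edge v \<mapsto> x)" "x = i \<or> x = j" "i < j"
proof -
  from assms(2) obtain g x where g: "can_face_off T L i j g"
    and max: "\<And>i' j' g'. can_face_off T L i' j' g' \<Longrightarrow> i' \<le> i" and L': "L' = L(g \<mapsto> x)" "x = i \<or> x = j"
    by (rule lazy_roundE) blast
  from g obtain v e f where v: "i < j" "edges_at T v = {e, f, g}" "e \<noteq> f" "e \<noteq> g" "f \<noteq> g"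
    "L e = Some i" "L f = Some j" "L g = None" "v \<in> verts T"
    unfolding can_face_off_def by blast
  have card: "card (edges_at T v) = 3"
    using v by simp
  then have "v \<noteq> A"
    using card_leaf labels_abc by auto
  have e: "e \<in> edges T" "f \<in> edges T" "g \<in> edges T" "v \<in> e" "v \<in> f" "v \<in> g"
    using v(2) by (auto simp: edges_at_def set_eq_iff)
  have "v \<noteq> R"
  proof
    assume [simp]: "v = R"
    obtain w where w: "g = {R, w}"
      using e(3,6) by (metis \<open>v = R\<close> edgeE insert_commute insertE singletonD)
    have "w \<noteq> A"
      using soundD(3)[OF assms(1), of label_a g] e labels_abc v(8) w by auto
    then have "w \<in> N" "parent_edge w = g"
      using child_R[of w] e w by auto
    then have "label_a < i"
      using other_face_off[OF assms(1), of w] max v(8) by fastforce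
    moreover have "{R, A} \<in> edges_at T v"
      using R by (auto simp: edges_at_def insert_commute)
    then have "{R, A} = e \<or> {R, A} = f \<or> {R, A} = g"
      unfolding v(2) by blast
    moreover have "L {R, A} = Some label_a"
      using soundD(3)[OF assms(1), of label_a "{R, A}"] R labels_abc by (auto simp: insert_commute)
    ultimately show False
      using v(1,6,7,8) by (elim disjE) simp_all
  qed
  then have N: "v \<in> N"
    using v \<open>v \<noteq> A\<close> by (simp add: N_def)
  obtain w w' where w: "edges_at T v = {parent_edge w, parent_edge w', parent_edge v}" "w \<noteq> w'"
    "parent_edge w = {v, w}" "parent_edge w' = {v, w'}" "{v, w} \<in> edges T" "{v, w'} \<in> edges T"
    "w \<in> below v" "w' \<in> below v" "w \<noteq> A" "w' \<noteq> A"
    "distinct [parent_edge w, parent_edge w', parent_edge v]"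
    using inner_vertexE[OF v(9) \<open>v \<noteq> A\<close> card] by metis
  have "w \<in> N" "w' \<in> N"
    using w below_N N by auto
  have "g = parent_edge v"
  proof (rule ccontr)
    assume *: "g \<noteq> parent_edge v"
    then have "g = parent_edge w \<or> g = parent_edge w'"
      using w(1) v(2) by auto
    then have "L (parent_edge v) = None"
      using soundD(2)[OF assms(1) N w(7)] soundD(2)[OF assms(1) N w(8)] v(8) by (elim disjE) simp_all
    moreover have "parent_edge v \<in> {e, f, g}"
      using w(1) unfolding v(2) by simp
    then have "parent_edge v = e \<or> parent_edge v = f"
      using * by simp
    ultimately show False
      using v(6,7) by (elim disjE) simp_all
  qed
  have "{e, f} = edges_at T v - {g}"
    using v(2-5) by auto
  also have "\<dots> = {parent_edge w, parent_edge w'}"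
    using w(1,11) unfolding \<open>g = parent_edge v\<close> by auto
  finally have "{e, f} = {parent_edge w, parent_edge w'}" .
  then consider "e = parent_edge w" "f = parent_edge w'" | "e = parent_edge w'" "f = parent_edge w"
    by (auto simp: doubleton_eq_iff)
  then show thesis
  proof cases
    case 1
    show ?thesis
      using that[OF N w(1,5-8) \<open>w \<in> N\<close> \<open>w' \<in> N\<close> w(2) _ _ _ _ L'(2) v(1)] v(6-8) L'(1)
      unfolding 1 \<open>g = parent_edge v\<close> by simp
  next
    case 2
    have "edges_at T v = {parent_edge w', parent_edge w, parent_edge v}"
      using w(1) by blast
    then show ?thesis
      using that[OF N _ w(6,5,8,7) \<open>w' \<in> N\<close> \<open>w \<in> N\<close> w(2)[symmetric] _ _ _ _ L'(2) v(1)] v(6-8) L'(1)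
      unfolding 2 \<open>g = parent_edge v\<close> by simp
  qed
qed

lemma labeled_below:
  assumes "sound L" "v \<in> N" "edges_at T v = {parent_edge w, parent_edge w', parent_edge v}"
    and "w \<in> N" "w' \<in> N" "L (parent_edge w) \<noteq> None" "L (parent_edge w') \<noteq> None"
    and "x \<in> below v" "x \<noteq> v"
  shows "L (parent_edge x) \<noteq> None"
proof -
  obtain u where u: "{v, u} \<in> edges T" "parent_edge u = {v, u}" "u \<noteq> A" "u \<in> below v" "x \<in> below u"
    by (rule below_child[OF N_V(1,2)[OF assms(2)] assms(8,9)])
  then have "parent_edge u \<in> edges_at T v"
    by (simp add: edges_at_def)
  then have "parent_edge u \<in> {parent_edge w, parent_edge w', parent_edge v}"
    using assms(3) by simp
  moreover have "parent_edge u \<noteq> parent_edge v"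
    using parent_edge_inj[of u v] N_V[OF assms(2)] u edgeD[OF u(1)] by auto
  ultimately have "L (parent_edge u) \<noteq> None"
    using assms(6,7) by auto
  then show ?thesis
    using soundD(2)[OF assms(1) below_N[OF assms(2) u(4)] u(5)] by metis
qed

lemma sound_round:
  assumes "sound L" "lazy_round T L i j L'"
  shows "sound L'"
proof -
  obtain v w w' x where v: "v \<in> N" "edges_at T v = {parent_edge w, parent_edge w', parent_edge v}"
    and w: "{v, w} \<in> edges T" "{v, w'} \<in> edges T" "w \<in> below v" "w' \<in> below v" "w \<in> N" "w' \<in> N" "w \<noteq> w'"
      "L (parent_edge w) = Some i" "L (parent_edge w') = Some j"
    and L: "L (parent_edge v) = None" "L' = L(parent_edge v \<mapsto> x)" "x = i \<or> x = j"
    by (rule roundE[OF assms])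
  have L'I: "L' e = L e" if "L e \<noteq> None" for e
    using L that by auto
  have "leaf T i \<in> below v" "leaf T j \<in> below v" "i \<in> X" "j \<in> X"
    using soundD(1)[OF assms(1)] w below_mono[OF N_V(1)[OF v(1)]] by blast+
  then have x: "x \<in> X" "leaf T x \<in> below v"
    using L(3) by auto
  have inj: "parent_edge u \<noteq> parent_edge v" if "u \<in> N" "u \<noteq> v" for u
    using parent_edge_inj[of u v] N_V[OF that(1)] N_V[OF v(1)] that(2) by blast
  show ?thesis
  proof (rule soundI)
    fix u y assume u: "u \<in> N" "L' (parent_edge u) = Some y"
    show "y \<in> X \<and> leaf T y \<in> below u"
    proof (cases "u = v")
      case True
      then show ?thesis
        using u x L by simp
    next
      case False
      then show ?thesis
        using u soundD(1)[OF assms(1) u(1)] inj[OF u(1)] L(2) by simp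
    qed
  next
    fix u y assume u: "u \<in> N" "L' (parent_edge u) \<noteq> None" "y \<in> below u"
    show "L' (parent_edge y) \<noteq> None"
    proof (cases "u = v")
      case True
      show ?thesis
      proof (cases "y = v")
        case False
        then have "L (parent_edge y) \<noteq> None"
          using labeled_below[OF assms(1) v w(5,6)] w(8,9) u(3) True by simp
        then show ?thesis
          using L'I by simp
      qed (simp add: L(2))
    next
      case False
      then have "L (parent_edge u) \<noteq> None"
        using u inj L(2) by simp
      then have "L (parent_edge y) \<noteq> None"
        using soundD(2)[OF assms(1) u(1,3)] by metis
      then show ?thesis
        using L'I by simp
    qed
  next
    fix y e assume "y \<in> X" "e \<in> edges T" "leaf T y \<in> e"
    then have "L e = Some y"
      by (rule soundD(3)[OF assms(1)])
    then show "L' e = Some y"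
      using L'I by simp
  qed
qed

text \<open>
  The labels beaten by \<open>r\<close> are pairwise different, since they come from disjoint parts of the tree.  As the branch of \<open>r\<close> at
  \<open>v0\<close> has no smaller label, \<open>r\<close> wins only at \<open>v0\<close> or above it.  The leaf of \<open>s\<close> lies below \<open>v0\<close> as well, so the round at its
  neighbour \<open>p\<close>, whose loser is at most \<open>s\<close>, is played no later.  From then on all losers are at most \<open>s\<close>.
\<close>
lemma wins_bound:
  assumes "tournament X T L ws" "r \<in> X" "s \<in> X" "s \<noteq> label_a"
    and v0: "v0 \<in> verts T" "v0 \<noteq> A" "leaf T r \<in> below v0" "leaf T s \<in> below v0"
    and small: "\<And>x. x \<in> X \<Longrightarrow> x < r \<Longrightarrow> \<not> linked (edges T) v0 (leaf T r) (leaf T x)"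
  shows "count_list ws r \<le> card {0..s}"
proof -
  have V_s: "leaf T s \<in> verts T" "leaf T s \<noteq> A"
    using leaf_V assms(3,4) leaf_eq labels_abc by auto
  obtain p where p: "{leaf T s, p} \<in> edges T" "linked (edges T) (leaf T s) p A"
    "parent_edge (leaf T s) = {leaf T s, p}"
    by (rule parentE[OF V_s])
  \<comment> \<open>\<open>S\<close> is the set of labels beaten by \<open>r\<close> so far; the vertex \<open>u\<close> above \<open>x\<close> and \<open>r\<close> tells where they have met.\<close>
  define inv where "inv L ws \<longleftrightarrow> sound L \<and>
    (p \<in> N \<longrightarrow> L (parent_edge p) \<noteq> None \<longrightarrow> (\<forall>i j g. can_face_off T L i j g \<longrightarrow> i \<le> s)) \<and>
    (\<exists>S\<subseteq>{0..s}. card S = count_list ws r \<and>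
      (\<forall>x\<in>S. \<exists>u\<in>N. L (parent_edge u) \<noteq> None \<and> leaf T x \<in> below u \<and> leaf T r \<in> below u))" for L ws
  have "inv L ws"
    using assms(1)
  proof (induction rule: tournament.induct)
    case start
    have "init (parent_edge p) = None" if p_N: "p \<in> N"
    proof (rule ccontr)
      assume "init (parent_edge p) \<noteq> None"
      then obtain x where x: "p = leaf T x" "x \<in> X"
        using initial_parent[OF p_N] by blast
      then have "s = x"
        using leaf_unique[OF assms(3) x(2) p(1)] by simp
      then show False
        using edgeD[OF p(1)] x(1) by simp
    qed
    then show ?case
      unfolding inv_def using sound_initial by (intro conjI exI[of _ "{}"]) simp_all
  next
    case (round L ws i j L')
    have sound: "sound L"
      and bound: "\<And>i j g. p \<in> N \<Longrightarrow> L (parent_edge p) \<noteq> None \<Longrightarrow> can_face_off T L i j g \<Longrightarrow> i \<le> s"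
      using round.IH unfolding inv_def by blast+
    obtain S where S: "S \<subseteq> {0..s}" "card S = count_list ws r"
      "\<And>x. x \<in> S \<Longrightarrow> \<exists>u\<in>N. L (parent_edge u) \<noteq> None \<and> leaf T x \<in> below u \<and> leaf T r \<in> below u"
      using round.IH unfolding inv_def by blast
    obtain g where g: "can_face_off T L i j g"
      by (rule lazy_roundE[OF round.hyps(2)])
    obtain v w w' x where v: "v \<in> N" "edges_at T v = {parent_edge w, parent_edge w', parent_edge v}"
      and w: "{v, w} \<in> edges T" "{v, w'} \<in> edges T" "w \<in> below v" "w' \<in> below v" "w \<in> N" "w' \<in> N" "w \<noteq> w'"
        "L (parent_edge w) = Some i" "L (parent_edge w') = Some j"
      and L: "L (parent_edge v) = None" "L' = L(parent_edge v \<mapsto> x)" and "i < j"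
      by (rule roundE[OF sound round.hyps(2)])
    note vV = N_V(1,2)[OF v(1)]
    have L'I: "L' e \<noteq> None" if "L e \<noteq> None" for e
      using L that by simp
    have ij: "leaf T i \<in> below w" "leaf T j \<in> below w'" "i \<in> X"
      using soundD(1)[OF sound w(5,8)] soundD(1)[OF sound w(6,9)] by auto
    have ij_v: "leaf T i \<in> below v" "leaf T j \<in> below v"
      using ij below_mono[OF vV(1) w(3)] below_mono[OF vV(1) w(4)] by auto
    have v_not_leaf: "v \<noteq> leaf T y" if "y \<in> X" for y
      using below_leaf[OF that] w(3) edgeD[OF w(1)] vV(2) by (cases "y = label_a") auto
    have i_s: "i \<le> s" if "p = v"
    proof -
      have e: "{leaf T s, p} \<in> edges_at T v"
        using p(1) that by (simp add: edges_at_def)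
      have "L {leaf T s, p} = Some s"
        using soundD(3)[OF sound assms(3) p(1)] by simp
      then have "s = i \<or> s = j"
        using e w(8,9) L(1) unfolding v(2) by auto
      then show ?thesis
        using \<open>i < j\<close> by auto
    qed
    have bound': "i' \<le> s" if "p \<in> N" "L' (parent_edge p) \<noteq> None" "can_face_off T L' i' j' g'" for i' j' g'
    proof -
      have "i \<le> s"
      proof (cases "p = v")
        case False
        then have "parent_edge p \<noteq> parent_edge v"
          using parent_edge_inj N_V(1,2)[OF that(1)] vV by metis
        then show ?thesis
          using bound[OF that(1) _ g] that(2) L(2) by simp
      qed (rule i_s)
      then show ?thesis
        using losers_decrease[OF round.hyps(2) that(3)] by simp
    qed
    have "\<exists>S\<subseteq>{0..s}. card S = count_list (j # ws) r \<and>
      (\<forall>x\<in>S. \<exists>u\<in>N. L' (parent_edge u) \<noteq> None \<and> leaf T x \<in> below u \<and> leaf T r \<in> below u)"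
    proof (cases "j = r")
      case False
      then show ?thesis
        using S L'I by (intro exI[of _ S]) fastforce
    next
      case True
      have "i \<notin> S"
      proof
        assume "i \<in> S"
        then obtain u where u: "u \<in> N" "L (parent_edge u) \<noteq> None" "leaf T i \<in> below u" "leaf T r \<in> below u"
          using S(3) by blast
        have "v \<notin> below u"
          using soundD(2)[OF sound u(1), of v] u(2) L(1) by metis
        then have "w \<notin> below u \<or> w = u"
          using below_neighbour[OF N_V(1,2)[OF u(1)], of w v] w(1) by (auto simp: insert_commute)
        then have "u \<in> below w"
          using below_nested[OF N_V(1,2)[OF u(1)] N_V(1)[OF w(5)] u(3) ij(1)] belowI[OF N_V(1,2)[OF u(1)]]
          by auto
        then have "leaf T r \<in> below w"
          using below_mono[OF N_V(1)[OF w(5)]] u(4) by blast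
        then show False
          using ij(2) True children_disjoint[OF w(1,3,2,4,7)] by blast
      qed
      moreover have "0 \<le> i"
      proof -
        have "i \<noteq> label_a"
          using ij(1) root_notin_below by metis
        moreover have "i \<noteq> label_b"
        proof
          assume "i = label_b"
          then have "R \<in> below v"
            using below_neighbour[OF vV ij_v(1), of R] R(2) v_not_leaf labels_abc by metis
          then show False
            using below_N[OF v(1)] N_V(3) by blast
        qed
        ultimately show ?thesis
          using label_ge[OF ij(3)] by linarith
      qed
      moreover have "i \<le> s"
      proof -
        have "v0 \<in> below v"
        proof (rule ccontr)
          assume not: "v0 \<notin> below v"
          then have "v \<in> below v0" "v \<noteq> v0"
            using below_nested[OF v0(1,2) vV(1) v0(3)] ij_v(2) True belowI[OF v0(1,2)] by auto
          then have "linked (edges T) v0 (leaf T r) v" "linked (edges T) v0 (leaf T i) v"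
            using linked_below[OF v0(1)] ij_v True by auto
          then show False
            using small[OF ij(3)] \<open>i < j\<close> True linked_trans linked_sym by metis
        qed
        then have "leaf T s \<in> below v"
          using below_mono[OF vV(1)] v0(4) by blast
        then have "p \<in> below v"
          using below_neighbour[OF vV _ p(1)] v_not_leaf[OF assms(3)] by metis
        show ?thesis
        proof (cases "p = v")
          case False
          then have "L (parent_edge p) \<noteq> None"
            using labeled_below[OF sound v w(5,6)] w(8,9) \<open>p \<in> below v\<close> by simp
          then show ?thesis
            using bound[OF below_N[OF v(1) \<open>p \<in> below v\<close>] _ g] by simp
        qed (rule i_s)
      qed
      moreover have "finite S"
        using S(1) finite_subset by blast
      moreover have "L' (parent_edge v) \<noteq> None"
        using L(2) by simp
      ultimately show ?thesis
        using S True L'I ij_v v(1) by (intro exI[of _ "insert i S"]) (simp, blast)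
    qed
    then show ?case
      unfolding inv_def using sound_round[OF sound round.hyps(2)] bound' by blast
  qed
  then obtain S where "S \<subseteq> {0..s}" "card S = count_list ws r"
    unfolding inv_def by blast
  then show ?thesis
    using card_mono[of "{0..s}" S] by simp
qed

end

lemma wins_le:
  assumes "T \<in> tour n k" "1 \<le> r" "r \<le> n" "s \<in> labels n" "s \<noteq> label_a"
    and v: "v \<in> verts T" "card (edges_at T v) = 3"
    and sep: "\<not> linked (edges T) v (leaf T (int r)) (leaf T label_a)"
      "\<not> linked (edges T) v (leaf T s) (leaf T label_a)"
    and small: "\<And>x. x \<in> labels n \<Longrightarrow> x < int r \<Longrightarrow> \<not> linked (edges T) v (leaf T (int r)) (leaf T x)"
  shows "int (k r) \<le> s + 1"
proof -
  from assms(1) obtain R L ws where T: "trivalent T" "leaf_labeled (labels n) T"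
    "{leaf T label_a, R} \<in> edges T" "{leaf T label_b, R} \<in> edges T"
    and t: "tournament (labels n) T L ws" "\<forall>i\<in>{1..n}. count_list ws (int i) = k i"
    unfolding tour_def by blast
  interpret tournament_tree n T R
    using T by unfold_locales
  have r: "int r \<in> labels n"
    using assms(2,3) by (simp add: labels_def)
  have "v \<noteq> A"
    using v(2) card_leaf[OF labels_abc(1)] by auto
  then have "count_list ws (int r) \<le> card {0..s}"
    using sep leaf_V[OF r] leaf_V[OF assms(4)]
    by (intro wins_bound[OF t(1) r assms(4,5) v(1)] small) (auto simp: below_def)
  moreover have "-1 \<le> s"
    using label_ge[OF assms(4)] assms(5) by linarith
  ultimately show ?thesis
    using t(2) assms(2,3) by auto
qed

section \<open>Branches of a stable curve\<close>

locale stable =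
  fixes X :: "label set" and C :: curve
  assumes finite_X: "finite X" and stable: "stable_curve X C"
begin

sublocale tree "comps C" "nodes C"
proof
  show "is_tree (comps C) (nodes C)"
    using stable unfolding stable_curve_def by (elim conjE)
qed

abbreviation "mc \<equiv> mark_comp C"
abbreviation "E \<equiv> nodes C"

lemma mc_comps: "x \<in> X \<Longrightarrow> mc x \<in> comps C"
  using stable unfolding stable_curve_def by blast

lemma special_points:
  assumes "v \<in> comps C"
  shows "node_pt C v ` nodes_on C v \<subseteq> P1" "mark_pt C ` marks_on X C v \<subseteq> P1"
    "inj_on (node_pt C v) (nodes_on C v)" "inj_on (mark_pt C) (marks_on X C v)"
    "node_pt C v ` nodes_on C v \<inter> mark_pt C ` marks_on X C v = {}" "3 \<le> n_special X C v"
  using bspec[OF stable[unfolded stable_curve_def, THEN conjunct2, THEN conjunct2] assms] by blast+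

lemma nodes_on_iff: "w \<in> nodes_on C v \<longleftrightarrow> {v, w} \<in> E"
  by (simp add: nodes_on_def)

lemma marks_on_iff: "x \<in> marks_on X C v \<longleftrightarrow> x \<in> X \<and> mc x = v"
  by (auto simp: marks_on_def)

lemma finite_nodes_on: "finite (nodes_on C v)"
proof (rule finite_subset)
  show "nodes_on C v \<subseteq> comps C"
    using edgeD by (auto simp: nodes_on_iff)
qed (rule finite_V)

lemma finite_marks_on: "finite (marks_on X C v)"
  using finite_X by (simp add: marks_on_def)

lemma proj_to_mark: "mc x = v \<Longrightarrow> proj_to C v x = mark_pt C x"
  by (simp add: proj_to_def)

lemma proj_to_node:
  assumes "{v, w} \<in> E" "linked E v w (mc x)"
  shows "proj_to C v x = node_pt C v w"
proof -
  have "(THE w. w \<in> nodes_on C v \<and> reach {e \<in> E. v \<notin> e} w (mc x)) = w"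
  proof (rule the_equality)
    show "w \<in> nodes_on C v \<and> reach {e \<in> E. v \<notin> e} w (mc x)"
      using assms by (simp add: nodes_on_iff linked_def)
  next
    fix w' assume "w' \<in> nodes_on C v \<and> reach {e \<in> E. v \<notin> e} w' (mc x)"
    then have w': "{v, w'} \<in> E" "linked E v w' (mc x)"
      by (simp_all add: nodes_on_iff linked_def)
    then have "linked E v w' w"
      using assms(2) linked_trans linked_sym by metis
    then show "w' = w"
      by (rule linked_neighbours[OF w'(1) assms(1)])
  qed
  moreover have "mc x \<noteq> v"
    using linked_neq[OF assms(2)] edgeD[OF assms(1)] by auto
  ultimately show ?thesis
    by (simp add: proj_to_def)
qed

lemma proj_to_nodeE:
  assumes "v \<in> comps C" "x \<in> X" "mc x \<noteq> v"
  obtains w where "{v, w} \<in> E" "linked E v w (mc x)" "proj_to C v x = node_pt C v w"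
  using linked_neighbourE[OF assms(1) mc_comps[OF assms(2)] assms(3)] proj_to_node by metis

text \<open>
  The special points of a component are different, so equality of projections is a matter of the graph of components.
\<close>
lemma proj_to_eq_iff:
  assumes "v \<in> comps C" "x \<in> X" "y \<in> X"
  shows "proj_to C v x = proj_to C v y \<longleftrightarrow> x = y \<or> (mc x \<noteq> v \<and> mc y \<noteq> v \<and> linked E v (mc x) (mc y))"
proof -
  note sp = special_points[OF assms(1)]
  have mixed: "proj_to C v x \<noteq> proj_to C v y" if xy: "x \<in> X" "y \<in> X" "mc x = v" "mc y \<noteq> v" for x y
  proof -
    obtain w where w: "{v, w} \<in> E" "proj_to C v y = node_pt C v w"
      using proj_to_nodeE[OF assms(1) xy(2,4)] .
    have "node_pt C v w \<in> node_pt C v ` nodes_on C v" "mark_pt C x \<in> mark_pt C ` marks_on X C v"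
      using w xy by (auto simp: nodes_on_iff marks_on_iff)
    then have "node_pt C v w \<noteq> mark_pt C x"
      using sp(5) by (metis IntI empty_iff)
    then show ?thesis
      using w(2) proj_to_mark[OF xy(3)] by simp
  qed
  consider "mc x = v" "mc y = v" | "mc x = v" "mc y \<noteq> v" | "mc x \<noteq> v" "mc y = v" | "mc x \<noteq> v" "mc y \<noteq> v"
    by blast
  then show ?thesis
  proof cases
    case 1
    then have "x \<in> marks_on X C v" "y \<in> marks_on X C v"
      using assms by (auto simp: marks_on_iff)
    then show ?thesis
      using inj_on_eq_iff[OF sp(4)] 1 by (simp add: proj_to_mark)
  next
    case 2
    then show ?thesis
      using mixed[OF assms(2,3)] by blast
  next
    case 3
    then show ?thesis
      using mixed[OF assms(3,2)] by auto
  next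
    case 4
    obtain w where w: "{v, w} \<in> E" "linked E v w (mc x)" "proj_to C v x = node_pt C v w"
      using proj_to_nodeE[OF assms(1,2) 4(1)] .
    obtain w' where w': "{v, w'} \<in> E" "linked E v w' (mc y)" "proj_to C v y = node_pt C v w'"
      using proj_to_nodeE[OF assms(1,3) 4(2)] .
    have "proj_to C v x = proj_to C v y \<longleftrightarrow> w = w'"
      using inj_on_eq_iff[OF sp(3), of w w'] w w' by (simp add: nodes_on_iff)
    also have "\<dots> \<longleftrightarrow> linked E v w w'"
      using linked_neighbours[OF w(1) w'(1)] by auto
    also have "\<dots> \<longleftrightarrow> linked E v (mc x) (mc y)"
      using w(2) w'(2) linked_trans linked_sym by metis
    finally show ?thesis
      using 4 by auto
  qed
qed

text \<open>
  Every node leads to a marked point: a component without one has a further node, which leads into a smaller part of the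
  curve.
\<close>
lemma node_leads_to_mark:
  assumes "{v, w} \<in> E"
  shows "\<exists>x\<in>X. linked E v w (mc x)"
  using assms
proof (induction "card {u \<in> comps C. linked E v w u}" arbitrary: v w rule: less_induct)
  case less
  have w: "w \<in> comps C" "v \<noteq> w"
    using edgeD[OF less.prems] by auto
  show ?case
  proof (cases "marks_on X C w = {}")
    case False
    then obtain x where "x \<in> marks_on X C w"
      by blast
    then show ?thesis
      by (intro bexI[of _ x]) (simp_all add: marks_on_iff)
  next
    case True
    then have "3 \<le> card (nodes_on C w)"
      using special_points(6)[OF w(1)] by (simp add: n_special_def)
    then have "\<not> nodes_on C w \<subseteq> {v}"
      using card_mono[of "{v}" "nodes_on C w"] by auto
    then obtain w' where "w' \<in> nodes_on C w" and w': "w' \<noteq> v"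
      by blast
    then have w': "{w, w'} \<in> E" "w' \<noteq> v"
      by (simp_all add: nodes_on_iff)
    have sub: "linked E v w u" if "u \<in> comps C" "linked E w w' u" for u
    proof (rule ccontr)
      assume "\<not> linked E v w u"
      then have "linked E w v u"
        using edge_separates[OF less.prems that(1)] by simp
      then have "linked E w v w'"
        using that(2) linked_trans linked_sym by metis
      then show False
        using linked_neighbours[of w v w'] less.prems w' by (simp add: insert_commute)
    qed
    have "w' \<noteq> w"
      using edgeD[OF w'(1)] by auto
    then have "\<not> linked E w w' w"
      using linked_neq by blast
    then have "{u \<in> comps C. linked E w w' u} \<subset> {u \<in> comps C. linked E v w u}"
      using sub w(1) by (intro psubsetI subsetI) auto
    then have "card {u \<in> comps C. linked E w w' u} < card {u \<in> comps C. linked E v w u}"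
      using finite_V by (intro psubset_card_mono) auto
    then obtain x where "x \<in> X" "linked E w w' (mc x)"
      using less.hyps w'(1) by blast
    then show ?thesis
      using sub[OF mc_comps] by blast
  qed
qed

lemma card_proj_to:
  assumes "v \<in> comps C"
  shows "card (proj_to C v ` X) = n_special X C v"
proof -
  note sp = special_points[OF assms]
  have "proj_to C v ` X = node_pt C v ` nodes_on C v \<union> mark_pt C ` marks_on X C v"
  proof (intro subset_antisym subsetI)
    fix p assume "p \<in> proj_to C v ` X"
    then obtain x where x: "x \<in> X" "p = proj_to C v x"
      by blast
    show "p \<in> node_pt C v ` nodes_on C v \<union> mark_pt C ` marks_on X C v"
    proof (cases "mc x = v")
      case True
      then show ?thesis
        using x by (auto simp: proj_to_mark marks_on_iff)
    next
      case False
      then show ?thesis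
        using proj_to_nodeE[OF assms x(1)] x(2) by (metis UnI1 imageI nodes_on_iff)
    qed
  next
    fix p assume "p \<in> node_pt C v ` nodes_on C v \<union> mark_pt C ` marks_on X C v"
    then consider w where "{v, w} \<in> E" "p = node_pt C v w" | x where "x \<in> X" "mc x = v" "p = mark_pt C x"
      by (auto simp: marks_on_iff nodes_on_iff)
    then show "p \<in> proj_to C v ` X"
    proof cases
      case 1
      then show ?thesis
        using node_leads_to_mark[OF 1(1)] proj_to_node[OF 1(1)] by force
    next
      case 2
      then show ?thesis
        using proj_to_mark by force
    qed
  qed
  moreover have "card (node_pt C v ` nodes_on C v \<union> mark_pt C ` marks_on X C v) =
      card (node_pt C v ` nodes_on C v) + card (mark_pt C ` marks_on X C v)"
    using finite_nodes_on finite_marks_on sp(5) by (intro card_Un_disjoint) auto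
  ultimately show ?thesis
    using sp(3,4) by (simp add: n_special_def card_image)
qed

lemma proj_to_opposite:
  assumes "v \<in> comps C" "w \<in> comps C" "v \<noteq> w"
  shows "\<exists>p q. \<forall>x\<in>X. proj_to C v x = p \<or> proj_to C w x = q"
proof -
  obtain w0 where w0: "{v, w0} \<in> E" "linked E v w0 w"
    using linked_neighbourE[of v w] assms by metis
  obtain v0 where v0: "{w, v0} \<in> E" "linked E w v0 v"
    using linked_neighbourE[of w v] assms by metis
  have "proj_to C v x = node_pt C v w0 \<or> proj_to C w x = node_pt C w v0" if "x \<in> X" for x
  proof -
    have "linked E v (mc x) w \<or> linked E w (mc x) v"
      using linked_or_linked[OF connected[OF assms(1) mc_comps[OF that]] assms(3)] .
    then have "linked E v w0 (mc x) \<or> linked E w v0 (mc x)"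
      using w0(2) v0(2) linked_trans linked_sym by metis
    then show ?thesis
      using proj_to_node w0(1) v0(1) by blast
  qed
  then show ?thesis
    by blast
qed

text \<open>
  Starting at the component of \<open>z\<close>, walk towards \<open>x\<close> and \<open>y\<close> as long as they are seen in the same direction.
\<close>
lemma proj_to_median:
  assumes "x \<in> X" "y \<in> X" "z \<in> X" "distinct [x, y, z]"
  shows "\<exists>v\<in>comps C. distinct [proj_to C v x, proj_to C v y, proj_to C v z]"
proof -
  define M where "M v = {u \<in> comps C. u = v \<or> \<not> linked E v u (mc z)}" for v
  have "\<exists>v\<in>comps C. distinct [proj_to C v x, proj_to C v y, proj_to C v z]"
    if "v \<in> comps C" "proj_to C v z \<noteq> proj_to C v x" "proj_to C v z \<noteq> proj_to C v y" for v
    using that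
  proof (induction "card (M v)" arbitrary: v rule: less_induct)
    case less
    show ?case
    proof (cases "proj_to C v x = proj_to C v y")
      case False
      then show ?thesis
        using less.prems by (intro bexI[of _ v]) auto
    next
      case True
      then have l: "mc x \<noteq> v" "mc y \<noteq> v" "linked E v (mc x) (mc y)"
        using proj_to_eq_iff[OF less.prems(1) assms(1,2)] assms(4) by auto
      obtain w where w: "{v, w} \<in> E" "linked E v w (mc x)"
        using proj_to_nodeE[OF less.prems(1) assms(1) l(1)] .
      have wy: "linked E v w (mc y)"
        using w(2) l(3) by (rule linked_trans)
      have wV: "w \<in> comps C" "v \<noteq> w"
        using edgeD[OF w(1)] by auto
      have nz: "\<not> linked E v w (mc z)"
      proof
        assume *: "linked E v w (mc z)"
        then have "linked E v (mc z) (mc x)"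
          using w(2) linked_trans linked_sym by metis
        moreover have "mc z \<noteq> v"
          using linked_neq[OF *] wV by auto
        ultimately show False
          using less.prems(2) proj_to_eq_iff[OF less.prems(1) assms(3,1)] l(1) by auto
      qed
      then have wz: "linked E w v (mc z)"
        using edge_separates[OF w(1) mc_comps[OF assms(3)]] by simp
      have "\<not> linked E w v (mc x)" "\<not> linked E w v (mc y)"
        using edge_separates[OF w(1)] mc_comps assms(1,2) w(2) wy by auto
      then have sep: "\<not> linked E w (mc z) (mc x)" "\<not> linked E w (mc z) (mc y)"
        using wz linked_trans by metis+
      have sub: "\<not> linked E v u (mc z)" if "u \<in> comps C" "\<not> linked E w u (mc z)" for u
      proof -
        have "\<not> linked E w v u"
          using that(2) wz linked_trans linked_sym by metis
        then have "linked E v w u"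
          using edge_separates[OF w(1) that(1)] by simp
        then show ?thesis
          using nz linked_trans by metis
      qed
      have "M w \<subset> M v"
      proof (rule psubsetI)
        show "M w \<subseteq> M v"
          using sub nz by (auto simp: M_def)
        have "v \<notin> M w"
          using wV wz by (simp add: M_def)
        then show "M w \<noteq> M v"
          using less.prems(1) by (auto simp: M_def)
      qed
      then have "card (M w) <
          card (M v)"
        using finite_V by (intro psubset_card_mono) (simp add: M_def)
      moreover have "proj_to C w z \<noteq> proj_to C w x" "proj_to C w z \<noteq> proj_to C w y"
        using sep proj_to_eq_iff[OF wV(1) assms(3)] assms by auto
      ultimately show ?thesis
        using less.hyps wV(1) by blast
    qed
  qed
  moreover have "proj_to C (mc z) z \<noteq> proj_to C (mc z) x" "proj_to C (mc z) z \<noteq> proj_to C (mc z) y"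
    using proj_to_eq_iff[OF mc_comps[OF assms(3)] assms(3)] assms by auto
  ultimately show ?thesis
    using mc_comps[OF assms(3)] by blast
qed

end

section \<open>Isomorphisms\<close>

lemma linked_iso:
  assumes E: "\<And>e. e \<in> E \<Longrightarrow> \<exists>x\<in>V. \<exists>y\<in>V. e = {x, y}" and h: "inj_on h V"
    and V: "v \<in> V" "a \<in> V" "b \<in> V"
  shows "linked ((\<lambda>e. h ` e) ` E) (h v) (h a) (h b) \<longleftrightarrow> linked E v a b"
proof
  let ?F = "(\<lambda>e. h ` e) ` E" and ?g = "inv_into V h"
  have g: "?g (h x) = x" if "x \<in> V" for x
    using inv_into_f_f[OF h that] .
  assume "linked ?F (h v) (h a) (h b)"
  then have "linked E v (?g (h a)) (?g (h b))"
  proof (rule linked_map)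
    fix x y assume xy: "{x, y} \<in> ?F" "x \<noteq> h v" "y \<noteq> h v"
    then obtain e where e: "e \<in> E" "{x, y} = h ` e"
      by blast
    then obtain p q where pq: "p \<in> V" "q \<in> V" "e = {p, q}"
      using E by blast
    have "{x, y} = {h p, h q}"
      using e(2) pq(3) by simp
    then consider "x = h p" "y = h q" | "x = h q" "y = h p"
      by (auto simp: doubleton_eq_iff)
    then show "linked E v (?g x) (?g y)"
    proof cases
      case 1
      then have "?g x = p" "?g y = q" "p \<noteq> v" "q \<noteq> v"
        using g pq xy by auto
      then show ?thesis
        using linked_edge[of p q E v] e(1) pq(3) by simp
    next
      case 2
      then have "?g x = q" "?g y = p" "p \<noteq> v" "q \<noteq> v"
        using g pq xy by auto
      then show ?thesis
        using linked_edge[of q p E v] e(1) pq(3) by (simp add: insert_commute)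
    qed
  qed
  then show "linked E v a b"
    using g V by simp
next
  assume "linked E v a b"
  then show "linked ((\<lambda>e. h ` e) ` E) (h v) (h a) (h b)"
  proof (rule linked_map)
    fix x y assume xy: "{x, y} \<in> E" "x \<noteq> v" "y \<noteq> v"
    then have "x \<in> V" "y \<in> V"
      using E[OF xy(1)] by (auto simp: doubleton_eq_iff)
    then have "h x \<noteq> h v" "h y \<noteq> h v"
      using inj_on_eq_iff[OF h] xy V(1) by auto
    moreover have "{h x, h y} \<in> (\<lambda>e. h ` e) ` E"
      using xy(1) by (intro image_eqI[of _ _ "{x, y}"]) auto
    ultimately show "linked ((\<lambda>e. h ` e) ` E) (h v) (h x) (h y)"
      by (intro linked_edge) auto
  qed
qed

definition same_branch :: "label set \<Rightarrow> curve \<Rightarrow> nat \<Rightarrow> (label \<times> label) set" where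
  "same_branch X C v = {(x, y). x \<in> X \<and> y \<in> X \<and> proj_to C v x = proj_to C v y}"

text \<open>
  The partitions of the labels into branches, one for each component, are an invariant of a curve that does not mention the
  components.
\<close>
definition branches :: "label set \<Rightarrow> curve \<Rightarrow> (label \<times> label) set set" where
  "branches X C = same_branch X C ` comps C"

definition trivalent_curve :: "label set \<Rightarrow> curve \<Rightarrow> bool" where
  "trivalent_curve X C \<longleftrightarrow> stable_curve X C \<and> (\<forall>v\<in>comps C. n_special X C v = 3)"

lemma branches_cong:
  assumes "comps D = h ` comps C"
    and "\<And>v x y. v \<in> comps C \<Longrightarrow> x \<in> X \<Longrightarrow> y \<in> X \<Longrightarrow>
      proj_to D (h v) x = proj_to D (h v) y \<longleftrightarrow> proj_to C v x = proj_to C v y"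
  shows "branches X D = branches X C"
  unfolding branches_def same_branch_def assms(1) image_image using assms(2) by (intro image_cong refl) auto

lemma card_image_quotient: "card (f ` X) = card (X // {(x, y). x \<in> X \<and> y \<in> X \<and> f x = f y})"
proof -
  have "X // {(x, y). x \<in> X \<and> y \<in> X \<and> f x = f y} = (\<Union>x\<in>X. {{y \<in> X. f y = f x}})"
    unfolding quotient_def by (intro SUP_cong refl) auto
  also have "\<dots> = (\<lambda>p. {y \<in> X. f y = p}) ` f ` X"
    by blast
  finally have "X // {(x, y). x \<in> X \<and> y \<in> X \<and> f x = f y} = (\<lambda>p. {y \<in> X. f y = p}) ` f ` X" .
  moreover have "inj_on (\<lambda>p. {y \<in> X. f y = p}) (f ` X)"
    by (auto simp: inj_on_def)
  ultimately show ?thesis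
    by (simp add: card_image)
qed

lemma curve_isoE:
  assumes "(C, D) \<in> curve_iso X"
  obtains h \<phi> where "stable_curve X C" "stable_curve X D" "bij_betw h (comps C) (comps D)"
    "nodes D = (\<lambda>e. h ` e) ` nodes C" "\<And>v. v \<in> comps C \<Longrightarrow> \<phi> v \<in> moebius"
    "\<And>x. x \<in> X \<Longrightarrow> mark_comp D x = h (mark_comp C x)"
    "\<And>x. x \<in> X \<Longrightarrow> mark_pt D x = \<phi> (mark_comp C x) (mark_pt C x)"
  using assms[unfolded curve_iso_def mem_Collect_eq case_prod_conv]
  by (elim conjE exE) (rule that, simp_all)

lemma curve_isoI:
  assumes "stable_curve X C" "stable_curve X D" "bij_betw h (comps C) (comps D)"
    "nodes D = (\<lambda>e. h ` e) ` nodes C" "\<And>v. v \<in> comps C \<Longrightarrow> \<phi> v \<in> moebius"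
    "\<And>v w. v \<in> comps C \<Longrightarrow> w \<in> nodes_on C v \<Longrightarrow> node_pt D (h v) (h w) = \<phi> v (node_pt C v w)"
    "\<And>x. x \<in> X \<Longrightarrow> mark_comp D x = h (mark_comp C x)"
    "\<And>x. x \<in> X \<Longrightarrow> mark_pt D x = \<phi> (mark_comp C x) (mark_pt C x)"
  shows "(C, D) \<in> curve_iso X"
  unfolding curve_iso_def mem_Collect_eq case_prod_conv
  by (intro conjI exI[of _ h] exI[of _ \<phi>] ballI assms)

text \<open>
  The number of special points of a component is the number of its branches, so trivalence is preserved along with the
  branches.
\<close>
lemma curve_iso_branches:
  assumes "(C, D) \<in> curve_iso X" "finite X"
  shows "branches X D = branches X C" "trivalent_curve X D \<longleftrightarrow> trivalent_curve X C"
proof -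
  obtain h where st: "stable_curve X C" "stable_curve X D"
    and h: "bij_betw h (comps C) (comps D)" "nodes D = (\<lambda>e. h ` e) ` nodes C"
    and mc: "\<And>x. x \<in> X \<Longrightarrow> mark_comp D x = h (mark_comp C x)"
    using curve_isoE[OF assms(1)] by metis
  interpret C: stable X C
    using st assms(2) by unfold_locales
  interpret D: stable X D
    using st assms(2) by unfold_locales
  have inj: "inj_on h (comps C)" and im: "comps D = h ` comps C"
    using h(1) by (auto simp: bij_betw_def)
  have hv: "h v \<in> comps D" if "v \<in> comps C" for v
    using that im by blast
  have E: "\<exists>x\<in>comps C. \<exists>y\<in>comps C. e = {x, y}" if "e \<in> nodes C" for e
    by (rule C.edgeE[OF that]) blast
  have eq: "proj_to D (h v) x = proj_to D (h v) y \<longleftrightarrow> proj_to C v x = proj_to C v y"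
    if "v \<in> comps C" "x \<in> X" "y \<in> X" for v x y
    unfolding C.proj_to_eq_iff[OF that] D.proj_to_eq_iff[OF hv[OF that(1)] that(2,3)] h(2)
    using linked_iso[OF E inj that(1) C.mc_comps[OF that(2)] C.mc_comps[OF that(3)]] mc that
      inj_on_eq_iff[OF inj C.mc_comps that(1)] by simp
  show "branches X D = branches X C"
    using branches_cong[OF im eq] .
  have "n_special X D (h v) = n_special X C v" if "v \<in> comps C" for v
  proof -
    have "{(x, y). x \<in> X \<and> y \<in> X \<and> proj_to D (h v) x = proj_to D (h v) y} =
        {(x, y). x \<in> X \<and> y \<in> X \<and> proj_to C v x = proj_to C v y}"
      using eq[OF that] by auto
    then show ?thesis
      using C.card_proj_to[OF that] D.card_proj_to[OF hv[OF that]]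
        card_image_quotient[of "proj_to C v" X] card_image_quotient[of "proj_to D (h v)" X] by simp
  qed
  then show "trivalent_curve X D \<longleftrightarrow> trivalent_curve X C"
    using st im by (simp add: trivalent_curve_def)
qed

lemma curve_iso_refl:
  assumes "stable_curve X C"
  shows "(C, C) \<in> curve_iso X"
proof -
  define I :: "point \<Rightarrow> point" where "I = (\<lambda>p. (\<lambda>v. vec2 (1 * v 0 + 0 * v 1) (0 * v 0 + 1 * v 1)) ` p)"
  have "1 * 1 - 0 * 0 \<noteq> (0::complex)"
    by simp
  then have "I \<in> moebius"
    unfolding moebius_def I_def by blast
  have I: "I p = p" if p: "p \<in> P1" for p
  proof -
    obtain u where u: "u \<in> vecs {0, 1}" "p = proj_pt u"
      using p unfolding proj_space_def by blast
    have "vec2 (1 * v 0 + 0 * v 1) (0 * v 0 + 1 * v 1) = v" if "v \<in> p" for v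
      using u that by (auto simp: vec2_def proj_pt_def vecs_def)
    then show ?thesis
      unfolding I_def by (simp add: image_cong[where g = "\<lambda>v. v"])
  qed
  have P1: "node_pt C v ` nodes_on C v \<subseteq> P1" "mark_pt C ` marks_on X C v \<subseteq> P1" if "v \<in> comps C" for v
    using assms that unfolding stable_curve_def by blast+
  have "mark_pt C x \<in> P1" if "x \<in> X" for x
  proof -
    have "mark_comp C x \<in> comps C" "x \<in> marks_on X C (mark_comp C x)"
      using assms that by (auto simp: stable_curve_def marks_on_def)
    then show ?thesis
      using P1(2) by blast
  qed
  moreover have "node_pt C v w \<in> P1" if "v \<in> comps C" "w \<in> nodes_on C v" for v w
    using P1(1)[OF that(1)] that(2) by blast
  ultimately show ?thesis
    using assms \<open>I \<in> moebius\<close> I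
    by (intro curve_isoI[where h = "\<lambda>v. v" and \<phi> = "\<lambda>_. I"]) (simp_all add: bij_betw_def)
qed

section \<open>Contracting a vertex of degree at most two\<close>

text \<open>
  If \<open>v\<close> has one neighbour, it is deleted; if it has two, they become adjacent.
\<close>
definition contract where
  "contract E v = {e \<in> E. v \<notin> e} \<union> {{p, q} |p q. p \<noteq> q \<and> {v, p} \<in> E \<and> {v, q} \<in> E}"

lemma contract_iff:
  "{x, y} \<in> contract E v \<longleftrightarrow>
    {x, y} \<in> E \<and> v \<noteq> x \<and> v \<noteq> y \<or> x \<noteq> y \<and> {v, x} \<in> E \<and> {v, y} \<in> E"
  by (auto simp: contract_def doubleton_eq_iff)

context tree
begin

text \<open>
  A walk that enters and leaves \<open>v\<close> does so by neighbours of \<open>v\<close>, which are adjacent after the contraction.  This carries most of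
  what follows: that the contracted graph is a tree, and that forgetting a marked point respects the branches.
\<close>
lemma linked_contract:
  assumes "x \<noteq> v" "a \<noteq> v" "b \<noteq> v"
  shows "linked (contract E v) x a b \<longleftrightarrow> linked E x a b"
proof
  assume "linked (contract E v) x a b"
  then show "linked E x a b"
  proof (rule linked_map[where f = "\<lambda>y. y"])
    fix y z assume yz: "{y, z} \<in> contract E v" "y \<noteq> x" "z \<noteq> x"
    then consider "{y, z} \<in> E" | "{v, y} \<in> E" "{v, z} \<in> E"
      by (auto simp: contract_iff)
    then show "linked E x y z"
    proof cases
      case 2
      then have "linked E x v y" "linked E x v z"
        using linked_edge yz assms(1) by metis+
      then show ?thesis
        using linked_trans linked_sym by metis
    qed (use linked_edge yz in metis)
  qed
next
  \<comment> \<open>A walk through \<open>v\<close> is rerouted through a neighbour of \<open>v\<close> other than \<open>x\<close>.\<close>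
  define u where "u = (SOME u. {v, u} \<in> E \<and> u \<noteq> x)"
  have u: "{v, u} \<in> E \<and> u \<noteq> x" if "{v, y} \<in> E" "y \<noteq> x" for y
    unfolding u_def by (rule someI[of "\<lambda>u. {v, u} \<in> E \<and> u \<noteq> x", OF conjI[OF that]])
  let ?f = "\<lambda>y. if y = v then u else y"
  have via: "linked (contract E v) x u z" if "{v, z} \<in> E" "z \<noteq> x" for z
    using u[OF that] that linked_edge[of u z "contract E v" x] by (cases "u = z") (auto simp: contract_iff)
  assume "linked E x a b"
  then have "linked (contract E v) x (?f a) (?f b)"
  proof (rule linked_map)
    fix y z assume yz: "{y, z} \<in> E" "y \<noteq> x" "z \<noteq> x"
    then have "y \<noteq> z"
      using edgeD by blast
    consider "y = v" "z \<noteq> v" | "z = v" "y \<noteq> v" | "y \<noteq> v" "z \<noteq> v"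
      using \<open>y \<noteq> z\<close> by blast
    then show "linked (contract E v) x (?f y) (?f z)"
    proof cases
      case 1
      then show ?thesis
        using via[of z] yz by simp
    next
      case 2
      then have "linked (contract E v) x u y"
        using via[of y] yz by (simp add: insert_commute)
      then show ?thesis
        using 2 linked_sym by simp
    next
      case 3
      then show ?thesis
        using yz linked_edge[of y z "contract E v" x] by (auto simp: contract_iff)
    qed
  qed
  then show "linked (contract E v) x a b"
    using assms by simp
qed

lemma tree_contract:
  assumes deg: "\<And>p. card ({w. {v, w} \<in> E} - {p}) \<le> 1 \<or> \<not> {v, p} \<in> E" and ne: "V \<noteq> {v}" and v: "v \<in> V"
  shows "is_tree (V - {v}) (contract E v)"
  unfolding is_tree_def
proof (intro conjI ballI)
  show "finite (V - {v})"
    using finite_V by simp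
  show "V - {v} \<noteq> {}"
    using ne v by blast
next
  fix e assume "e \<in> contract E v"
  then consider "e \<in> E" "v \<notin> e" | p q where "e = {p, q}" "p \<noteq> q" "{v, p} \<in> E" "{v, q} \<in> E"
    unfolding contract_def by blast
  then show "\<exists>x\<in>V - {v}. \<exists>y\<in>V - {v}. x \<noteq> y \<and> e = {x, y}"
  proof cases
    case 1
    obtain x y where "e = {x, y}" "x \<in> V" "y \<in> V" "x \<noteq> y"
      by (rule edgeE[OF 1(1)])
    then show ?thesis
      using 1(2) by (intro bexI[of _ x] bexI[of _ y]) auto
  next
    case 2
    then show ?thesis
      using edgeD[OF 2(3)] edgeD[OF 2(4)] by (intro bexI[of _ p] bexI[of _ q]) auto
  qed
next
  fix a b assume ab: "a \<in> V - {v}" "b \<in> V - {v}"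
  show "reach (contract E v) a b"
  proof (cases "a = b")
    case False
    have "linked E a b v \<or> linked E v b a"
      using linked_or_linked[of E a b v] connected ab by simp
    then show ?thesis
    proof
      assume l: "linked E v b a"
      then have "reach (contract E v) b a"
        unfolding linked_def by (rule reach_mono) (auto simp: contract_def)
      then show ?thesis
        by (rule reach_sym)
    next
      assume l: "linked E a b v"
      obtain w where w: "{v, w} \<in> E" "linked E v w b"
        using linked_neighbourE[of v b] v ab by auto
      obtain u where u: "{v, u} \<in> E" "linked E v u a"
        using linked_neighbourE[of v a] v ab by auto
      have "reach (contract E v) w b" "reach (contract E v) u a"
        using w(2) u(2) unfolding linked_def by (auto intro: reach_mono simp: contract_def)
      moreover have "reach (contract E v) u w"
        using w(1) u(1) reach_edge[of u w "contract E v"] by (cases "u = w") (auto simp: contract_iff)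
      ultimately show ?thesis
        using reach_trans reach_sym by metis
    qed
  qed simp
next
  show "\<nexists>p. is_cycle (contract E v) p"
  proof (rule acyclicI)
    fix x y y'
    assume xy: "{x, y} \<in> contract E v" "{x, y'} \<in> contract E v" and l: "linked (contract E v) x y y'"
    then have nv: "x \<noteq> v" "y \<noteq> v" "y' \<noteq> v"
      using edgeD by (auto simp: contract_iff)
    then have l: "linked E x y y'"
      using l linked_contract by simp
    have mixed: False if "x \<noteq> y" "{v, x} \<in> E" "{v, y} \<in> E" "{x, y'} \<in> E" "linked E x y y'" "y' \<noteq> v" for y y'
    proof -
      have "linked E x v y"
        using that nv by (intro linked_edge) auto
      then have "linked E x v y'"
        using that(5) by (rule linked_trans)
      then show False
        using linked_neighbours[of x v y'] that by (simp add: insert_commute)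
    qed
    have l': "linked E x y' y"
      using l by (rule linked_sym)
    consider "{x, y} \<in> E" "{x, y'} \<in> E"
      | "x \<noteq> y" "{v, x} \<in> E" "{v, y} \<in> E" "{x, y'} \<in> E"
      | "x \<noteq> y'" "{v, x} \<in> E" "{v, y'} \<in> E" "{x, y} \<in> E"
      | "x \<noteq> y" "x \<noteq> y'" "{v, x} \<in> E" "{v, y} \<in> E" "{v, y'} \<in> E"
      using xy unfolding contract_iff by blast
    then show "y = y'"
    proof cases
      case 1
      then show ?thesis
        using linked_neighbours l by blast
    next
      case 2
      then show ?thesis
        using mixed[OF 2(1-4) l nv(3)] by blast
    next
      case 3
      then show ?thesis
        using mixed[OF 3(1-4) l' nv(2)] by blast
    next
      case 4
      then have "card ({w. {v, w} \<in> E} - {x}) \<le> 1"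
        using deg[of x] by blast
      moreover have "finite ({w. {v, w} \<in> E} - {x})"
        by (rule finite_subset[OF _ finite_V]) (use edgeD in blast)
      moreover have "y \<in> {w. {v, w} \<in> E} - {x}" "y' \<in> {w. {v, w} \<in> E} - {x}"
        using 4 by auto
      ultimately show ?thesis
        using card_le_Suc0_iff_eq by (metis One_nat_def)
    qed
  qed
qed

end

section \<open>Forgetting a marked point\<close>

lemma inj_on_case_sum:
  "inj_on (case_sum f g) (Inl ` A \<union> Inr ` B) \<longleftrightarrow> inj_on f A \<and> inj_on g B \<and> f ` A \<inter> g ` B = {}"
proof (intro iffI conjI inj_onI)
  assume *: "inj_on (case_sum f g) (Inl ` A \<union> Inr ` B)"
  show "x = y" if "x \<in> A" "y \<in> A" "f x = f y" for x y
    using inj_onD[OF *, of "Inl x" "Inl y"] that by simp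
  show "x = y" if "x \<in> B" "y \<in> B" "g x = g y" for x y
    using inj_onD[OF *, of "Inr x" "Inr y"] that by simp
  have "f x \<noteq> g y" if "x \<in> A" "y \<in> B" for x y
    using inj_onD[OF *, of "Inl x" "Inr y"] that by auto
  then show "f ` A \<inter> g ` B = {}"
    by blast
next
  fix z z'
  assume *: "inj_on f A \<and> inj_on g B \<and> f ` A \<inter> g ` B = {}"
    and z: "z \<in> Inl ` A \<union> Inr ` B" "z' \<in> Inl ` A \<union> Inr ` B" "case_sum f g z = case_sum f g z'"
  have "f x \<noteq> g y" if "x \<in> A" "y \<in> B" for x y
    using * that by blast
  then show "z = z'"
    using inj_onD[OF conjunct1[OF *]] inj_onD[OF conjunct1[OF conjunct2[OF *]]] z
    by (cases z; cases z') (auto dest: sym)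
qed

locale forget_point = stable +
  fixes i :: label
  assumes trivalent: "v \<in> comps C \<Longrightarrow> n_special X C v = 3" and i: "i \<in> X" and card_X: "3 < card X"
begin

definition v0 where "v0 = mc i"
definition w0 where "w0 = (SOME w. w \<in> nodes_on C v0)"
definition F where "F = forget_curve X i C"

lemma v0: "v0 \<in> comps C"
  using mc_comps[OF i] by (simp add: v0_def)

lemma F_simps:
  "comps F = comps C - {v0}"
  "nodes F = contract E v0"
  "node_pt F u u' = (if {u, u'} \<in> E then node_pt C u u' else node_pt C u v0)"
  "mark_comp F x = (if mc x = v0 then w0 else mc x)"
  "mark_pt F x = (if mc x = v0 then node_pt C w0 v0 else mark_pt C x)"
  using trivalent[OF v0]
  unfolding F_def forget_curve_def Let_def v0_def[symmetric] w0_def[symmetric]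
  by (simp_all add: contract_def nodes_on_def)

text \<open>
  Besides \<open>i\<close> there are two special points.  They are not both marked points, as then the curve would have just three labels.
\<close>
lemma v0_cases:
  obtains p q where "nodes_on C v0 = {p, q}" "p \<noteq> q" "marks_on X C v0 = {i}"
  | l where "nodes_on C v0 = {w0}" "marks_on X C v0 = {i, l}" "l \<noteq> i"
proof -
  have i_on: "i \<in> marks_on X C v0"
    using i by (simp add: marks_on_iff v0_def)
  have sum: "card (nodes_on C v0) + card (marks_on X C v0) = 3"
    using trivalent[OF v0] by (simp add: n_special_def)
  have "nodes_on C v0 \<noteq> {}"
  proof
    assume none: "nodes_on C v0 = {}"
    have "mc x = v0" if "x \<in> X" for x
    proof (rule ccontr)
      assume "mc x \<noteq> v0"
      then show False
        using linked_neighbourE[OF v0 mc_comps[OF that]] none nodes_on_iff by (metis empty_iff)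
    qed
    then have "marks_on X C v0 = X"
      by (auto simp: marks_on_iff)
    then show False
      using sum none card_X by simp
  qed
  then have "card (nodes_on C v0) \<noteq> 0"
    using finite_nodes_on by simp
  moreover have m: "card (marks_on X C v0) = Suc (card (marks_on X C v0 - {i}))"
    using card.remove[OF finite_marks_on i_on] .
  ultimately consider "card (nodes_on C v0) = 2" "card (marks_on X C v0 - {i}) = 0"
    | "card (nodes_on C v0) = 1" "card (marks_on X C v0 - {i}) = 1"
    using sum by linarith
  then show thesis
  proof cases
    case 1
    then have "marks_on X C v0 - {i} = {}"
      using 1(2) card_0_eq[OF finite_Diff[OF finite_marks_on]] by metis
    then have "marks_on X C v0 = {i}"
      using i_on by blast
    moreover obtain p q where "nodes_on C v0 = {p, q}" "p \<noteq> q"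
      using 1(1) unfolding card_2_iff by blast
    ultimately show thesis
      using that(1) by blast
  next
    case 2
    obtain p where p: "nodes_on C v0 = {p}"
      using 2(1) by (rule card_1_singletonE)
    obtain l where l: "marks_on X C v0 - {i} = {l}"
      using 2(2) by (rule card_1_singletonE)
    have "w0 = p"
      unfolding w0_def p by simp
    moreover have "marks_on X C v0 = {i, l}" "l \<noteq> i"
      using l i_on by blast+
    ultimately show thesis
      using that(2) p by blast
  qed
qed

lemma v0_neighbour: "nodes_on C v0 \<noteq> {}"
  by (rule v0_cases) auto

lemma w0: "{v0, w0} \<in> E"
proof -
  have "w0 \<in> nodes_on C v0"
    unfolding w0_def by (rule someI_ex) (use v0_neighbour in blast)
  then show ?thesis
    by (simp add: nodes_on_iff)
qed

lemma F_tree: "is_tree (comps F) (nodes F)"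
  unfolding F_simps
proof (rule tree_contract[OF _ _ v0])
  show "card ({w. {v0, w} \<in> E} - {p}) \<le> 1 \<or> {v0, p} \<notin> E" for p
  proof (rule v0_cases)
    fix q q' assume "nodes_on C v0 = {q, q'}" "q \<noteq> q'"
    then show ?thesis
      by (cases "p = q"; cases "p = q'") (auto simp: nodes_on_def)
  next
    assume "nodes_on C v0 = {w0}"
    then show ?thesis
      by (simp add: nodes_on_def card_Diff_singleton_if)
  qed
  show "comps C \<noteq> {v0}"
    using edgeD[OF w0] by auto
qed

definition special :: "nat \<Rightarrow> (nat + label) set" where
  "special v = Inl ` nodes_on C v \<union> Inr ` marks_on X C v"

definition special_F :: "nat \<Rightarrow> (nat + label) set" where
  "special_F v = Inl ` nodes_on F v \<union> Inr ` marks_on (X - {i}) F v"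

definition point :: "nat \<Rightarrow> nat + label \<Rightarrow> point" where
  "point v = case_sum (node_pt C v) (mark_pt C)"

text \<open>
  The special point of \<open>C\<close> in whose place a special point of \<open>F\<close> on the same component has come: a new node or a moved marked
  point takes the place of the node at which the contracted component was attached.
\<close>
definition old :: "nat \<Rightarrow> nat + label \<Rightarrow> nat + label" where
  "old v = case_sum (\<lambda>u. if {v, u} \<in> E then Inl u else Inl v0) (\<lambda>x. if mc x = v0 then Inl v0 else Inr x)"

lemma nodes_on_F: "w \<in> nodes_on F v \<longleftrightarrow> {v, w} \<in> E \<and> v \<noteq> v0 \<and> w \<noteq> v0 \<or> v \<noteq> w \<and> {v0, v} \<in> E \<and> {v0, w} \<in> E"
  by (auto simp: nodes_on_def F_simps contract_iff)

lemma no_triangle: "{v0, v} \<in> E \<Longrightarrow> {v0, w} \<in> E \<Longrightarrow> {v, w} \<notin> E"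
proof
  assume "{v0, v} \<in> E" "{v0, w} \<in> E" "{v, w} \<in> E"
  moreover from this have "linked E v0 v w"
    using edgeD by (intro linked_edge) auto
  ultimately show False
    using linked_neighbours edgeD by blast
qed

lemma old_old: "z \<in> special v \<Longrightarrow> v \<noteq> v0 \<Longrightarrow> old v z = z"
  by (auto simp: special_def old_def nodes_on_iff marks_on_iff)

lemma marks_on_F: "x \<in> marks_on (X - {i}) F v \<longleftrightarrow> x \<in> X \<and> x \<noteq> i \<and> (if mc x = v0 then w0 else mc x) = v"
  by (auto simp: marks_on_def F_simps)

lemma old_special:
  assumes "v \<in> comps C" "v \<noteq> v0"
  shows "bij_betw (old v) (special_F v) (special v)"
proof -
  have replaced: ?thesis
    if "{v0, v} \<in> E" "z \<notin> special v" "old v z = Inl v0" "special_F v = insert z (special v - {Inl v0})" for z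
  proof -
    have "bij_betw (old v) (special v - {Inl v0}) (special v - {Inl v0})"
      using old_old[OF _ assms(2)] by (auto simp: bij_betw_def inj_on_def)
    then have "bij_betw (old v) (insert z (special v - {Inl v0})) (insert (Inl v0) (special v - {Inl v0}))"
      using notIn_Un_bij_betw[of z "special v - {Inl v0}" "old v" "special v - {Inl v0}"] that(2,3) by simp
    moreover have "Inl v0 \<in> special v"
      using that(1) by (simp add: special_def nodes_on_iff insert_commute)
    ultimately show ?thesis
      using that(4) by (simp add: insert_absorb)
  qed
  show ?thesis
  proof (cases "{v0, v} \<in> E")
    case False
    then have "nodes_on F v = nodes_on C v"
      using assms(2) by (auto simp: nodes_on_F nodes_on_iff insert_commute)
    moreover have "v \<noteq> w0"
      using False w0 by auto
    then have "marks_on (X - {i}) F v = marks_on X C v"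
      using assms(2) by (auto simp: marks_on_F marks_on_iff v0_def)
    ultimately have "special_F v = special v"
      by (simp add: special_def special_F_def)
    then show ?thesis
      using old_old[OF _ assms(2)] by (auto simp: bij_betw_def inj_on_def)
  next
    case v: True
    show ?thesis
    proof (rule v0_cases)
      fix p q assume pq: "nodes_on C v0 = {p, q}" "p \<noteq> q" "marks_on X C v0 = {i}"
      define u where "u = (if v = p then q else p)"
      have "v = p \<or> v = q"
        using v pq(1) by (auto simp: nodes_on_def)
      then have u: "u \<noteq> v" "nodes_on C v0 = {v, u}"
        using pq(1,2) by (auto simp: u_def)
      then have nbr: "{v0, w} \<in> E \<longleftrightarrow> w = v \<or> w = u" for w
        by (auto simp: nodes_on_def)
      have "u \<noteq> v0"
        using edgeD[of v0 u] nbr[of u] by auto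
      have "{v, u} \<notin> E"
        using no_triangle[of v u] nbr by blast
      have "nodes_on F v = insert u (nodes_on C v - {v0})"
        using assms(2) u(1) \<open>u \<noteq> v0\<close> edgeD[of v0 v0] by (auto simp: nodes_on_F nodes_on_iff nbr)
      moreover have "mc x \<noteq> v0" if "x \<in> X" "x \<noteq> i" for x
        using pq(3) that by (auto simp: marks_on_def)
      then have "marks_on (X - {i}) F v = marks_on X C v"
        using assms(2) by (auto simp: marks_on_F marks_on_iff v0_def)
      ultimately have "special_F v = insert (Inl u) (special v - {Inl v0})"
        by (auto simp: special_def special_F_def)
      moreover have "Inl u \<notin> special v" "old v (Inl u) = Inl v0"
        using \<open>{v, u} \<notin> E\<close> by (auto simp: special_def old_def nodes_on_iff)
      ultimately show ?thesis
        using replaced[OF v, of "Inl u"] by blast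
    next
      fix l assume l: "nodes_on C v0 = {w0}" "marks_on X C v0 = {i, l}" "l \<noteq> i"
      then have nbr: "{v0, w} \<in> E \<longleftrightarrow> w = w0" for w
        by (auto simp: nodes_on_def)
      then have "v = w0"
        using v by simp
      have l_v0: "x \<in> X \<and> mc x = v0 \<longleftrightarrow> x = i \<or> x = l" for x
        using l(2) by (auto simp: marks_on_def)
      have "nodes_on F v = nodes_on C v - {v0}"
        using assms(2) \<open>v = w0\<close> edgeD[of v0 v0] by (auto simp: nodes_on_F nodes_on_iff nbr)
      moreover have "marks_on (X - {i}) F v = insert l (marks_on X C v)"
      proof (rule set_eqI)
        fix x
        show "x \<in> marks_on (X - {i}) F v \<longleftrightarrow> x \<in> insert l (marks_on X C v)"
          using assms(2) \<open>v = w0\<close> l(3) l_v0[of x] l_v0[of i]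
          unfolding marks_on_F insert_iff marks_on_iff by (cases "mc x = v0") auto
      qed
      ultimately have "special_F v = insert (Inr l) (special v - {Inl v0})"
        by (auto simp: special_def special_F_def)
      moreover have "mc l = v0" "mc l \<noteq> v"
        using l_v0[of l] assms(2) by auto
      then have "Inr l \<notin> special v" "old v (Inr l) = Inl v0"
        by (auto simp: special_def old_def marks_on_iff)
      ultimately show ?thesis
        using replaced[OF v, of "Inr l"] by blast
    qed
  qed
qed

lemma card_special: "card (special v) = n_special X C v"
  unfolding special_def n_special_def
  by (subst card_Un_disjoint) (auto simp: finite_nodes_on finite_marks_on card_image)

lemma n_special_F:
  assumes "v \<in> comps F"
  shows "n_special (X - {i}) F v = n_special X C v"
proof -
  have v: "v \<in> comps C" "v \<noteq> v0"
    using assms by (auto simp: F_simps)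
  have "finite (special v)"
    by (simp add: special_def finite_nodes_on finite_marks_on)
  then have "finite (special_F v)"
    using bij_betw_finite[OF old_special[OF v]] by simp
  then have "n_special (X - {i}) F v = card (special_F v)"
    unfolding special_F_def n_special_def
    by (subst card_Un_disjoint) (auto simp: card_image finite_image_iff)
  then show ?thesis
    using bij_betw_same_card[OF old_special[OF v]] card_special by simp
qed

lemma F_stable: "stable_curve (X - {i}) F"
  unfolding stable_curve_def
proof (intro conjI[OF F_tree] conjI ballI)
  fix x assume "x \<in> X - {i}"
  then show "mark_comp F x \<in> comps F"
    using mc_comps[of x] edgeD[OF w0] by (auto simp: F_simps)
next
  fix v assume vF: "v \<in> comps F"
  then have v: "v \<in> comps C" "v \<noteq> v0"
    by (auto simp: F_simps)
  let ?point = "case_sum (node_pt F v) (mark_pt F)"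
  note sp = special_points[OF v(1)]
  have inj: "inj_on (point v) (special v)" and P1: "point v ` special v \<subseteq> P1"
    using sp(1-5) by (auto simp: point_def special_def inj_on_case_sum)
  have eq: "?point z = point v (old v z)" if "z \<in> special_F v" for z
    using that by (auto simp: special_F_def point_def old_def F_simps marks_on_F)
  have "inj_on (point v \<circ> old v) (special_F v)"
    using old_special[OF v] inj by (intro comp_inj_on) (auto simp: bij_betw_def)
  then have "inj_on ?point (special_F v)"
    using eq by (subst inj_on_cong[where g = "point v \<circ> old v"]) auto
  then show "inj_on (node_pt F v) (nodes_on F v)" "inj_on (mark_pt F) (marks_on (X - {i}) F v)"
    "node_pt F v ` nodes_on F v \<inter> mark_pt F ` marks_on (X - {i}) F v = {}"
    by (auto simp: special_F_def inj_on_case_sum)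
  have "?point ` special_F v \<subseteq> P1"
    using eq old_special[OF v] P1 by (fastforce simp: bij_betw_def)
  then show "node_pt F v ` nodes_on F v \<subseteq> P1" "mark_pt F ` marks_on (X - {i}) F v \<subseteq> P1"
    by (auto simp: special_F_def image_Un image_image)
  show "3 \<le> n_special (X - {i}) F v"
    using n_special_F[OF vF] trivalent[OF v(1)] by simp
qed

lemma F_trivalent: "trivalent_curve (X - {i}) F"
  using F_stable n_special_F trivalent by (auto simp: trivalent_curve_def F_simps)

text \<open>
  A marked point \<open>x\<close> that moves from the contracted component to its only neighbour \<open>w0\<close> is seen in the same direction as
  before, except from \<open>w0\<close>.  There it forms a branch of its own, and so it did before: the branch consisted of \<open>x\<close> and \<open>i\<close>.
\<close>
lemma F_proj_to_eq:
  assumes v: "v \<in> comps F" and xy: "x \<in> X - {i}" "y \<in> X - {i}"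
  shows "proj_to F v x = proj_to F v y \<longleftrightarrow> proj_to C v x = proj_to C v y"
proof -
  interpret F: stable "X - {i}" F
    using finite_X F_stable by unfold_locales auto
  have vC: "v \<in> comps C" "v \<noteq> v0" and XY: "x \<in> X" "y \<in> X"
    using v xy by (auto simp: F_simps)
  have leaf: "mc z = v0" if "{w. {v0, w} \<in> E} = {v}" "linked E v v0 (mc z)" for z
  proof -
    have "u = v0" if "linked E v v0 u" for u
      using that by (induction rule: linked_induct) (use \<open>{w. {v0, w} \<in> E} = {v}\<close> in blast)+
    then show ?thesis
      using that(2) by blast
  qed
  let ?m = "mark_comp F"
  have m_v0: "?m z \<noteq> v0" for z
    using edgeD[OF w0] by (simp add: F_simps)
  have "?m x \<noteq> v \<and> ?m y \<noteq> v \<and> linked (nodes F) v (?m x) (?m y) \<longleftrightarrow>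
      mc x \<noteq> v \<and> mc y \<noteq> v \<and> linked E v (mc x) (mc y)" if "x \<noteq> y"
  proof -
    have "linked (nodes F) v (?m x) (?m y) \<longleftrightarrow> linked E v (?m x) (?m y)"
      using linked_contract[OF vC(2) m_v0 m_v0] by (simp add: F_simps(2))
    moreover have "?m x \<noteq> v \<and> ?m y \<noteq> v \<and> linked E v (?m x) (?m y) \<longleftrightarrow>
      mc x \<noteq> v \<and> mc y \<noteq> v \<and> linked E v (mc x) (mc y)"
    proof (cases "mc x = v0 \<or> mc y = v0")
      case False
      then show ?thesis
        by (simp add: F_simps)
    next
      case True
      have moved: "?m x \<noteq> v \<and> ?m y \<noteq> v \<and> linked E v (?m x) (?m y) \<longleftrightarrow>
          mc x \<noteq> v \<and> mc y \<noteq> v \<and> linked E v (mc x) (mc y)"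
        if x: "mc x = v0" "x \<in> X" "x \<noteq> i" and y: "y \<in> X" "y \<noteq> i" "x \<noteq> y" for x y
      proof (rule v0_cases)
        fix p q assume "marks_on X C v0 = {i}"
        then show ?thesis
          using x by (auto simp: marks_on_def)
      next
        fix l assume l: "nodes_on C v0 = {w0}" "marks_on X C v0 = {i, l}"
        have "y \<noteq> l" "x = l"
          using x y l(2) by (auto simp: marks_on_def)
        then have my: "mc y \<noteq> v0"
          using y l(2) by (auto simp: marks_on_def)
        show ?thesis
        proof (cases "v = w0")
          case True
          then have "\<not> linked E v v0 (mc y)"
            using leaf[of y] l(1) my by (auto simp: nodes_on_def)
          then show ?thesis
            using True x(1) by (simp add: F_simps)
        next
          case False
          then have "linked E v v0 w0"
            using w0 vC(2) by (intro linked_edge) auto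
          then have "linked E v w0 z \<longleftrightarrow> linked E v v0 z" for z
            using linked_trans linked_sym by metis
          then show ?thesis
            using False x(1) my vC(2) by (auto simp: F_simps)
        qed
      qed
      show ?thesis
      proof (cases "mc x = v0")
        case True
        then show ?thesis
          using moved[of x y] xy that by simp
      next
        case False
        then have "mc y = v0"
          using True by simp
        then have "?m y \<noteq> v \<and> ?m x \<noteq> v \<and> linked E v (?m y) (?m x) \<longleftrightarrow>
          mc y \<noteq> v \<and> mc x \<noteq> v \<and> linked E v (mc y) (mc x)"
          using moved[of y x] xy that by simp
        then show ?thesis
          using linked_sym by metis
      qed
    qed
    ultimately show ?thesis
      by simp
  qed
  then show ?thesis
    unfolding proj_to_eq_iff[OF vC(1) XY] F.proj_to_eq_iff[OF v xy] by blast
qed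

end

section \<open>The dual tree\<close>

context stable
begin

abbreviation "D \<equiv> dual_tree X C"

lemma dual_edge_iff:
  "e \<in> edges D \<longleftrightarrow> (\<exists>u w. e = {Inl u, Inl w} \<and> {u, w} \<in> E) \<or> (\<exists>x\<in>X. e = {Inr x, Inl (mc x)})"
  by (auto simp: dual_tree_def)

lemma dual_edges:
  assumes "e \<in> edges D"
  shows "\<exists>a\<in>verts D. \<exists>b\<in>verts D. e = {a, b}"
proof -
  from assms consider u w where "e = {Inl u, Inl w}" "{u, w} \<in> E" | x where "x \<in> X" "e = {Inr x, Inl (mc x)}"
    unfolding dual_edge_iff by blast
  then show ?thesis
  proof cases
    case 1
    then show ?thesis
      using edgeD[OF 1(2)] by (intro bexI[of _ "Inl u"] bexI[of _ "Inl w"]) (auto simp: dual_tree_def)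
  next
    case 2
    then show ?thesis
      using mc_comps[OF 2(1)] by (intro bexI[of _ "Inr x"] bexI[of _ "Inl (mc x)"]) (auto simp: dual_tree_def)
  qed
qed

lemma dual_linked_imp_proj_to_eq:
  assumes v: "v \<in> comps C" and x: "x \<in> X" and y: "y \<in> X"
    and l: "linked (edges D) (Inl v) (Inr x) (Inr y)"
  shows "proj_to C v x = proj_to C v y"
proof -
  have "case b of Inl u \<Rightarrow> mc x \<noteq> v \<and> linked E v (mc x) u
      | Inr z \<Rightarrow> z = x \<or> (mc x \<noteq> v \<and> mc z \<noteq> v \<and> linked E v (mc x) (mc z))"
    if "linked (edges D) (Inl v) (Inr x) b" for b
    using that
  proof (induction rule: linked_induct)
    case (step a b)
    from step(2) consider u w where "{a, b} = {Inl u, Inl w}" "{u, w} \<in> E" | z where "z \<in> X" "{a, b} = {Inr z, Inl (mc z)}"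
      unfolding dual_edge_iff by blast
    then show ?case
    proof cases
      case 1
      then obtain u w where uw: "a = Inl u" "b = Inl w" "{u, w} \<in> E"
        by (auto simp: doubleton_eq_iff insert_commute)
      then have "linked E v u w"
        using step(3,4) by (intro linked_edge) auto
      then show ?thesis
        using step.IH uw linked_trans by auto
    next
      case 2
      then consider "a = Inr z" "b = Inl (mc z)" | "a = Inl (mc z)" "b = Inr z"
        by (auto simp: doubleton_eq_iff)
      then show ?thesis
        using step.IH step(3,4) by cases auto
    qed
  qed simp
  from this[OF l] show ?thesis
    using proj_to_eq_iff[OF v x y] by auto
qed

lemma card_edges_at_dual:
  assumes "v \<in> comps C"
  shows "card (edges_at D (Inl v)) = n_special X C v"
proof -
  have "edges_at D (Inl v) = (\<lambda>w. {Inl v, Inl w}) ` nodes_on C v \<union> (\<lambda>x. {Inr x, Inl v}) ` marks_on X C v"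
  proof (intro subset_antisym subsetI)
    fix e assume "e \<in> edges_at D (Inl v)"
    then have e: "e \<in> edges D" "Inl v \<in> e"
      by (auto simp: edges_at_def)
    from e(1) consider u w where "e = {Inl u, Inl w}" "{u, w} \<in> E" | x where "x \<in> X" "e = {Inr x, Inl (mc x)}"
      unfolding dual_edge_iff by blast
    then show "e \<in> (\<lambda>w. {Inl v, Inl w}) ` nodes_on C v \<union> (\<lambda>x. {Inr x, Inl v}) ` marks_on X C v"
    proof cases
      case 1
      then have "u = v \<or> w = v"
        using e(2) by auto
      then obtain w' where "e = {Inl v, Inl w'}" "{v, w'} \<in> E"
        using 1 by (auto simp: insert_commute)
      then show ?thesis
        by (auto simp: nodes_on_iff)
    next
      case 2
      then show ?thesis
        using e(2) by (auto simp: marks_on_iff)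
    qed
  next
    fix e :: "(nat + label) set"
    assume "e \<in> (\<lambda>w. {Inl v, Inl w}) ` nodes_on C v \<union> (\<lambda>x. {Inr x, Inl v}) ` marks_on X C v"
    then show "e \<in> edges_at D (Inl v)"
      by (auto simp: edges_at_def dual_edge_iff nodes_on_iff marks_on_iff)
  qed
  moreover have "card ((\<lambda>w. {Inl v, Inl w} :: (nat + label) set) ` nodes_on C v) = card (nodes_on C v)"
    by (rule card_image) (auto simp: inj_on_def doubleton_eq_iff)
  moreover have "card ((\<lambda>x. {Inr x, Inl v} :: (nat + label) set) ` marks_on X C v) = card (marks_on X C v)"
    by (rule card_image) (auto simp: inj_on_def doubleton_eq_iff)
  moreover have "(\<lambda>w. {Inl v, Inl w} :: (nat + label) set) ` nodes_on C v \<inter> (\<lambda>x. {Inr x, Inl v}) ` marks_on X C v = {}"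
    by (auto simp: doubleton_eq_iff)
  ultimately show ?thesis
    by (simp add: n_special_def card_Un_disjoint finite_nodes_on finite_marks_on)
qed

text \<open>
  The number of special points of a component is the degree of its vertex, which is 1 or 3 in \<open>T\<close>, and stability excludes 1.
\<close>
lemma dual_tree_iso:
  assumes iso: "ltree_iso X D T" and T: "trivalent T"
  shows "trivalent_curve X C"
    and "v \<in> comps C \<Longrightarrow> \<exists>t\<in>verts T. card (edges_at T t) = 3 \<and>
      (\<forall>x\<in>X. \<forall>y\<in>X. linked (edges T) t (leaf T x) (leaf T y) \<longrightarrow> proj_to C v x = proj_to C v y)"
proof -
  from iso obtain h where h: "bij_betw h (verts D) (verts T)" "edges T = (\<lambda>e. h ` e) ` edges D"
    and leaf: "\<forall>x\<in>X. h (leaf D x) = leaf T x"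
    unfolding ltree_iso_def by blast
  have leaf: "leaf T x = h (Inr x)" if "x \<in> X" for x
    using leaf that by (simp add: dual_tree_def)
  have inj: "inj_on h (verts D)"
    using h(1) by (simp add: bij_betw_def)
  have verts: "Inl v \<in> verts D" if "v \<in> comps C" for v
    using that by (simp add: dual_tree_def)
  have sub: "e \<subseteq> verts D" if "e \<in> edges D" for e
    using dual_edges[OF that] by blast
  have hv: "h (Inl v) \<in> verts T" if "v \<in> comps C" for v
    using bij_betwE[OF h(1)] verts[OF that] by blast
  have card: "card (edges_at T (h (Inl v))) = n_special X C v" if "v \<in> comps C" for v
  proof -
    have "edges_at T (h (Inl v)) = (\<lambda>e. h ` e) ` edges_at D (Inl v)"
      unfolding edges_at_def h(2) using inj_on_image_mem_iff[OF inj verts[OF that] sub] by auto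
    moreover have "inj_on (\<lambda>e. h ` e) (edges_at D (Inl v))"
      using inj_on_image_eq_iff[OF inj sub sub] by (intro inj_onI) (auto simp: edges_at_def)
    ultimately show ?thesis
      using card_edges_at_dual[OF that] by (simp add: card_image)
  qed
  have three: "n_special X C v = 3" if "v \<in> comps C" for v
  proof -
    have "card (edges_at T (h (Inl v))) \<in> {1, 3}"
      using T hv[OF that] by (simp add: trivalent_def)
    then show ?thesis
      using card[OF that] special_points(6)[OF that] by auto
  qed
  then show "trivalent_curve X C"
    using stable by (simp add: trivalent_curve_def)
  assume v: "v \<in> comps C"
  show "\<exists>t\<in>verts T. card (edges_at T t) = 3 \<and>
      (\<forall>x\<in>X. \<forall>y\<in>X. linked (edges T) t (leaf T x) (leaf T y) \<longrightarrow> proj_to C v x = proj_to C v y)"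
  proof (intro bexI[OF _ hv[OF v]] conjI ballI impI)
    show "card (edges_at T (h (Inl v))) = 3"
      using card[OF v] three[OF v] by simp
    fix x y assume xy: "x \<in> X" "y \<in> X" and l: "linked (edges T) (h (Inl v)) (leaf T x) (leaf T y)"
    have "Inr x \<in> verts D" "Inr y \<in> verts D"
      using xy by (auto simp: dual_tree_def)
    then have "linked (edges D) (Inl v) (Inr x) (Inr y)"
      using l linked_iso[OF dual_edges inj verts[OF v]] by (simp add: leaf xy h(2))
    then show "proj_to C v x = proj_to C v y"
      by (rule dual_linked_imp_proj_to_eq[OF v xy])
  qed
qed

end

section \<open>Smoothing a trivalent tree of branches\<close>

text \<open>
  \<open>proj v x\<close> is the direction in which \<open>x\<close> is seen from the vertex \<open>v\<close>; the axiom \<open>opposite\<close> says that everything not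
  seen from \<open>v\<close> in the direction of \<open>w\<close> is seen from \<open>w\<close> in the direction of \<open>v\<close>.
\<close>
locale branch_system =
  fixes V :: "'v set" and X :: "'l set" and proj :: "'v \<Rightarrow> 'l \<Rightarrow> 'b" and r :: 'l
  assumes finite_V: "finite V" and finite_X: "finite X" and r: "r \<in> X"
    and three: "v \<in> V \<Longrightarrow> card (proj v ` X) = 3"
    and median: "x \<in> X \<Longrightarrow> y \<in> X \<Longrightarrow> z \<in> X \<Longrightarrow> distinct [x, y, z] \<Longrightarrow>
      \<exists>v\<in>V. distinct [proj v x, proj v y, proj v z]"
    and opposite: "v \<in> V \<Longrightarrow> w \<in> V \<Longrightarrow> v \<noteq> w \<Longrightarrow> \<exists>p q. \<forall>x\<in>X. proj v x = p \<or> proj w x = q"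
begin

definition clade where "clade v = {x \<in> X. proj v x \<noteq> proj v r}"

lemma oppositeE:
  assumes "v \<in> V" "w \<in> V" "v \<noteq> w"
  obtains p q where "\<And>x. x \<in> X \<Longrightarrow> proj v x = p \<or> proj w x = q"
  using opposite[OF assms] by blast

lemma two_of_three:
  assumes "v \<in> V" "x \<in> X" "y \<in> X" "z \<in> X" "t \<in> X" "distinct [proj v x, proj v y, proj v z]"
  shows "proj v t \<in> {proj v x, proj v y, proj v z}"
proof -
  have "{proj v x, proj v y, proj v z} = proj v ` X"
    using assms three[OF assms(1)] finite_X by (intro card_subset_eq) auto
  then show ?thesis
    using assms(5) by blast
qed

lemma third:
  assumes "v \<in> V"
  obtains x where "x \<in> X" "proj v x \<noteq> p" "proj v x \<noteq> q"
proof -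
  have "\<not> proj v ` X \<subseteq> {p, q}"
  proof
    assume "proj v ` X \<subseteq> {p, q}"
    then have "card (proj v ` X) \<le> card {p, q}"
      by (intro card_mono) auto
    also have "\<dots> \<le> 2"
      by (simp add: card_insert_if)
    finally show False
      using three[OF assms] by simp
  qed
  then show thesis
    using that by blast
qed

text \<open>
  The clade of the vertex where \<open>r\<close>, \<open>x\<close>, \<open>y\<close> meet is seen in a single direction from any other vertex \<open>w\<close> whose clade contains
  \<open>x\<close> and \<open>y\<close>, and this direction is not that of \<open>r\<close>.
\<close>
lemma clade_smallest:
  assumes v: "v \<in> V" "distinct [proj v r, proj v x, proj v y]" and w: "w \<in> V" "x \<in> clade w" "y \<in> clade w"
  shows "clade v \<subseteq> clade w" and "proj w x = proj w y \<Longrightarrow> clade v \<subset> clade w"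
proof -
  have *: "clade v \<subseteq> clade w \<and> (proj w x = proj w y \<longrightarrow> clade v \<subset> clade w)" if vw: "v \<noteq> w"
  proof -
    obtain p q where pq: "\<And>x. x \<in> X \<Longrightarrow> proj v x = p \<or> proj w x = q"
      using oppositeE[OF v(1) w(1) vw] by metis
    have X: "x \<in> X" "y \<in> X"
      using w by (auto simp: clade_def)
    have q: "proj w r \<noteq> q"
      using pq[OF X(1)] pq[OF X(2)] v(2) w(2,3) by (auto simp: clade_def)
    then have "proj v r = p"
      using pq[OF r] by simp
    then have sub: "proj w z = q" if "z \<in> clade v" for z
      using pq[of z] that by (auto simp: clade_def)
    obtain z where "z \<in> X" "proj w z \<noteq> proj w r" "proj w z \<noteq> q"
      by (rule third[OF w(1)])
    then have "z \<in> clade w" "z \<notin> clade v"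
      using sub by (auto simp: clade_def)
    moreover have "clade v \<subseteq> clade w"
      using sub q by (auto simp: clade_def)
    ultimately show ?thesis
      by blast
  qed
  show "clade v \<subseteq> clade w"
    using * by (cases "v = w") auto
  show "proj w x = proj w y \<Longrightarrow> clade v \<subset> clade w"
    using * v(2) by (cases "v = w") auto
qed

lemma clade_separating:
  assumes v: "v \<in> V" "distinct [proj v r, proj v x, proj v y]" and w: "w \<in> V" "w \<noteq> v" "proj w x \<noteq> proj w y"
    and X: "x \<in> X" "y \<in> X"
  shows "clade w \<subset> clade v"
proof -
  obtain p q where pq: "\<And>x. x \<in> X \<Longrightarrow> proj v x = p \<or> proj w x = q"
    using oppositeE[OF v(1) w(1)] w(2) by metis
  have p: "proj v x = p \<or> proj v y = p"
    using pq[OF X(1)] pq[OF X(2)] w(3) by auto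
  then have "proj w r = q"
    using pq[OF r] v(2) by auto
  then have sub: "proj v z = p" if "z \<in> clade w" for z
    using pq[of z] that by (auto simp: clade_def)
  have "proj v r \<noteq> p"
    using p v(2) by auto
  then have "clade w \<subseteq> clade v"
    using sub by (auto simp: clade_def)
  moreover have "x \<in> clade v" "y \<in> clade v"
    using v(2) X by (auto simp: clade_def)
  moreover have "x \<notin> clade w \<or> y \<notin> clade w"
    using sub[of x] sub[of y] v(2) by auto
  ultimately show ?thesis
    by blast
qed

lemma clade_nested:
  assumes "v \<in> V" "w \<in> V" "t \<in> clade v" "t \<in> clade w" "x \<in> clade w" "x \<notin> clade v"
  shows "clade v \<subset> clade w"
proof -
  have "v \<noteq> w"
    using assms by auto
  then obtain p q where pq: "\<And>x. x \<in> X \<Longrightarrow> proj v x = p \<or> proj w x = q"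
    using oppositeE[OF assms(1,2)] by metis
  have X: "t \<in> X" "x \<in> X" "proj v x = proj v r" "proj v t \<noteq> proj v r" "proj w t \<noteq> proj w r" "proj w x \<noteq> proj w r"
    using assms by (auto simp: clade_def)
  have q: "proj w r \<noteq> q"
    using pq[OF X(1)] pq[OF X(2)] X(3-6) by auto
  then have "proj v r = p"
    using pq[OF r] by simp
  then have "proj w z = q" if "z \<in> clade v" for z
    using pq[of z] that by (auto simp: clade_def)
  then have "clade v \<subseteq> clade w"
    using q by (auto simp: clade_def)
  then show ?thesis
    using assms(5,6) by blast
qed

definition meet where "meet x y = (SOME v. v \<in> V \<and> distinct [proj v r, proj v x, proj v y])"

lemma meet:
  assumes "x \<in> X" "y \<in> X" "distinct [r, x, y]"
  shows "meet x y \<in> V" "distinct [proj (meet x y) r, proj (meet x y) x, proj (meet x y) y]"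
proof -
  have "\<exists>v. v \<in> V \<and> distinct [proj v r, proj v x, proj v y]"
    using median[OF r assms] by blast
  then have "meet x y \<in> V \<and> distinct [proj (meet x y) r, proj (meet x y) x, proj (meet x y) y]"
    unfolding meet_def by (rule someI_ex)
  then show "meet x y \<in> V" "distinct [proj (meet x y) r, proj (meet x y) x, proj (meet x y) y]"
    by auto
qed

lemma in_clade_meet:
  assumes "x \<in> X" "y \<in> X" "distinct [r, x, y]"
  shows "x \<in> clade (meet x y)" "y \<in> clade (meet x y)"
  using meet(2)[OF assms] assms by (auto simp: clade_def)

text \<open>
  Any function that decreases when the clade grows serves as an exponent; this one is defined without reference to paths.
\<close>
definition depth where "depth v = card X - card (clade v)"

lemma depth_mono: "clade v \<subseteq> clade w \<Longrightarrow> depth w \<le> depth v"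
  unfolding depth_def using finite_X
  by (intro diff_le_mono2 card_mono) (auto simp: clade_def)

lemma depth_less: "clade v \<subset> clade w \<Longrightarrow> depth w < depth v"
proof -
  assume *: "clade v \<subset> clade w"
  have "clade w \<subseteq> X"
    by (auto simp: clade_def)
  then have "card (clade v) < card (clade w)" "card (clade w) \<le> card X"
    using finite_X * by (auto intro: psubset_card_mono card_mono finite_subset)
  then show ?thesis
    by (simp add: depth_def)
qed

text \<open>
  The order of vanishing, in powers of \<open>\<epsilon>\<close>, of the difference of the positions of \<open>x\<close> and \<open>y\<close>; the position of \<open>r\<close> is
  infinity.
\<close>
definition contact where "contact x y = (if x = r \<or> y = r then 0 else depth (meet x y))"

lemma meet_commute: "meet x y = meet y x"
  unfolding meet_def by (rule arg_cong[of _ _ Eps]) auto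

lemma contact_commute: "contact x y = contact y x"
  by (auto simp: contact_def meet_commute)

text \<open>
  A four-point condition.  If \<open>r\<close> is seen from \<open>v\<close> in the direction of \<open>y\<close>, then \<open>x\<close> and \<open>t\<close> meet at \<open>v\<close>, \<open>x\<close> and \<open>s\<close> meet deeper,
  and \<open>y\<close> meets \<open>s\<close> and \<open>t\<close> at the same vertex; the case of \<open>t\<close> is symmetric.  If \<open>r\<close> is in the direction of \<open>x\<close> and \<open>s\<close>, then \<open>y\<close>
  and \<open>t\<close> meet at \<open>v\<close>, deeper than both mixed pairs, and \<open>x\<close> and \<open>s\<close> meet at least as deep as one of the mixed pairs.
\<close>
lemma four_points:
  assumes v: "v \<in> V" "proj v x = proj v s" "distinct [proj v x, proj v y, proj v t]"
    and X: "x \<in> X" "s \<in> X" "y \<in> X" "t \<in> X" "x \<noteq> s"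
  shows "contact x t + contact y s < contact x s + contact y t"
proof -
  have dist: "x \<noteq> y" "x \<noteq> t" "s \<noteq> y" "s \<noteq> t" "y \<noteq> t"
    using v by auto
  have away: "clade v \<subset> clade (meet z u)" "depth (meet z u) < depth v"
    if "z \<in> X" "z \<noteq> r" "proj v z = proj v r" "u \<in> clade v" for z u
  proof -
    have "u \<in> X" "distinct [r, z, u]"
      using that by (auto simp: clade_def)
    note m = meet(1)[OF that(1) this] in_clade_meet[OF that(1) this]
    have "z \<notin> clade v"
      using that by (simp add: clade_def)
    then show "clade v \<subset> clade (meet z u)"
      using clade_nested[OF v(1) m(1) that(4) m(3,2)] by blast
    then show "depth (meet z u) < depth v"
      by (rule depth_less)
  qed
  have away': "depth (meet z u) \<le> depth (meet z u')"
    if "z \<in> X" "z \<noteq> r" "proj v z = proj v r" "u \<in> clade v" "u' \<in> clade v" for z u u'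
  proof -
    have u: "u \<in> X" "distinct [r, z, u]" "u' \<in> X" "distinct [r, z, u']"
      using that by (auto simp: clade_def)
    note m = meet[OF that(1) u(1,2)] in_clade_meet[OF that(1) u(1,2)]
    note m' = meet[OF that(1) u(3,4)]
    have "z \<notin> clade v"
      using that by (simp add: clade_def)
    then have "u' \<in> clade (meet z u)"
      using clade_nested[OF v(1) m(1) that(4) m(4,3)] that(5) by blast
    then show ?thesis
      using clade_smallest(1)[OF m' m(1,3)] depth_mono by blast
  qed
  have here: "depth (meet z u) = depth v" if "z \<in> X" "u \<in> X" "distinct [proj v r, proj v z, proj v u]" for z u
  proof -
    have d: "distinct [r, z, u]" and c: "z \<in> clade v" "u \<in> clade v"
      using that by (auto simp: clade_def)
    note m = meet[OF that(1,2) d] in_clade_meet[OF that(1,2) d]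
    have "clade v = clade (meet z u)"
      using clade_smallest(1)[OF v(1) that(3) m(1,3,4)] clade_smallest(1)[OF m(1,2) v(1) c] by blast
    then show ?thesis
      by (simp add: depth_def)
  qed
  have beyond: "depth v < depth (meet x s)" if "proj v x \<noteq> proj v r"
  proof -
    have d: "distinct [r, x, s]" and c: "x \<in> clade v" "s \<in> clade v"
      using that v X by (auto simp: clade_def)
    show ?thesis
      using clade_smallest(2)[OF meet[OF X(1,2) d] v(1) c v(2)] depth_less by blast
  qed
  have side: "contact x t + contact y s < contact x s + contact y t"
    if v: "distinct [proj v r, proj v x, proj v t]" "proj v y = proj v r" "proj v x = proj v s"
      and X: "x \<in> X" "s \<in> X" "y \<in> X" "t \<in> X" and xs: "depth v < depth (meet x s)" for x s y t
  proof -
    have "contact x t = depth v" "contact x s = depth (meet x s)"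
      using here[OF X(1,4) v(1)] v by (auto simp: contact_def)
    moreover have "s \<in> clade v" "t \<in> clade v"
      using v X by (auto simp: clade_def)
    then have "contact y s \<le> contact y t"
      using away'[OF X(3) _ v(2)] v by (auto simp: contact_def)
    ultimately show ?thesis
      using xs by simp
  qed
  consider "proj v r = proj v x" | "proj v r = proj v y" | "proj v r = proj v t"
    using two_of_three[OF v(1) X(1,3,4) r v(3)] by auto
  then show ?thesis
  proof cases
    case 1
    have yt: "contact y t = depth v" and c: "y \<in> clade v" "t \<in> clade v" and "y \<noteq> r" "t \<noteq> r"
      using here[OF X(3,4)] 1 v X by (auto simp: contact_def clade_def)
    have x: "depth (meet x t) < depth v" "contact x t = depth (meet x t)" "clade v \<subset> clade (meet x t)" if "x \<noteq> r"
      using away[OF X(1) that 1[symmetric] c(2)] that \<open>t \<noteq> r\<close> by (auto simp: contact_def)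
    have s: "depth (meet s y) < depth v" "contact y s = depth (meet s y)" "clade v \<subset> clade (meet s y)" if "s \<noteq> r"
      using away[OF X(2) that _ c(1)] that 1 v(2) \<open>y \<noteq> r\<close> by (auto simp: contact_def meet_commute)
    show ?thesis
    proof (cases "x = r \<or> s = r")
      case True
      then show ?thesis
        using x(1,2) s(1,2) X(5) yt by (cases "x = r") (auto simp: contact_def)
    next
      case False
      then have d: "distinct [r, x, t]" "distinct [r, s, y]" "distinct [r, x, s]"
        using dist X(5) \<open>y \<noteq> r\<close> \<open>t \<noteq> r\<close> by auto
      note m = meet(1)[OF X(1,4) d(1)] in_clade_meet[OF X(1,4) d(1)]
      note m' = meet(1)[OF X(2,3) d(2)] in_clade_meet[OF X(2,3) d(2)]
      have "s \<in> clade (meet x t) \<or> x \<in> clade (meet s y)"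
        using clade_nested[OF m'(1) m(1) _ m(3,2)] s(3) c(2) m'(2) False by blast
      then have "depth (meet x t) \<le> depth (meet x s) \<or> depth (meet s y) \<le> depth (meet x s)"
        using clade_smallest(1)[OF meet[OF X(1,2) d(3)] m(1,2)]
          clade_smallest(1)[OF meet[OF X(1,2) d(3)] m'(1) _ m'(2)] depth_mono by blast
      moreover have "contact x s = depth (meet x s)"
        using False by (simp add: contact_def)
      ultimately show ?thesis
        using x(1,2) s(1,2) False yt by auto
    qed
  next
    case 2
    then show ?thesis
      using v X beyond by (intro side) auto
  next
    case 3
    then have "contact s y + contact t x < contact s x + contact t y"
      using v X beyond by (intro side) (auto simp: meet_commute)
    then show ?thesis
      by (simp add: contact_commute)
  qed
qed

text \<open>
  The marked points of a smooth curve that degenerates as \<open>\<epsilon>\<close> tends to 0: the clade of \<open>v\<close> becomes a cluster with diameter of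
  order \<open>\<epsilon> ^ depth v\<close>, and the two branches of \<open>v\<close> away from \<open>r\<close> sit at the two ends of that cluster.
\<close>
definition side where "side v x = (if proj v x = (SOME p. p \<in> proj v ` X \<and> p \<noteq> proj v r) then 1 else 0 :: complex)"

definition position where "position \<epsilon> x = (\<Sum>v\<in>V. \<epsilon> ^ depth v * (if x \<in> clade v then side v x else 0))"

lemma side_meet:
  assumes "x \<in> X" "y \<in> X" "distinct [r, x, y]"
  shows "side (meet x y) x - side (meet x y) y \<noteq> 0"
proof -
  define v where "v = meet x y"
  note m = meet[OF assms, folded v_def]
  define p where "p = (SOME p. p \<in> proj v ` X \<and> p \<noteq> proj v r)"
  have "\<exists>p. p \<in> proj v ` X \<and> p \<noteq> proj v r"
    using m(2) assms(1) by (intro exI[of _ "proj v x"]) auto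
  then have "p \<in> proj v ` X \<and> p \<noteq> proj v r"
    unfolding p_def by (rule someI_ex)
  then have "p = proj v x \<or> p = proj v y"
    using two_of_three[OF m(1) r assms(1,2) _ m(2)] by auto
  then show ?thesis
    using m(2) unfolding v_def[symmetric] side_def p_def[symmetric] by auto
qed

text \<open>The homogeneous form of the difference of two positions.\<close>
definition bracket where
  "bracket \<epsilon> x y = (if x = r then if y = r then 0 else 1 else if y = r then -1 else position \<epsilon> x - position \<epsilon> y)"

text \<open>
  The leading term comes from the vertex where \<open>r\<close>, \<open>x\<close>, \<open>y\<close> meet: the other vertices that separate \<open>x\<close> from \<open>y\<close> have smaller
  clades by \<open>clade_separating\<close>, hence larger exponents.
\<close>
lemma bracket_limit:
  assumes "x \<in> X" "y \<in> X" "x \<noteq> y" and \<epsilon>: "\<epsilon> \<longlonglongrightarrow> 0" "\<And>m. \<epsilon> m \<noteq> 0"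
  shows "\<exists>c. c \<noteq> 0 \<and> (\<lambda>m. bracket (\<epsilon> m) x y / \<epsilon> m ^ contact x y) \<longlonglongrightarrow> c"
proof (cases "x = r \<or> y = r")
  case True
  then show ?thesis
    using assms(3) by (intro exI[of _ "if x = r then 1 else -1"]) (auto simp: bracket_def contact_def)
next
  case False
  then have d: "distinct [r, x, y]"
    using assms(3) by auto
  define u where "u = meet x y"
  note m = meet[OF assms(1,2) d, folded u_def] in_clade_meet[OF assms(1,2) d, folded u_def]
  \<comment> \<open>\<open>g v\<close> is the coefficient of \<open>v\<close> in the difference of the positions, and \<open>h v\<close> is the limit of its term.\<close>
  define g where "g v = (if x \<in> clade v then side v x else 0) - (if y \<in> clade v then side v y else 0)" for v
  define h where "h v = (if v = u then side u x - side u y else 0)" for v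
  have "(\<lambda>m. \<epsilon> m ^ depth v * g v / \<epsilon> m ^ depth u) \<longlonglongrightarrow> h v" if "v \<in> V" for v
  proof (cases "v = u \<or> proj v x = proj v y")
    case True
    moreover have "g v = 0" if "proj v x = proj v y"
      using that assms(1,2) by (auto simp: g_def side_def clade_def)
    ultimately show ?thesis
      using \<epsilon>(2) m by (cases "v = u") (auto simp: h_def g_def)
  next
    case False
    then have "depth u < depth v"
      using clade_separating[OF m(1,2) \<open>v \<in> V\<close> _ _ assms(1,2)] depth_less by blast
    then obtain k where k: "depth v = depth u + Suc k"
      by (metis less_iff_Suc_add add_Suc_right)
    have "(\<lambda>m. \<epsilon> m ^ Suc k * g v) \<longlonglongrightarrow> 0 ^ Suc k * g v"
      by (intro tendsto_intros \<epsilon>)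
    moreover have "\<epsilon> m ^ depth v * g v / \<epsilon> m ^ depth u = \<epsilon> m ^ Suc k * g v" for m
      using \<epsilon>(2)[of m] by (simp add: k power_add)
    ultimately show ?thesis
      using False by (simp add: h_def)
  qed
  then have "(\<lambda>m. \<Sum>v\<in>V. \<epsilon> m ^ depth v * g v / \<epsilon> m ^ depth u) \<longlonglongrightarrow> (\<Sum>v\<in>V. h v)"
    by (intro tendsto_sum)
  moreover have "(\<Sum>v\<in>V. h v) = side u x - side u y"
    using finite_V m(1) by (simp add: h_def)
  moreover have "bracket (\<epsilon> m) x y / \<epsilon> m ^ contact x y = (\<Sum>v\<in>V. \<epsilon> m ^ depth v * g v / \<epsilon> m ^ depth u)" for m
    using False by (simp add: bracket_def contact_def position_def g_def u_def sum_subtractf[symmetric]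
      sum_divide_distrib right_diff_distrib)
  ultimately show ?thesis
    using side_meet[OF assms(1,2) d] unfolding u_def by (intro exI conjI) simp_all
qed

lemma bracket_nonzero:
  assumes "x \<in> X" "y \<in> X" "x \<noteq> y" and \<epsilon>: "\<epsilon> \<longlonglongrightarrow> 0" "\<And>m. \<epsilon> m \<noteq> 0"
  shows "eventually (\<lambda>m. bracket (\<epsilon> m) x y \<noteq> 0) sequentially"
proof -
  obtain c where "c \<noteq> 0" "(\<lambda>m. bracket (\<epsilon> m) x y / \<epsilon> m ^ contact x y) \<longlonglongrightarrow> c"
    using bracket_limit[OF assms] by blast
  then have "eventually (\<lambda>m. bracket (\<epsilon> m) x y / \<epsilon> m ^ contact x y \<noteq> 0) sequentially"
    by (intro tendsto_imp_eventually_ne)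
  then show ?thesis
    by eventually_elim auto
qed

text \<open>By \<open>four_points\<close> the cross-ratio is a convergent factor times a positive power of \<open>\<epsilon>\<close>.\<close>
lemma bracket_ratio_limit:
  assumes v: "v \<in> V" "proj v x = proj v s" "distinct [proj v x, proj v y, proj v t]"
    and X: "x \<in> X" "s \<in> X" "y \<in> X" "t \<in> X" "x \<noteq> s" and \<epsilon>: "\<epsilon> \<longlonglongrightarrow> 0" "\<And>m. \<epsilon> m \<noteq> 0"
  shows "(\<lambda>m. bracket (\<epsilon> m) x s * bracket (\<epsilon> m) y t / (bracket (\<epsilon> m) x t * bracket (\<epsilon> m) y s)) \<longlonglongrightarrow> 0"
proof -
  define q where "q x y m = bracket (\<epsilon> m) x y / \<epsilon> m ^ contact x y" for x y m
  have q: "\<exists>c. c \<noteq> 0 \<and> q x y \<longlonglongrightarrow> c" if "x \<in> X" "y \<in> X" "x \<noteq> y" for x y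
    unfolding q_def by (rule bracket_limit[OF that \<epsilon>])
  have "x \<noteq> t" "y \<noteq> s" "y \<noteq> t"
    using v by auto
  then obtain c1 c2 c3 c4 where c: "c1 \<noteq> 0" "q x s \<longlonglongrightarrow> c1" "c2 \<noteq> 0" "q y t \<longlonglongrightarrow> c2" "c3 \<noteq> 0" "q x t \<longlonglongrightarrow> c3"
    "c4 \<noteq> 0" "q y s \<longlonglongrightarrow> c4"
    using q[of x s] q[of y t] q[of x t] q[of y s] X by blast
  obtain k where k: "contact x s + contact y t = contact x t + contact y s + Suc k"
    using four_points[OF v X] by (metis less_iff_Suc_add add_Suc_right)
  have "(\<lambda>m. q x s m * q y t m / (q x t m * q y s m) * \<epsilon> m ^ Suc k) \<longlonglongrightarrow> c1 * c2 / (c3 * c4) * 0 ^ Suc k"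
    by (intro tendsto_intros c \<epsilon>) (use c in auto)
  moreover have "q x s m * q y t m / (q x t m * q y s m) * \<epsilon> m ^ Suc k =
    bracket (\<epsilon> m) x s * bracket (\<epsilon> m) y t / (bracket (\<epsilon> m) x t * bracket (\<epsilon> m) y s)" for m
  proof -
    define B where "B = bracket (\<epsilon> m) x s * bracket (\<epsilon> m) y t / (bracket (\<epsilon> m) x t * bracket (\<epsilon> m) y s)"
    have "q x s m * q y t m / (q x t m * q y s m) * \<epsilon> m ^ Suc k =
      B * (\<epsilon> m ^ (contact x t + contact y s + Suc k) / \<epsilon> m ^ (contact x s + contact y t))"
      by (simp add: q_def B_def power_add mult_ac)
    also have "\<dots> = B"
      using \<epsilon>(2)[of m] by (simp add: k)
    finally show ?thesis
      by (simp add: B_def)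
  qed
  ultimately show ?thesis
    by simp
qed

end

section \<open>The topology of projective spaces\<close>

lemma openin_proj_topology:
  "openin (proj_topology I) U \<longleftrightarrow> U \<subseteq> proj_space I \<and>
     openin (top_of_set (vecs I)) {v \<in> vecs I. proj_pt v \<in> U}"
proof -
  have "istopology (\<lambda>U. U \<subseteq> proj_space I \<and> openin (top_of_set (vecs I)) {v \<in> vecs I. proj_pt v \<in> U})"
    unfolding istopology_def
  proof (intro conjI allI impI)
    fix S T
    assume "S \<subseteq> proj_space I \<and> openin (top_of_set (vecs I)) {v \<in> vecs I. proj_pt v \<in> S}"
      "T \<subseteq> proj_space I \<and> openin (top_of_set (vecs I)) {v \<in> vecs I. proj_pt v \<in> T}"
    moreover have "{v \<in> vecs I. proj_pt v \<in> S \<inter> T} = {v \<in> vecs I. proj_pt v \<in> S} \<inter> {v \<in> vecs I. proj_pt v \<in> T}"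
      by blast
    ultimately show "S \<inter> T \<subseteq> proj_space I" "openin (top_of_set (vecs I)) {v \<in> vecs I. proj_pt v \<in> S \<inter> T}"
      by (auto intro: openin_Int)
  next
    fix K assume K: "\<forall>U\<in>K. U \<subseteq> proj_space I \<and> openin (top_of_set (vecs I)) {v \<in> vecs I. proj_pt v \<in> U}"
    then show "\<Union> K \<subseteq> proj_space I"
      by blast
    have "{v \<in> vecs I. proj_pt v \<in> \<Union> K} = (\<Union>U\<in>K. {v \<in> vecs I. proj_pt v \<in> U})"
      by blast
    then show "openin (top_of_set (vecs I)) {v \<in> vecs I. proj_pt v \<in> \<Union> K}"
      using K by (auto intro: openin_Union)
  qed
  then show ?thesis
    unfolding proj_topology_def by (rule topology_inverse'[THEN fun_cong])
qed

lemma topspace_proj_topology [simp]: "topspace (proj_topology I) = proj_space I"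
proof (rule subset_antisym)
  show "topspace (proj_topology I) \<subseteq> proj_space I"
    using openin_topspace[of "proj_topology I"] unfolding openin_proj_topology by blast
  have "{v \<in> vecs I. proj_pt v \<in> proj_space I} = vecs I"
    by (auto simp: proj_space_def)
  then have "openin (proj_topology I) (proj_space I)"
    unfolding openin_proj_topology by simp
  then show "proj_space I \<subseteq> topspace (proj_topology I)"
    by (rule openin_subset)
qed

lemma limitin_proj_pt:
  assumes "w \<longlonglongrightarrow> z" "z \<in> vecs I" "eventually (\<lambda>m. w m \<in> vecs I) sequentially"
  shows "limitin (proj_topology I) (\<lambda>m. proj_pt (w m)) (proj_pt z) sequentially"
  unfolding limitin_def
proof (intro conjI allI impI)
  show "proj_pt z \<in> topspace (proj_topology I)"
    using assms(2) by (simp add: proj_space_def)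
  fix U assume U: "openin (proj_topology I) U \<and> proj_pt z \<in> U"
  then obtain O' where O': "open O'" "{v \<in> vecs I. proj_pt v \<in> U} = vecs I \<inter> O'"
    unfolding openin_proj_topology openin_open by blast
  then have "z \<in> O'"
    using U assms(2) by blast
  then have "eventually (\<lambda>m. w m \<in> O') sequentially"
    using assms(1) O'(1) topological_tendstoD by blast
  then show "eventually (\<lambda>m. proj_pt (w m) \<in> U) sequentially"
    using assms(3) by eventually_elim (use O'(2) in blast)
qed

lemma tendsto_vec2:
  assumes "s \<longlonglongrightarrow> s0" "t \<longlonglongrightarrow> t0"
  shows "(\<lambda>m. vec2 (s m) (t m)) \<longlonglongrightarrow> vec2 s0 t0"
proof -
  have "continuous_on UNIV (\<lambda>p i. vec2 (fst p) (snd p) i)"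
  proof (rule continuous_on_coordinatewise_then_product)
    fix i :: int
    show "continuous_on UNIV (\<lambda>p. vec2 (fst p) (snd p) i)"
      by (cases "i = 0"; cases "i = 1") (simp_all add: vec2_def continuous_on_fst continuous_on_snd)
  qed
  then have "isCont (\<lambda>p. vec2 (fst p) (snd p)) (s0, t0)"
    by (simp add: continuous_on_eq_continuous_at)
  from isCont_tendsto_compose[OF this tendsto_Pair[OF assms]] show ?thesis
    by simp
qed

lemma vec2_in_vecs: "vec2 s t \<in> vecs {0, 1} \<longleftrightarrow> s \<noteq> 0 \<or> t \<noteq> 0"
proof
  assume "vec2 s t \<in> vecs {0, 1}"
  then obtain i where "vec2 s t i \<noteq> 0"
    by (auto simp: vecs_def)
  then show "s \<noteq> 0 \<or> t \<noteq> 0"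
    by (auto simp: vec2_def split: if_splits)
next
  assume "s \<noteq> 0 \<or> t \<noteq> 0"
  then show "vec2 s t \<in> vecs {0, 1}"
    by (auto simp: vecs_def vec2_def intro: exI[of _ "0::int"] exI[of _ "1::int"])
qed

lemma proj_pt_self: "v \<in> proj_pt v"
  by (auto simp: proj_pt_def intro!: exI[of _ 1])

lemma proj_pt_eqD: "proj_pt v = proj_pt w \<Longrightarrow> \<exists>t. t \<noteq> 0 \<and> v = (\<lambda>i. t * w i)"
  using proj_pt_self[of v] by (auto simp: proj_pt_def)

lemma proj_pt_scale:
  assumes "c \<noteq> 0"
  shows "proj_pt (\<lambda>i. c * v i) = proj_pt v"
proof (intro subset_antisym subsetI)
  fix w assume "w \<in> proj_pt v"
  then obtain t where "t \<noteq> 0" "w = (\<lambda>i. t * v i)"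
    by (auto simp: proj_pt_def)
  then show "w \<in> proj_pt (\<lambda>i. c * v i)"
    using assms by (auto simp: proj_pt_def intro!: exI[of _ "t / c"])
next
  fix w assume "w \<in> proj_pt (\<lambda>i. c * v i)"
  then obtain t where "t \<noteq> 0" "w = (\<lambda>i. t * (c * v i))"
    by (auto simp: proj_pt_def)
  then show "w \<in> proj_pt v"
    using assms by (auto simp: proj_pt_def intro!: exI[of _ "t * c"])
qed

lemma proj_pt_vec2_scale: "c \<noteq> 0 \<Longrightarrow> proj_pt (vec2 (c * s) (c * t)) = proj_pt (vec2 s t)"
proof -
  assume "c \<noteq> 0"
  moreover have "(\<lambda>i. c * vec2 s t i) = vec2 (c * s) (c * t)"
    by (auto simp: vec2_def fun_eq_iff)
  ultimately show ?thesis
    using proj_pt_scale[of c "vec2 s t"] by simp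
qed

definition det2 :: "vec \<Rightarrow> vec \<Rightarrow> complex" where
  "det2 v w = v 0 * w 1 - v 1 * w 0"

lemma cross_ratio_proj_pt:
  "cross_ratio (proj_pt p) (proj_pt q) (proj_pt s) (proj_pt t) =
    proj_pt (vec2 (det2 p s * det2 q t) (det2 p t * det2 q s))"
proof -
  have rep: "\<exists>c. c \<noteq> 0 \<and> (SOME v. v \<in> proj_pt w) = (\<lambda>i. c * w i)" for w
  proof -
    have "(SOME v. v \<in> proj_pt w) \<in> proj_pt w"
      by (rule someI[of "\<lambda>v. v \<in> proj_pt w", OF proj_pt_self])
    then show ?thesis
      by (auto simp: proj_pt_def)
  qed
  obtain c where c: "\<And>w. c w \<noteq> 0" "\<And>w. (SOME v. v \<in> proj_pt w) = (\<lambda>i. c w * w i)"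
    using rep by metis
  let ?k = "c p * c q * c s * c t"
  have "cross_ratio (proj_pt p) (proj_pt q) (proj_pt s) (proj_pt t) =
      proj_pt (vec2 (?k * (det2 p s * det2 q t)) (?k * (det2 p t * det2 q s)))"
    unfolding cross_ratio_def Let_def c(2) det2_def by (simp add: algebra_simps)
  then show ?thesis
    using proj_pt_vec2_scale[of ?k] c(1) by simp
qed

lemma det2_eq_0:
  assumes "v \<in> vecs {0, 1}" "w \<in> vecs {0, 1}" "det2 v w = 0"
  shows "proj_pt v = proj_pt w"
proof -
  have v: "v = vec2 (v 0) (v 1)" "w = vec2 (w 0) (w 1)"
    using assms(1,2) by (auto simp: vecs_def vec2_def fun_eq_iff)
  have nz: "v 0 \<noteq> 0 \<or> v 1 \<noteq> 0" "w 0 \<noteq> 0 \<or> w 1 \<noteq> 0"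
    using assms(1,2) v by (metis vec2_in_vecs)+
  have d: "v 0 * w 1 = v 1 * w 0"
    using assms(3) by (simp add: det2_def)
  show ?thesis
  proof (cases "w 0 = 0")
    case True
    then have "w 1 \<noteq> 0" "v 0 = 0" "v 1 \<noteq> 0"
      using d nz by auto
    then have "vec2 (v 0) (v 1) = vec2 (v 1 / w 1 * w 0) (v 1 / w 1 * w 1)"
      using True by simp
    then show ?thesis
      using proj_pt_vec2_scale[of "v 1 / w 1" "w 0" "w 1"] \<open>w 1 \<noteq> 0\<close> \<open>v 1 \<noteq> 0\<close> v by simp
  next
    case False
    then have "v 0 \<noteq> 0"
      using d nz by auto
    have "v 1 = v 0 / w 0 * w 1"
      using d False by (simp add: field_simps)
    then have "vec2 (v 0) (v 1) = vec2 (v 0 / w 0 * w 0) (v 0 / w 0 * w 1)"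
      using False by simp
    then show ?thesis
      using proj_pt_vec2_scale[of "v 0 / w 0" "w 0" "w 1"] False \<open>v 0 \<noteq> 0\<close> v by simp
  qed
qed

lemma cross_ratio_degenerate:
  assumes P1: "p \<in> P1" "q \<in> P1" "s \<in> P1" "t \<in> P1"
  shows "p = s \<Longrightarrow> distinct [p, q, t] \<Longrightarrow> cross_ratio p q s t = proj_pt (vec2 0 1)"
    and "q = t \<Longrightarrow> distinct [p, q, s] \<Longrightarrow> cross_ratio p q s t = proj_pt (vec2 0 1)"
    and "p = t \<Longrightarrow> distinct [p, q, s] \<Longrightarrow> cross_ratio p q s t = proj_pt (vec2 1 0)"
    and "q = s \<Longrightarrow> distinct [p, q, t] \<Longrightarrow> cross_ratio p q s t = proj_pt (vec2 1 0)"
    and "p = q \<Longrightarrow> distinct [p, s, t] \<Longrightarrow> cross_ratio p q s t = proj_pt (vec2 1 1)"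
    and "s = t \<Longrightarrow> distinct [p, q, s] \<Longrightarrow> cross_ratio p q s t = proj_pt (vec2 1 1)"
proof -
  define f where "f x = (SOME v. v \<in> vecs {0, 1} \<and> x = proj_pt v)" for x
  have f: "f x \<in> vecs {0, 1} \<and> x = proj_pt (f x)" if "x \<in> P1" for x
  proof -
    have "\<exists>v. v \<in> vecs {0, 1} \<and> x = proj_pt v"
      using that unfolding proj_space_def by blast
    then show ?thesis
      unfolding f_def by (rule someI_ex)
  qed
  let ?d = "\<lambda>x y. det2 (f x) (f y)"
  have d: "?d x y \<noteq> 0" if "x \<in> P1" "y \<in> P1" "x \<noteq> y" for x y
    using f[OF that(1)] f[OF that(2)] that(3) det2_eq_0 by metis
  have d0: "?d x x = 0" for x
    by (simp add: det2_def)
  have cr: "cross_ratio p q s t = proj_pt (vec2 (?d p s * ?d q t) (?d p t * ?d q s))"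
    using cross_ratio_proj_pt[of "f p" "f q" "f s" "f t"] f P1 by metis
  have 0: "proj_pt (vec2 0 c) = proj_pt (vec2 0 1)" and inf: "proj_pt (vec2 c 0) = proj_pt (vec2 1 0)"
    and 1: "proj_pt (vec2 c c) = proj_pt (vec2 1 1)" if "c \<noteq> 0" for c
    using proj_pt_vec2_scale[OF that, of 0 1] proj_pt_vec2_scale[OF that, of 1 0]
      proj_pt_vec2_scale[OF that, of 1 1] by simp_all
  show "cross_ratio p q s t = proj_pt (vec2 0 1)" if "p = s" "distinct [p, q, t]"
  proof -
    have "?d p t * ?d q s \<noteq> 0"
      using that P1 d by (metis distinct_length_2_or_more mult_eq_0_iff)
    moreover have "cross_ratio p q s t = proj_pt (vec2 0 (?d p t * ?d q s))"
      unfolding cr using that(1) by (simp add: d0)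
    ultimately show ?thesis
      using 0 by metis
  qed
  show "cross_ratio p q s t = proj_pt (vec2 0 1)" if "q = t" "distinct [p, q, s]"
  proof -
    have "?d p t * ?d q s \<noteq> 0"
      using that P1 d by (metis distinct_length_2_or_more mult_eq_0_iff)
    moreover have "cross_ratio p q s t = proj_pt (vec2 0 (?d p t * ?d q s))"
      unfolding cr using that(1) by (simp add: d0)
    ultimately show ?thesis
      using 0 by metis
  qed
  show "cross_ratio p q s t = proj_pt (vec2 1 0)" if "p = t" "distinct [p, q, s]"
  proof -
    have "?d p s * ?d q t \<noteq> 0"
      using that P1 d by (metis distinct_length_2_or_more mult_eq_0_iff)
    moreover have "cross_ratio p q s t = proj_pt (vec2 (?d p s * ?d q t) 0)"
      unfolding cr using that(1) by (simp add: d0)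
    ultimately show ?thesis
      using inf by metis
  qed
  show "cross_ratio p q s t = proj_pt (vec2 1 0)" if "q = s" "distinct [p, q, t]"
  proof -
    have "?d p s * ?d q t \<noteq> 0"
      using that P1 d by (metis distinct_length_2_or_more mult_eq_0_iff)
    moreover have "cross_ratio p q s t = proj_pt (vec2 (?d p s * ?d q t) 0)"
      unfolding cr using that(1) by (simp add: d0)
    ultimately show ?thesis
      using inf by metis
  qed
  show "cross_ratio p q s t = proj_pt (vec2 1 1)" if "p = q" "distinct [p, s, t]"
  proof -
    have "?d p s * ?d q t \<noteq> 0"
      using that P1 d by (metis distinct_length_2_or_more mult_eq_0_iff)
    moreover have "cross_ratio p q s t = proj_pt (vec2 (?d p s * ?d q t) (?d p s * ?d q t))"
      unfolding cr using that(1) by (simp add: mult.commute)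
    ultimately show ?thesis
      using 1 by metis
  qed
  show "cross_ratio p q s t = proj_pt (vec2 1 1)" if "s = t" "distinct [p, q, s]"
  proof -
    have "?d p s * ?d q t \<noteq> 0"
      using that P1 d by (metis distinct_length_2_or_more mult_eq_0_iff)
    moreover have "cross_ratio p q s t = proj_pt (vec2 (?d p s * ?d q t) (?d p s * ?d q t))"
      unfolding cr using that(1) by (simp add: d0)
    ultimately show ?thesis
      using 1 by metis
  qed
qed

section \<open>Smooth curves\<close>

definition smooth_curve :: "(label \<Rightarrow> vec) \<Rightarrow> curve" where
  "smooth_curve q = \<lparr>comps = {0}, nodes = {}, node_pt = (\<lambda>_ _. infinity_pt), mark_comp = (\<lambda>_. 0),
     mark_pt = (\<lambda>x. proj_pt (q x))\<rparr>"

lemma stable_smooth_curve: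
  assumes X: "finite X" "3 \<le> card X" and q: "\<And>x. x \<in> X \<Longrightarrow> q x \<in> vecs {0, 1}"
    and inj: "\<And>x y. x \<in> X \<Longrightarrow> y \<in> X \<Longrightarrow> x \<noteq> y \<Longrightarrow> det2 (q x) (q y) \<noteq> 0"
  shows "stable_curve X (smooth_curve q)"
proof -
  have "is_tree {0::nat} {}"
    unfolding is_tree_def is_cycle_def
    by (auto simp: intro!: exI[of _ 0])
  moreover have "proj_pt (q x) \<noteq> proj_pt (q y)" if "x \<in> X" "y \<in> X" "x \<noteq> y" for x y
  proof
    assume "proj_pt (q x) = proj_pt (q y)"
    then obtain t where "q x = (\<lambda>i. t * q y i)"
      using proj_pt_eqD by blast
    then have "det2 (q x) (q y) = 0"
      by (simp add: det2_def)
    then show False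
      using inj[OF that] by simp
  qed
  then have "inj_on (\<lambda>x. proj_pt (q x)) X"
    by (auto simp: inj_on_def)
  moreover have "proj_pt (q x) \<in> P1" if "x \<in> X" for x
    using q[OF that] by (simp add: proj_space_def)
  ultimately show ?thesis
    using X by (auto simp: stable_curve_def smooth_curve_def nodes_on_def marks_on_def n_special_def)
qed

text \<open>
  A representative differs from \<open>smooth_curve q\<close> by a Moebius transformation, which multiplies all 2 by 2 determinants by the
  same factor.
\<close>
lemma smooth_curve_cross_ratio:
  assumes "(smooth_curve q, D) \<in> curve_iso X" "finite X" "(x, y, s, t) \<in> quadruples X"
  shows "curve_cross_ratio D (x, y, s, t) =
    proj_pt (vec2 (det2 (q x) (q s) * det2 (q y) (q t)) (det2 (q x) (q t) * det2 (q y) (q s)))"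
proof -
  obtain h \<phi> where st: "stable_curve X D" and h: "bij_betw h (comps (smooth_curve q)) (comps D)"
    and \<phi>: "\<And>v. v \<in> comps (smooth_curve q) \<Longrightarrow> \<phi> v \<in> moebius"
    and mc: "\<And>x. x \<in> X \<Longrightarrow> mark_comp D x = h (mark_comp (smooth_curve q) x)"
    and mp: "\<And>x. x \<in> X \<Longrightarrow> mark_pt D x = \<phi> (mark_comp (smooth_curve q) x) (mark_pt (smooth_curve q) x)"
    using curve_isoE[OF assms(1)] by metis
  interpret D: stable X D
    using st assms(2) by unfold_locales
  define u where "u = h 0"
  have comps: "comps D = {u}"
    using h by (simp add: bij_betw_def smooth_curve_def u_def)
  have xyst: "x \<in> X" "y \<in> X" "s \<in> X" "t \<in> X" "distinct [x, y, s, t]"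
    using assms(3) by (auto simp: quadruples_def)
  have mcu: "mark_comp D z = u" if "z \<in> X" for z
    using mc[OF that] by (simp add: smooth_curve_def u_def)
  have pr: "proj_to D u z = mark_pt D z" if "z \<in> X" for z
    using D.proj_to_mark[OF mcu[OF that]] .
  have "inj_on (proj_to D u) {x, y, s, t}"
  proof (rule inj_onI)
    fix z z' assume z: "z \<in> {x, y, s, t}" "z' \<in> {x, y, s, t}" "proj_to D u z = proj_to D u z'"
    then have "z \<in> X" "z' \<in> X"
      using xyst by auto
    then show "z = z'"
      using D.proj_to_eq_iff[of u z z'] comps z(3) mcu by simp
  qed
  then have "card (proj_to D u ` {x, y, s, t}) = 4"
    using xyst(5) by (simp add: card_image)
  then have "(SOME v. v \<in> comps D \<and> 3 \<le> card (proj_to D v ` {x, y, s, t})) = u"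
    unfolding comps by (intro some_equality) auto
  then have cr: "curve_cross_ratio D (x, y, s, t) =
      cross_ratio (mark_pt D x) (mark_pt D y) (mark_pt D s) (mark_pt D t)"
    unfolding curve_cross_ratio_def by (simp add: pr xyst)
  have "\<phi> 0 \<in> moebius"
    using \<phi>[of 0] by (simp add: smooth_curve_def)
  then obtain \<alpha> \<beta> \<gamma> \<delta> where m: "\<phi> 0 = (\<lambda>p. (\<lambda>v. vec2 (\<alpha> * v 0 + \<beta> * v 1) (\<gamma> * v 0 + \<delta> * v 1)) ` p)"
    "\<alpha> * \<delta> - \<beta> * \<gamma> \<noteq> 0"
    unfolding moebius_def by blast
  define M where "M v = vec2 (\<alpha> * v 0 + \<beta> * v 1) (\<gamma> * v 0 + \<delta> * v 1)" for v :: vec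
  have M: "mark_pt D z = proj_pt (M (q z))" if "z \<in> X" for z
  proof -
    have *: "M (\<lambda>i. c * v i) = (\<lambda>i. c * M v i)" for c v
      by (auto simp: M_def vec2_def fun_eq_iff algebra_simps)
    have "proj_pt v = (\<lambda>c i. c * v i) ` {c. c \<noteq> 0}" for v
      by (auto simp: proj_pt_def)
    then have "M ` proj_pt v = proj_pt (M v)" for v
      by (simp add: image_image *)
    then show ?thesis
      using mp[OF that] m(1) by (simp add: smooth_curve_def M_def)
  qed
  have det: "det2 (M v) (M w) = (\<alpha> * \<delta> - \<beta> * \<gamma>) * det2 v w" for v w
    by (simp add: M_def det2_def vec2_def algebra_simps)
  have "curve_cross_ratio D (x, y, s, t) = proj_pt (vec2
      ((\<alpha> * \<delta> - \<beta> * \<gamma>)\<^sup>2 * (det2 (q x) (q s) * det2 (q y) (q t)))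
      ((\<alpha> * \<delta> - \<beta> * \<gamma>)\<^sup>2 * (det2 (q x) (q t) * det2 (q y) (q s))))"
    unfolding cr M[OF xyst(1)] M[OF xyst(2)] M[OF xyst(3)] M[OF xyst(4)] cross_ratio_proj_pt det
    by (simp add: power2_eq_square mult_ac)
  then show ?thesis
    using proj_pt_vec2_scale m(2) by simp
qed

section \<open>Smoothing a trivalent curve\<close>

lemma limitin_ratio:
  assumes "(\<lambda>m. N m / D m) \<longlonglongrightarrow> c" "eventually (\<lambda>m. D m \<noteq> 0) sequentially"
  shows "limitin (proj_topology {0, 1}) (\<lambda>m. proj_pt (vec2 (N m) (D m))) (proj_pt (vec2 c 1)) sequentially"
proof (rule limitin_transform_eventually)
  show "limitin (proj_topology {0, 1}) (\<lambda>m. proj_pt (vec2 (N m / D m) 1)) (proj_pt (vec2 c 1)) sequentially"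
    by (intro limitin_proj_pt tendsto_vec2 assms tendsto_const) (simp_all add: vec2_in_vecs)
  show "eventually (\<lambda>m. proj_pt (vec2 (N m / D m) 1) = proj_pt (vec2 (N m) (D m))) sequentially"
    using assms(2)
  proof eventually_elim
    case (elim m)
    then show ?case
      using proj_pt_vec2_scale[of "D m" "N m / D m" 1] by simp
  qed
qed

lemma limitin_ratio_infinity:
  assumes "(\<lambda>m. D m / N m) \<longlonglongrightarrow> 0" "eventually (\<lambda>m. N m \<noteq> 0) sequentially"
  shows "limitin (proj_topology {0, 1}) (\<lambda>m. proj_pt (vec2 (N m) (D m))) (proj_pt (vec2 1 0)) sequentially"
proof (rule limitin_transform_eventually)
  show "limitin (proj_topology {0, 1}) (\<lambda>m. proj_pt (vec2 1 (D m / N m))) (proj_pt (vec2 1 0)) sequentially"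
    by (intro limitin_proj_pt tendsto_vec2 assms tendsto_const) (simp_all add: vec2_in_vecs)
  show "eventually (\<lambda>m. proj_pt (vec2 1 (D m / N m)) = proj_pt (vec2 (N m) (D m))) sequentially"
    using assms(2)
  proof eventually_elim
    case (elim m)
    then show ?case
      using proj_pt_vec2_scale[of "N m" 1 "D m / N m"] by simp
  qed
qed

lemma continuous_map_limitin:
  assumes "continuous_map S T f" "limitin S g l F"
  shows "limitin T (\<lambda>x. f (g x)) (f l) F"
  using continuous_map_limit[OF assms] by (simp add: o_def)

text \<open>
  If \<open>z\<^sub>j\<close> did not vanish at \<open>Y\<close>, then \<open>Y\<close> would have an open neighbourhood on which \<open>z\<^sub>l\<close> is at most a fixed multiple of
  \<open>z\<^sub>j\<close>, which \<open>ratio\<close> excludes for the points \<open>g m\<close>.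
\<close>
lemma limit_in_hyperplane:
  assumes lim: "limitin (proj_topology (coords r)) g Y sequentially"
    and g: "eventually (\<lambda>m. g m = proj_pt (p m)) sequentially"
    and j: "j \<in> coords r" and ratio: "(\<lambda>m. p m j / p m l) \<longlonglongrightarrow> 0" "eventually (\<lambda>m. p m l \<noteq> 0) sequentially"
  shows "Y \<in> coord_hyperplane r j"
proof -
  have "Y \<in> proj_space (coords r)"
    using limitin_topspace[OF lim] by simp
  then obtain z where z: "z \<in> vecs (coords r)" "Y = proj_pt z"
    unfolding proj_space_def by blast
  have "z j = 0"
  proof (rule ccontr)
    assume nz: "z j \<noteq> 0"
    \<comment> \<open>A positive number larger than the quotient at \<open>Y\<close>, which may be 0.\<close>
    define M where "M = norm (z l) / norm (z j) + 1"
    have M: "0 < M"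
      by (simp add: M_def add_nonneg_pos)
    define O' where "O' = {v :: vec. norm (v l) < M * norm (v j)}"
    define U where "U = proj_pt ` (vecs (coords r) \<inter> O')"
    have hom: "w \<in> O'" if wv: "proj_pt w = proj_pt v" "v \<in> O'" for v w
    proof -
      obtain t where t: "t \<noteq> 0" "w = (\<lambda>i. t * v i)"
        using proj_pt_eqD[OF wv(1)] by blast
      have "norm t * norm (v l) < norm t * (M * norm (v j))"
        using wv(2) t(1) by (simp add: O'_def)
      then show ?thesis
        by (simp add: O'_def t(2) norm_mult mult_ac)
    qed
    have "open O'"
      unfolding O'_def by (intro open_Collect_less continuous_intros continuous_on_product_coordinates)
    moreover have "{v \<in> vecs (coords r). proj_pt v \<in> U} = vecs (coords r) \<inter> O'"
      unfolding U_def using hom by blast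
    moreover have "U \<subseteq> proj_space (coords r)"
      unfolding U_def proj_space_def by blast
    ultimately have "openin (proj_topology (coords r)) U"
      unfolding openin_proj_topology by (auto simp: openin_open)
    moreover have "norm (z l) < M * norm (z j)"
      using nz by (simp add: M_def distrib_right)
    then have "Y \<in> U"
      unfolding U_def using z by (auto simp: O'_def)
    ultimately have "eventually (\<lambda>m. g m \<in> U) sequentially"
      using lim unfolding limitin_def by blast
    moreover have "eventually (\<lambda>m. norm (p m j / p m l) < 1 / M) sequentially"
      using tendstoD[OF ratio(1), of "1 / M"] M by (simp add: dist_norm)
    ultimately have "eventually (\<lambda>m. False) sequentially"
      using g ratio(2)
    proof eventually_elim
      case (elim m)
      have "p m \<in> O'"
        using elim(1,3) hom unfolding U_def by auto
      then have "norm (p m l) < M * norm (p m j)"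
        by (simp add: O'_def)
      then show False
        using elim(2,4) M by (simp add: norm_divide field_simps)
    qed
    then show False
      by simp
  qed
  then show ?thesis
    unfolding coord_hyperplane_def using z j by blast
qed

lemma finite_labels: "finite (labels n)"
  by (simp add: labels_def)

lemma card_labels: "card (labels n) = n + 3"
proof -
  have "labels n = {-2..int n}"
    by (auto simp: labels_def)
  then show ?thesis
    by simp
qed

context stable
begin

lemma proj_to_P1:
  assumes "v \<in> comps C" "x \<in> X"
  shows "proj_to C v x \<in> P1"
proof (cases "mc x = v")
  case True
  then have "mark_pt C x \<in> mark_pt C ` marks_on X C v"
    using assms(2) by (simp add: marks_on_iff)
  then show ?thesis
    using special_points(2)[OF assms(1)] proj_to_mark[OF True] by auto
next
  case False
  then obtain w where "{v, w} \<in> E" "proj_to C v x = node_pt C v w"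
    using proj_to_nodeE assms by metis
  moreover from this have "node_pt C v w \<in> node_pt C v ` nodes_on C v"
    by (simp add: nodes_on_iff)
  ultimately show ?thesis
    using special_points(1)[OF assms(1)] by auto
qed

end

locale trivalent_stable = stable "labels r" C for r C +
  assumes trivalent: "v \<in> comps C \<Longrightarrow> n_special (labels r) C v = 3" and r_pos: "1 \<le> r"
begin

abbreviation "X \<equiv> labels r"

lemma r_X: "int r \<in> X" and a_X: "label_a \<in> X" and a_neq_r: "label_a \<noteq> int r"
  using r_pos by (auto simp: labels_def)

sublocale branch_system "comps C" X "proj_to C" "int r"
proof
  show "card (proj_to C v ` X) = 3" if "v \<in> comps C" for v
    using card_proj_to trivalent that by simp
qed (use finite_V finite_X r_X proj_to_median proj_to_opposite in auto)

definition eps :: "nat \<Rightarrow> complex" where "eps m = inverse (of_nat (Suc m))"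

lemma eps: "eps \<longlonglongrightarrow> 0" "eps m \<noteq> 0"
proof -
  have "(\<lambda>m. complex_of_real (inverse (real (Suc m)))) \<longlonglongrightarrow> complex_of_real 0"
    by (intro tendsto_of_real LIMSEQ_inverse_real_of_nat)
  then show "eps \<longlonglongrightarrow> 0"
    by (simp add: eps_def[abs_def])
  show "eps m \<noteq> 0"
    by (simp add: eps_def del: of_nat_Suc)
qed

definition pos where "pos m x = position (eps m) x - position (eps m) label_a"

definition q where "q m x = (if x = int r then vec2 1 0 else vec2 (pos m x) 1)"

abbreviation "br m \<equiv> bracket (eps m)"

lemma det2_q: "det2 (q m x) (q m y) = br m x y"
  by (auto simp: q_def pos_def det2_def vec2_def bracket_def)

lemma br_antisym: "br m x y = - br m y x"
  by (simp add: det2_q[symmetric] det2_def)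

lemma br_pluecker: "br m x s * br m y t = br m x t * br m y s + br m x y * br m s t"
  by (simp add: det2_q[symmetric] det2_def algebra_simps)

lemma br_nonzero: "x \<in> X \<Longrightarrow> y \<in> X \<Longrightarrow> x \<noteq> y \<Longrightarrow> eventually (\<lambda>m. br m x y \<noteq> 0) sequentially"
  by (rule bracket_nonzero[OF _ _ _ eps])

definition smoothing :: "nat \<Rightarrow> curve set" where
  "smoothing m = curve_iso X `` {smooth_curve (q m)}"

lemma eventually_stable: "eventually (\<lambda>m. stable_curve X (smooth_curve (q m))) sequentially"
proof -
  have "eventually (\<lambda>m. \<forall>x\<in>X. \<forall>y\<in>X. x \<noteq> y \<longrightarrow> br m x y \<noteq> 0) sequentially"
  proof (intro eventually_ball_finite finite_X ballI)
    fix x y assume "x \<in> X" "y \<in> X"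
    then show "eventually (\<lambda>m. x \<noteq> y \<longrightarrow> br m x y \<noteq> 0) sequentially"
      using br_nonzero by (cases "x = y") simp_all
  qed
  then show ?thesis
  proof eventually_elim
    case (elim m)
    show ?case
    proof (rule stable_smooth_curve)
      show "det2 (q m x) (q m y) \<noteq> 0" if "x \<in> X" "y \<in> X" "x \<noteq> y" for x y
        using elim that by (simp add: det2_q)
    qed (auto simp: finite_X card_labels q_def vec2_in_vecs)
  qed
qed

lemma smoothing_self: "stable_curve X (smooth_curve (q m)) \<Longrightarrow> smooth_curve (q m) \<in> smoothing m"
  using curve_iso_refl by (simp add: smoothing_def)

lemma smoothing_moduli: "stable_curve X (smooth_curve (q m)) \<Longrightarrow> smoothing m \<in> moduli X"
  by (auto simp: moduli_def smoothing_def intro: quotientI)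

lemma smoothing_cross_ratio:
  assumes "stable_curve X (smooth_curve (q m))" "(x, y, s, t) \<in> quadruples X"
  shows "curve_cross_ratio (SOME D. D \<in> smoothing m) (x, y, s, t) =
    proj_pt (vec2 (br m x s * br m y t) (br m x t * br m y s))"
proof -
  have "(SOME D. D \<in> smoothing m) \<in> smoothing m"
    by (rule someI[of "\<lambda>D. D \<in> smoothing m", OF smoothing_self[OF assms(1)]])
  then have "(smooth_curve (q m), SOME D. D \<in> smoothing m) \<in> curve_iso X"
    by (simp add: smoothing_def)
  from smooth_curve_cross_ratio[OF this finite_X assms(2)] show ?thesis
    by (simp add: det2_q)
qed

text \<open>
  Trivalence makes exactly two of the four marked points coincide on the component that defines the cross-ratio, which is
  therefore 0, 1 or infinity.  If \<open>x, s\<close> or \<open>y, t\<close> or \<open>x, t\<close> or \<open>y, s\<close> coincide, \<open>bracket_ratio_limit\<close> applies to the cross-ratio or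
  to its inverse; in the remaining cases it applies to the difference from 1, by the Pluecker relation.
\<close>
lemma cross_ratio_limit:
  assumes quad: "(x, y, s, t) \<in> quadruples X"
  shows "limitin (proj_topology {0, 1}) (\<lambda>m. curve_cross_ratio (SOME D. D \<in> smoothing m) (x, y, s, t))
    (curve_cross_ratio C (x, y, s, t)) sequentially"
proof (rule limitin_transform_eventually)
  let ?N = "\<lambda>m. br m x s * br m y t" and ?D = "\<lambda>m. br m x t * br m y s"
  show "eventually (\<lambda>m. proj_pt (vec2 (?N m) (?D m)) = curve_cross_ratio (SOME D. D \<in> smoothing m) (x, y, s, t))
      sequentially"
    using eventually_stable by eventually_elim (use smoothing_cross_ratio[OF _ quad] in simp)
  have X: "x \<in> X" "y \<in> X" "s \<in> X" "t \<in> X" and dist: "distinct [x, y, s, t]"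
    using quad by (auto simp: quadruples_def)
  have nz: "eventually (\<lambda>m. ?N m \<noteq> 0) sequentially" "eventually (\<lambda>m. ?D m \<noteq> 0) sequentially"
    using eventually_conj[OF br_nonzero[of x s] br_nonzero[of y t]]
      eventually_conj[OF br_nonzero[of x t] br_nonzero[of y s]] X dist by auto
  define v where "v = (SOME v. v \<in> comps C \<and> 3 \<le> card (proj_to C v ` {x, y, s, t}))"
  have "\<exists>v. v \<in> comps C \<and> 3 \<le> card (proj_to C v ` {x, y, s, t})"
  proof -
    obtain v where v: "v \<in> comps C" "distinct [proj_to C v x, proj_to C v y, proj_to C v s]"
      using proj_to_median[of x y s] X dist by auto
    then have "3 = card {proj_to C v x, proj_to C v y, proj_to C v s}"
      by simp
    also have "\<dots> \<le> card (proj_to C v ` {x, y, s, t})"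
      by (intro card_mono) auto
    finally show ?thesis
      using v(1) by blast
  qed
  then have "v \<in> comps C \<and> 3 \<le> card (proj_to C v ` {x, y, s, t})"
    unfolding v_def by (rule someI_ex)
  then have v: "v \<in> comps C" and card: "3 \<le> card (proj_to C v ` {x, y, s, t})"
    by auto
  let ?p = "proj_to C v"
  note P1 = proj_to_P1[OF v X(1)] proj_to_P1[OF v X(2)] proj_to_P1[OF v X(3)] proj_to_P1[OF v X(4)]
  have cr: "curve_cross_ratio C (x, y, s, t) = cross_ratio (?p x) (?p y) (?p s) (?p t)"
    unfolding curve_cross_ratio_def Let_def case_prod_conv v_def[symmetric] ..
  note lim = bracket_ratio_limit[OF v _ _ _ _ _ _ _ eps]
  have at_least: "\<not> ?p ` {x, y, s, t} \<subseteq> {p, q}" for p q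
  proof
    assume "?p ` {x, y, s, t} \<subseteq> {p, q}"
    then have "card (?p ` {x, y, s, t}) \<le> card {p, q}"
      by (intro card_mono) auto
    also have "\<dots> \<le> 2"
      by (simp add: card_insert_if)
    finally show False
      using card by simp
  qed
  have at_most: "\<not> distinct [?p x, ?p y, ?p s, ?p t]"
  proof
    assume d: "distinct [?p x, ?p y, ?p s, ?p t]"
    have "4 = card {?p x, ?p y, ?p s, ?p t}"
      using d by simp
    also have "\<dots> \<le> card (?p ` X)"
      using X finite_X by (intro card_mono) auto
    finally show False
      using three[OF v] by simp
  qed
  have one: "limitin (proj_topology {0, 1}) (\<lambda>m. proj_pt (vec2 (?N m) (?D m))) (proj_pt (vec2 1 1)) sequentially"
    if "(\<lambda>m. br m x y * br m s t / (br m x t * br m s y)) \<longlonglongrightarrow> 0"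
  proof (rule limitin_ratio[OF Lim_transform_eventually nz(2)])
    show "(\<lambda>m. 1 - br m x y * br m s t / (br m x t * br m s y)) \<longlonglongrightarrow> 1"
      using tendsto_diff[OF tendsto_const that, of 1] by simp
    show "eventually (\<lambda>m. 1 - br m x y * br m s t / (br m x t * br m s y) = ?N m / ?D m) sequentially"
      using nz(2)
    proof eventually_elim
      case (elim m)
      then show ?case
        using br_antisym[of m s y] by (simp add: br_pluecker[of m x s y t] add_divide_distrib)
    qed
  qed
  from at_most consider "?p x = ?p s" | "?p y = ?p t" | "?p x = ?p t" | "?p y = ?p s" | "?p x = ?p y" | "?p s = ?p t"
    by auto
  then show "limitin (proj_topology {0, 1}) (\<lambda>m. proj_pt (vec2 (?N m) (?D m)))
      (curve_cross_ratio C (x, y, s, t)) sequentially"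
  proof cases
    case 1
    then have d: "distinct [?p x, ?p y, ?p t]"
      using at_least[of "?p x" "?p y"] at_least[of "?p x" "?p t"] by auto
    have "(\<lambda>m. ?N m / ?D m) \<longlonglongrightarrow> 0"
      using lim[of x s y t] 1 d X dist by simp
    then show ?thesis
      unfolding cr cross_ratio_degenerate(1)[OF P1 1 d] by (rule limitin_ratio[OF _ nz(2)])
  next
    case 2
    then have d: "distinct [?p x, ?p y, ?p s]"
      using at_least[of "?p x" "?p y"] at_least[of "?p s" "?p y"] by auto
    have "(\<lambda>m. ?N m / ?D m) \<longlonglongrightarrow> 0"
      using lim[of y t x s] 2 d X dist by (auto simp: mult.commute)
    then show ?thesis
      unfolding cr cross_ratio_degenerate(2)[OF P1 2 d] by (rule limitin_ratio[OF _ nz(2)])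
  next
    case 3
    then have d: "distinct [?p x, ?p y, ?p s]"
      using at_least[of "?p x" "?p y"] at_least[of "?p s" "?p x"] by auto
    have "(\<lambda>m. ?D m / ?N m) \<longlonglongrightarrow> 0"
      using lim[of x t y s] 3 d X dist by auto
    then show ?thesis
      unfolding cr cross_ratio_degenerate(3)[OF P1 3 d] by (rule limitin_ratio_infinity[OF _ nz(1)])
  next
    case 4
    then have d: "distinct [?p x, ?p y, ?p t]"
      using at_least[of "?p x" "?p y"] at_least[of "?p y" "?p t"] by auto
    have "(\<lambda>m. ?D m / ?N m) \<longlonglongrightarrow> 0"
      using lim[of y s x t] 4 d X dist by (auto simp: mult.commute)
    then show ?thesis
      unfolding cr cross_ratio_degenerate(4)[OF P1 4 d] by (rule limitin_ratio_infinity[OF _ nz(1)])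
  next
    case 5
    then have d: "distinct [?p x, ?p s, ?p t]"
      using at_least[of "?p x" "?p s"] at_least[of "?p x" "?p t"] by auto
    then show ?thesis
      unfolding cr cross_ratio_degenerate(5)[OF P1 5 d]
      using lim[of x y s t] 5 X dist by (intro one) auto
  next
    case 6
    then have d: "distinct [?p x, ?p y, ?p s]"
      using at_least[of "?p x" "?p s"] at_least[of "?p y" "?p s"] at_least[of "?p x" "?p y"] by auto
    then show ?thesis
      unfolding cr cross_ratio_degenerate(6)[OF P1 6 d]
      using lim[of s t x y] 6 X dist by (intro one) (auto simp: mult.commute)
  qed
qed

text \<open>
  The cross-ratios converge, and the topology of the moduli space is induced by them.
\<close>
lemma smoothing_limit:
  assumes "Q \<in> moduli X" "C = (SOME C. C \<in> Q)"
  shows "limitin (moduli_topology X) smoothing Q sequentially"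
proof -
  define f where "f = (\<lambda>P. \<lambda>q\<in>quadruples X. curve_cross_ratio (SOME C. C \<in> P) q)"
  let ?Y = "product_topology (\<lambda>_. proj_topology {0, 1}) (quadruples X)"
  have fin: "finite (quadruples X)"
    by (rule finite_subset[of _ "X \<times> X \<times> X \<times> X"]) (auto simp: quadruples_def finite_X)
  have comp: "limitin (proj_topology {0, 1}) (\<lambda>m. f (smoothing m) k) (f Q k) sequentially" if "k \<in> quadruples X" for k
    using that cross_ratio_limit unfolding f_def assms(2)[symmetric] by (cases k) simp
  have "eventually (\<lambda>m. \<forall>k\<in>quadruples X. f (smoothing m) k \<in> proj_space {0, 1}) sequentially"
  proof (intro eventually_ball_finite fin ballI)
    fix k assume "k \<in> quadruples X"
    from comp[OF this] show "eventually (\<lambda>m. f (smoothing m) k \<in> proj_space {0, 1}) sequentially"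
      using openin_topspace[of "proj_topology {0, 1}"] unfolding limitin_def topspace_proj_topology by blast
  qed
  then have "eventually (\<lambda>m. f (smoothing m) \<in> topspace ?Y) sequentially"
    by eventually_elim (auto simp: f_def PiE_iff)
  then have lim: "limitin ?Y (\<lambda>m. f (smoothing m)) (f Q) sequentially"
    unfolding limitin_componentwise using comp by (auto simp: f_def)
  have top: "moduli_topology X = pullback_topology (moduli X) f ?Y"
    by (simp add: moduli_topology_def f_def)
  show ?thesis
    unfolding limitin_def
  proof (intro conjI allI impI)
    show "Q \<in> topspace (moduli_topology X)"
      unfolding top topspace_pullback_topology using assms(1) limitin_topspace[OF lim] by simp
    fix U assume U: "openin (moduli_topology X) U \<and> Q \<in> U"
    then obtain W where W: "openin ?Y W" "U = f -` W \<inter> moduli X"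
      unfolding top openin_pullback_topology by blast
    then have "eventually (\<lambda>m. f (smoothing m) \<in> W) sequentially"
      using lim U unfolding limitin_def by blast
    then show "eventually (\<lambda>m. smoothing m \<in> U) sequentially"
      using eventually_stable by eventually_elim (use W(2) smoothing_moduli in simp)
  qed
qed

text \<open>
  In coordinates with \<open>a\<close> at 0 and \<open>r\<close> at infinity, the quotient of the coordinates of \<open>j\<close> and \<open>l\<close> is the cross-ratio of
  \<open>j, l, a, r\<close>.  On the component of \<open>r\<close>, the points of \<open>j\<close> and \<open>a\<close> coincide and those of \<open>a\<close>, \<open>l\<close>, \<open>r\<close> are different, so it tends
  to 0.
\<close>
lemma kapranov_hyperplane:
  assumes \<psi>: "kapranov_morphism r \<psi>" and Q: "Q \<in> moduli X" "C = (SOME C. C \<in> Q)"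
    and j: "j \<in> coords r" "proj_to C (mc (int r)) j = proj_to C (mc (int r)) label_a"
  shows "\<psi> Q \<in> coord_hyperplane r j"
proof -
  define v where "v = mc (int r)"
  have v: "v \<in> comps C"
    using mc_comps[OF r_X] by (simp add: v_def)
  obtain l where l: "l \<in> X" "proj_to C v l \<noteq> proj_to C v (int r)" "proj_to C v l \<noteq> proj_to C v label_a"
    by (rule third[OF v])
  have jX: "j \<in> X" "j \<noteq> label_a" "j \<noteq> int r"
    using j(1) r_pos by (auto simp: coords_def labels_def)
  have ra: "proj_to C v (int r) \<noteq> proj_to C v label_a"
    using proj_to_eq_iff[OF v r_X a_X] a_neq_r by (simp add: v_def)
  have lr: "l \<noteq> int r" "l \<noteq> label_a"
    using l(2,3) by auto
  then have l_coords: "l \<in> coords r"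
    using l(1) by (auto simp: coords_def labels_def)
  have "distinct [proj_to C v j, proj_to C v l, proj_to C v (int r)]"
    using l(2,3) ra j(2) by (auto simp: v_def)
  then have "(\<lambda>m. br m j label_a * br m l (int r) / (br m j (int r) * br m l label_a)) \<longlonglongrightarrow> 0"
    using bracket_ratio_limit[OF v _ _ jX(1) a_X l(1) r_X jX(2) eps] j(2) by (simp add: v_def)
  moreover have "br m l (int r) = -1" "br m j (int r) = -1" "br m j label_a = pos m j" "br m l label_a = pos m l" for m
    using jX lr a_neq_r by (simp_all add: bracket_def pos_def)
  ultimately have ratio: "(\<lambda>m. pos m j / pos m l) \<longlonglongrightarrow> 0"
    by simp
  have "eventually (\<lambda>m. br m l label_a \<noteq> 0) sequentially"
    using br_nonzero[OF l(1) a_X lr(2)] .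
  then have nz: "eventually (\<lambda>m. pos m l \<noteq> 0) sequentially"
    using lr a_neq_r by (simp add: bracket_def pos_def)
  have cont: "continuous_map (moduli_topology X) (proj_topology (coords r)) \<psi>"
    and int: "\<forall>P\<in>moduli X. \<forall>C\<in>P. \<forall>p :: label \<Rightarrow> complex.
        card (comps C) = 1 \<and> mark_pt C (int r) = infinity_pt \<and>
        (\<forall>x\<in>X - {int r}. mark_pt C x = affine_pt (p x)) \<and> p label_a = 0 \<longrightarrow>
        \<psi> P = proj_pt (\<lambda>j. if j \<in> coords r then p j else 0)"
    by (fact conjunct1[OF \<psi>[unfolded kapranov_morphism_def]], fact conjunct2[OF \<psi>[unfolded kapranov_morphism_def]])
  have "limitin (proj_topology (coords r)) (\<lambda>m. \<psi> (smoothing m)) (\<psi> Q) sequentially"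
    by (rule continuous_map_limitin[OF cont smoothing_limit[OF Q]])
  moreover have "eventually (\<lambda>m. \<psi> (smoothing m) = proj_pt (\<lambda>j. if j \<in> coords r then pos m j else 0)) sequentially"
    using eventually_stable
  proof eventually_elim
    case (elim m)
    have "card (comps (smooth_curve (q m))) = 1 \<and> mark_pt (smooth_curve (q m)) (int r) = infinity_pt \<and>
        (\<forall>x\<in>X - {int r}. mark_pt (smooth_curve (q m)) x = affine_pt (pos m x)) \<and> pos m label_a = 0"
      by (auto simp: smooth_curve_def q_def infinity_pt_def affine_pt_def pos_def)
    then show ?case
      using int[rule_format, OF smoothing_moduli[OF elim] smoothing_self[OF elim], of "pos m"] by blast
  qed
  ultimately show ?thesis
    by (rule limit_in_hyperplane[OF _ _ j(1), where l = l]) (use ratio nz j(1) l_coords in simp_all)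
qed

end

section \<open>The branches of the forgetful images\<close>

lemma moduli_nonempty: "P \<in> moduli X \<Longrightarrow> (SOME C. C \<in> P) \<in> P"
proof -
  assume "P \<in> moduli X"
  then obtain C where "stable_curve X C" "P = curve_iso X `` {C}"
    unfolding moduli_def quotient_def by blast
  then have "C \<in> P"
    using curve_iso_refl by blast
  then show ?thesis
    by (rule someI)
qed

lemma moduli_representatives:
  assumes "P \<in> moduli X" "finite X" "C \<in> P" "C' \<in> P"
  shows "branches X C = branches X C'" "trivalent_curve X C \<longleftrightarrow> trivalent_curve X C'"
proof -
  obtain C0 where "P = curve_iso X `` {C0}"
    using assms(1) unfolding moduli_def quotient_def by blast
  then have "(C0, C) \<in> curve_iso X" "(C0, C') \<in> curve_iso X"
    using assms(3,4) by auto
  note iso = curve_iso_branches[OF this(1) assms(2)] curve_iso_branches[OF this(2) assms(2)]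
  show "branches X C = branches X C'"
    using iso(1,3) by simp
  show "trivalent_curve X C \<longleftrightarrow> trivalent_curve X C'"
    using iso(2,4) by simp
qed

lemma branches_restrict:
  assumes "X' \<subseteq> X" "branches X C \<subseteq> branches X C'"
  shows "branches X' C \<subseteq> branches X' C'"
proof -
  have "branches X' C = (\<lambda>R. R \<inter> X' \<times> X') ` branches X C" for C
    unfolding branches_def same_branch_def image_image using assms(1) by (intro image_cong refl) auto
  then show ?thesis
    using assms(2) by (simp add: image_mono)
qed

lemma forget_trivalent:
  assumes Q: "Q \<in> moduli (labels (Suc m))" and C: "C = (SOME C. C \<in> Q)" "trivalent_curve (labels (Suc m)) C"
    and m: "1 \<le> m"
  shows "forget (Suc m) Q \<in> moduli (labels m)"
    and "D \<in> forget (Suc m) Q \<Longrightarrow> trivalent_curve (labels m) D \<and> branches (labels m) D \<subseteq> branches (labels m) C"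
proof -
  let ?X = "labels (Suc m)" and ?i = "int (Suc m)"
  have X: "labels m = ?X - {?i}"
    by (auto simp: labels_def)
  interpret forget_point ?X C ?i
    using C(2) m by unfold_locales (auto simp: trivalent_curve_def finite_labels card_labels labels_def)
  have forget: "forget (Suc m) Q = curve_iso (labels m) `` {F}"
    by (simp only: forget_def F_def diff_Suc_1 C(1)[symmetric])
  have F: "trivalent_curve (labels m) F"
    using F_trivalent by (simp add: X)
  then show "forget (Suc m) Q \<in> moduli (labels m)"
    unfolding forget moduli_def by (intro quotientI) (simp add: trivalent_curve_def)
  have "branches (labels m) F \<subseteq> branches (labels m) C"
  proof
    fix R assume "R \<in> branches (labels m) F"
    then obtain v where v: "v \<in> comps F" "R = same_branch (labels m) F v"
      unfolding branches_def by blast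
    have "R = same_branch (labels m) C v"
      using F_proj_to_eq[OF v(1)] unfolding v(2) X same_branch_def by auto
    moreover have "v \<in> comps C"
      using v(1) unfolding F_simps by blast
    ultimately show "R \<in> branches (labels m) C"
      unfolding branches_def by blast
  qed
  then show "trivalent_curve (labels m) D \<and> branches (labels m) D \<subseteq> branches (labels m) C"
    if "D \<in> forget (Suc m) Q"
    using that F curve_iso_branches[of F D "labels m"] finite_labels unfolding forget by simp
qed

text \<open>
  Every component that survives the forgetting is one of the components of the original curve, with its branches
  restricted to the remaining labels.
\<close>
lemma iterated_forget:
  assumes P: "P \<in> moduli (labels n)" "C0 \<in> P" "trivalent_curve (labels n) C0" and r: "1 \<le> r" "r \<le> n"
  defines "Q \<equiv> foldr forget [Suc r..<Suc n] P"
  shows "Q \<in> moduli (labels r) \<and>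
    (\<forall>C\<in>Q. trivalent_curve (labels r) C \<and> branches (labels r) C \<subseteq> branches (labels r) C0)"
  unfolding Q_def using r(2)
proof (induction rule: inc_induct)
  case base
  have "trivalent_curve (labels n) C \<and> branches (labels n) C \<subseteq> branches (labels n) C0" if "C \<in> P" for C
    using moduli_representatives[OF P(1) finite_labels that P(2)] P(3) by simp
  then show ?case
    using P(1) by simp
next
  case (step m)
  define Q where "Q = foldr forget [Suc (Suc m)..<Suc n] P"
  define C where "C = (SOME C. C \<in> Q)"
  have IH: "Q \<in> moduli (labels (Suc m))"
    "\<And>C. C \<in> Q \<Longrightarrow> trivalent_curve (labels (Suc m)) C \<and> branches (labels (Suc m)) C \<subseteq> branches (labels (Suc m)) C0"
    using step.IH unfolding Q_def by blast+
  have C: "trivalent_curve (labels (Suc m)) C" "branches (labels (Suc m)) C \<subseteq> branches (labels (Suc m)) C0"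
    using IH(2)[of C] moduli_nonempty[OF IH(1)] unfolding C_def by auto
  have m: "1 \<le> m"
    using step.hyps r(1) by simp
  have "branches (labels m) C \<subseteq> branches (labels m) C0"
    by (rule branches_restrict[OF _ C(2)]) (auto simp: labels_def)
  moreover have "foldr forget [Suc m..<Suc n] P = forget (Suc m) Q"
    using step.hyps unfolding Q_def by (simp add: upt_conv_Cons del: upt_Suc)
  ultimately show ?case
    using forget_trivalent(1)[OF IH(1) C_def C(1) m] forget_trivalent(2)[OF IH(1) C_def C(1) m]
    by (metis order_trans)
qed

section \<open>The hyperplanes\<close>

theorem theorem1p8:
  fixes n r :: nat and k :: "nat \<Rightarrow> nat" and \<psi> :: "nat \<Rightarrow> curve set \<Rightarrow> point"
    and T :: "'v ltree" and P :: "curve set"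
  assumes "1 \<le> n" and "(\<Sum>i=1..n. k i) = n" and "1 \<le> r" and "r \<le> n"
    and "\<forall>s\<in>{1..n}. kapranov_morphism s (\<psi> s)"
    and "T \<in> tour n k" and "has_dual_tree (labels n) P T"
  shows "\<forall>j\<in>{label_b..int (k r) - 2}. Phi n \<psi> P r \<in> coord_hyperplane r j"
proof
  fix j assume j: "j \<in> {label_b..int (k r) - 2}"
  obtain C0 where P: "P \<in> moduli (labels n)" and C0: "C0 \<in> P" "ltree_iso (labels n) (dual_tree (labels n) C0) T"
    using assms(7) unfolding has_dual_tree_def by blast
  have T: "trivalent T"
    using assms(6) unfolding tour_def by blast
  have "stable_curve (labels n) C0"
    using P C0(1) unfolding moduli_def quotient_def curve_iso_def by auto
  then interpret C0: stable "labels n" C0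
    by unfold_locales (rule finite_labels)
  define Q where "Q = foldr forget [Suc r..<Suc n] P"
  define C where "C = (SOME C. C \<in> Q)"
  note C0_T = C0.dual_tree_iso[OF C0(2) T]
  have Q: "Q \<in> moduli (labels r)"
    "\<And>C. C \<in> Q \<Longrightarrow> trivalent_curve (labels r) C \<and> branches (labels r) C \<subseteq> branches (labels r) C0"
    using iterated_forget[OF P C0(1) C0_T(1) assms(3,4)] unfolding Q_def by blast+
  then have C: "trivalent_curve (labels r) C" "branches (labels r) C \<subseteq> branches (labels r) C0"
    using moduli_nonempty[OF Q(1)] unfolding C_def by auto
  interpret C: trivalent_stable r C
    using C(1) assms(3) by unfold_locales (auto simp: trivalent_curve_def finite_labels)
  define v where "v = mark_comp C (int r)"
  have v: "v \<in> comps C"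
    unfolding v_def by (rule C.mc_comps[OF C.r_X])
  then obtain u where u: "u \<in> comps C0" "same_branch (labels r) C v = same_branch (labels r) C0 u"
    using C(2) unfolding branches_def by blast
  \<comment> \<open>The vertex of the tree that becomes the component of \<open>r\<close> when \<open>r + 1, \<dots>, n\<close> are forgotten.\<close>
  obtain t where t: "t \<in> verts T" "card (edges_at T t) = 3"
    "\<forall>x\<in>labels n. \<forall>y\<in>labels n. linked (edges T) t (leaf T x) (leaf T y) \<longrightarrow> proj_to C0 u x = proj_to C0 u y"
    using C0_T(2)[OF u(1)] by blast
  have sep: "\<not> linked (edges T) t (leaf T x) (leaf T y)"
    if "x \<in> labels r" "y \<in> labels r" "proj_to C v x \<noteq> proj_to C v y" for x y
  proof -
    have "proj_to C0 u x \<noteq> proj_to C0 u y"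
      using arg_cong[OF u(2), of "\<lambda>R. (x, y) \<in> R"] that by (simp add: same_branch_def)
    moreover have "x \<in> labels n" "y \<in> labels n"
      using that assms(4) by (auto simp: labels_def)
    ultimately show ?thesis
      using t(3) by blast
  qed
  have alone: "proj_to C v (int r) \<noteq> proj_to C v x" if "x \<in> labels r" "x \<noteq> int r" for x
    using C.proj_to_eq_iff[OF v C.r_X that(1)] that(2) by (simp add: v_def)
  have wins: "int (k r) \<le> s + 1"
    if "s \<in> labels r" "s \<noteq> label_a" "proj_to C v s \<noteq> proj_to C v label_a" for s
  proof (rule wins_le[OF assms(6,3,4) _ that(2) t(1,2)])
    show "s \<in> labels n"
      using that(1) assms(4) by (auto simp: labels_def)
    show "\<not> linked (edges T) t (leaf T s) (leaf T label_a)"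
      by (rule sep[OF that(1) C.a_X that(3)])
    show "\<not> linked (edges T) t (leaf T (int r)) (leaf T label_a)"
      by (rule sep[OF C.r_X C.a_X alone[OF C.a_X C.a_neq_r]])
    show "\<not> linked (edges T) t (leaf T (int r)) (leaf T x)" if "x \<in> labels n" "x < int r" for x
    proof -
      have "x \<in> labels r" "x \<noteq> int r"
        using that by (auto simp: labels_def)
      then show ?thesis
        using sep C.r_X alone by blast
    qed
  qed
  \<comment> \<open>With \<open>s = r\<close> the bound shows that \<open>j\<close> does index a coordinate.\<close>
  have "int (k r) \<le> int r + 1"
    using wins[OF C.r_X C.a_neq_r[symmetric] alone[OF C.a_X C.a_neq_r]] .
  then have coords: "j \<in> coords r"
    using j by (auto simp: coords_def)
  have "proj_to C v j = proj_to C v label_a"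
  proof (rule ccontr)
    assume "proj_to C v j \<noteq> proj_to C v label_a"
    moreover have "j \<in> labels r" "j \<noteq> label_a"
      using coords assms(3) by (auto simp: coords_def labels_def)
    ultimately have "int (k r) \<le> j + 1"
      using wins by blast
    then show False
      using j by simp
  qed
  moreover have "kapranov_morphism r (\<psi> r)"
    using assms(3-5) by simp
  ultimately have "\<psi> r Q \<in> coord_hyperplane r j"
    using C.kapranov_hyperplane[OF _ Q(1) C_def coords] by (simp add: v_def)
  then show "Phi n \<psi> P r \<in> coord_hyperplane r j"
    using assms(3,4) by (simp add: Phi_def Q_def)
qed

end
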